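(* Let $\alpha\in(1,2)$, $\gamma\in[1,\alpha)$, and let $\beta\ge0$ satisfy $\beta<1+\frac{\gamma-1}{\alpha}$. Let $F:\mathbb{R}\to\mathbb{R}$ be continuous with $F(\lambda v)=\lambda^{\gamma}F(v)$ for all $v\in\mathbb{R}$, $\lambda>0$, and $vF(v)\ge0$ for all $v\in\mathbb{R}$. Let $L$ be the $\alpha$-stable Lévy process described in the context, let $t_0>0$, $v_0>0$, $x_0\in\mathbb{R}$, and let $(V_t,X_t)_{t\ge t_0}$ be the solution to $$\mathrm{d}V_t=\mathrm{d}L_t-t^{-\beta}F(V_t)\,\mathrm{d}t,\quad V_{t_0}=v_0,\qquad \mathrm{d}X_t=V_t\,\mathrm{d}t,\quad X_{t_0}=x_0 .$$ Define $q:=\frac{\beta}{\alpha+\gamma-1}<\frac1\alpha$. Call $\widehat H$ the ergodic process solving the following SDE driven by an $\alpha$-stable process $(R_t)_{t\ge0}$ with the same distribution as $L$, and starting at its invariant measure: $$\mathrm{d}H_s=\mathrm{d}R_s-F(H_s)\,\mathrm{d}s .$$ Call $\Pi_F$ its invariant measure. Let $(\mathscr{V}_t)_{t\ge0}$ be the process whose finite-dimensional distributions (at times $t_1,\dots,t_d$) are the pushforward of $\Pi_F^{\otimes d}$ by the linear map $T(u_1,\dots,u_d):=(t_1^{q}u_1,\dots,t_d^{q}u_d)$. Then, as $\varepsilon\to0$, $(\varepsilon^{q}V_{t/\varepsilon})_{t\ge\varepsilon t_0}$ converges to $(\mathscr{V}_t)_{t\ge0}$ in the sense of finite-dimensional 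distributions.
   Context: $L$ is the $\alpha$-stable Lévy process, $\alpha\in(1,2)$, with Lévy measure $\nu(\mathrm{d}z)=|z|^{-1-\alpha}[a_+\mathbb{1}_{\{z>0\}}+a_-\mathbb{1}_{\{z<0\}}]\mathrm{d}z$, $a_+,a_-\ge0$, given by $L_t=\int_0^t\int_{\mathbb{R}^*}z\,\widetilde N(\mathrm{d}s,\mathrm{d}z)$, where $\widetilde N$ is the compensated Poisson random measure of its jumps (intensity $\mathrm{d}s\,\nu(\mathrm{d}z)$). Convergence of $(Z^{(\varepsilon)}_t)$ to $(Z_t)$ in the sense of finite-dimensional distributions means that, for every finite subset $S\subset(0,+\infty)$, the vector $(Z^{(\varepsilon)}_t)_{t\in S}$ converges in distribution to $(Z_t)_{t\in S}$ in $\mathbb{R}^S$ as $\varepsilon\to0$. *)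

theory Defs
  imports "HOL-Probability.Probability"
begin

section \<open>Poisson random measures and the stable Levy process\<close>

definition poisson_random_measure ::
  "'a measure \<Rightarrow> ('a \<Rightarrow> 'b measure) \<Rightarrow> 'b measure \<Rightarrow> bool" where
  "poisson_random_measure M N m \<longleftrightarrow>
     (\<forall>\<omega>\<in>space M. sets (N \<omega>) = sets m) \<and>
     (\<forall>A\<in>sets m. (\<lambda>\<omega>. emeasure (N \<omega>) A) \<in> borel_measurable M) \<and>
     (\<forall>A\<in>sets m. emeasure m A < \<infinity> \<longrightarrow>
        (\<forall>k::nat. measure M {\<omega> \<in> space M. emeasure (N \<omega>) A = of_nat k}
           = measure m A ^ k / fact k * exp (- measure m A))) \<and>
     (\<forall>(I::nat set) A. finite I \<longrightarrow> (\<forall>i\<in>I. A i \<in> sets m) \<longrightarrow> disjoint_family_on A I \<longrightarrow>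
        prob_space.indep_vars M (\<lambda>_. borel) (\<lambda>i \<omega>. emeasure (N \<omega>) (A i)) I)"

definition cadlag :: "(real \<Rightarrow> real) \<Rightarrow> bool" where
  "cadlag l \<longleftrightarrow>
     (\<forall>t\<ge>0. (l \<longlongrightarrow> l t) (at_right t)) \<and> (\<forall>t>0. \<exists>x. (l \<longlongrightarrow> x) (at_left t))"

definition jump :: "(real \<Rightarrow> real) \<Rightarrow> real \<Rightarrow> real" where
  "jump l s = l s - Lim (at_left s) l"

text \<open>The sum of the Dirac masses at the points \<open>(s, \<Delta>l\<^sub>s)\<close>, over the jump times
  \<open>s > 0\<close> of the path.\<close>

definition jump_measure :: "(real \<Rightarrow> real) \<Rightarrow> (real \<times> real) measure" where
  "jump_measure l =
     distr (count_space {s. 0 < s \<and> jump l s \<noteq> 0}) borel (\<lambda>s. (s, jump l s))"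

definition stable_levy_measure :: "real \<Rightarrow> real \<Rightarrow> real \<Rightarrow> real measure" where
  "stable_levy_measure \<alpha> a\<^sub>p a\<^sub>m =
     density lborel (\<lambda>z. ennreal (\<bar>z\<bar> powr (- 1 - \<alpha>) *
       (a\<^sub>p * indicator {0<..} z + a\<^sub>m * indicator {..<0} z)))"

definition jump_intensity :: "real measure \<Rightarrow> (real \<times> real) measure" where
  "jump_intensity \<nu> = density lborel (indicator {0<..}) \<Otimes>\<^sub>M \<nu>"

definition levy_process :: "'a measure \<Rightarrow> (real \<Rightarrow> 'a \<Rightarrow> real) \<Rightarrow> bool" where
  "levy_process M L \<longleftrightarrow>
     prob_space M \<and>
     (\<forall>t\<ge>0. L t \<in> borel_measurable M) \<and>
     (\<forall>\<omega>\<in>space M. L 0 \<omega> = 0 \<and> cadlag (\<lambda>t. L t \<omega>)) \<and>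
     (\<forall>(n::nat) t. 0 \<le> t 0 \<longrightarrow> mono_on {..n} t \<longrightarrow>
        prob_space.indep_vars M (\<lambda>_. borel) (\<lambda>i \<omega>. L (t (Suc i)) \<omega> - L (t i) \<omega>) {..<n}) \<and>
     (\<forall>s\<ge>0. \<forall>t\<ge>0. distr M borel (\<lambda>\<omega>. L (s + t) \<omega> - L s \<omega>) = distr M borel (L t))"

text \<open>The integral of \<open>z\<close> over \<open>(0, t] \<times> {\<bar>z\<bar> > \<delta>}\<close> against \<open>n - m\<close>.\<close>

definition compensated_jumps ::
  "(real \<times> real) measure \<Rightarrow> (real \<times> real) measure \<Rightarrow> real \<Rightarrow> real \<Rightarrow> real" where
  "compensated_jumps n m \<delta> t =
     (LINT p : {0<..t} \<times> {z. \<delta> < \<bar>z\<bar>} | n. snd p) -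
     (LINT p : {0<..t} \<times> {z. \<delta> < \<bar>z\<bar>} | m. snd p)"

text \<open>The last clause says that \<open>L\<^sub>t\<close> is the integral of \<open>z\<close> over \<open>(0, t] \<times> \<real>\<^sup>*\<close> against the
  compensated jump measure. For \<open>1 < \<alpha> < 2\<close> the jumps larger than \<open>\<delta>\<close> are integrable, and the
  remaining compensated small jumps are an \<open>L\<^sup>2\<close> limit in the sense of Ito.\<close>

definition stable_levy_process ::
  "'a measure \<Rightarrow> real \<Rightarrow> real \<Rightarrow> real \<Rightarrow> (real \<Rightarrow> 'a \<Rightarrow> real) \<Rightarrow> bool" where
  "stable_levy_process M \<alpha> a\<^sub>p a\<^sub>m L \<longleftrightarrow>
     (let m = jump_intensity (stable_levy_measure \<alpha> a\<^sub>p a\<^sub>m);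
          N = (\<lambda>\<omega>. jump_measure (\<lambda>t. L t \<omega>))
      in levy_process M L \<and>
         poisson_random_measure M N m \<and>
         (\<forall>t\<ge>0. ((\<lambda>\<delta>. \<integral>\<^sup>+\<omega>. ennreal ((L t \<omega> - compensated_jumps (N \<omega>) m \<delta> t)\<^sup>2) \<partial>M)
                    \<longlongrightarrow> 0) (at_right 0)))"

section \<open>Equations with additive noise\<close>

text \<open>\<open>dV\<^sub>t = dL\<^sub>t + b(t, V\<^sub>t) dt\<close> on \<open>[t\<^sub>0, \<infinity>)\<close>, in integral form. The noise being additive,
  no stochastic integral is involved.\<close>

definition additive_sde_solution ::
  "'a measure \<Rightarrow> real \<Rightarrow> (real \<Rightarrow> real \<Rightarrow> real) \<Rightarrow> (real \<Rightarrow> 'a \<Rightarrow> real) \<Rightarrow> (real \<Rightarrow> 'a \<Rightarrow> real) \<Rightarrow> bool"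
  where
  "additive_sde_solution M t\<^sub>0 b L V \<longleftrightarrow>
     (\<forall>t\<ge>t\<^sub>0. V t \<in> borel_measurable M) \<and>
     (AE \<omega> in M. \<forall>t\<ge>t\<^sub>0.
        set_integrable lborel {t\<^sub>0..t} (\<lambda>s. b s (V s \<omega>)) \<and>
        V t \<omega> = V t\<^sub>0 \<omega> + (L t \<omega> - L t\<^sub>0 \<omega>) + (LINT s:{t\<^sub>0..t}|lborel. b s (V s \<omega>)))"

definition kinetic_solution ::
  "'a measure \<Rightarrow> real \<Rightarrow> real \<Rightarrow> real \<Rightarrow> real \<Rightarrow> (real \<Rightarrow> real) \<Rightarrow>
   (real \<Rightarrow> 'a \<Rightarrow> real) \<Rightarrow> (real \<Rightarrow> 'a \<Rightarrow> real) \<Rightarrow> (real \<Rightarrow> 'a \<Rightarrow> real) \<Rightarrow> bool" where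
  "kinetic_solution M t\<^sub>0 v\<^sub>0 x\<^sub>0 \<beta> F L V X \<longleftrightarrow>
     additive_sde_solution M t\<^sub>0 (\<lambda>t v. - (t powr (- \<beta>) * F v)) L V \<and>
     (AE \<omega> in M. V t\<^sub>0 \<omega> = v\<^sub>0) \<and>
     (\<forall>t\<ge>t\<^sub>0. X t \<in> borel_measurable M) \<and>
     (AE \<omega> in M. \<forall>t\<ge>t\<^sub>0. set_integrable lborel {t\<^sub>0..t} (\<lambda>s. V s \<omega>) \<and>
        X t \<omega> = x\<^sub>0 + (LINT s:{t\<^sub>0..t}|lborel. V s \<omega>))"

section \<open>Invariant measure and ergodic process\<close>

text \<open>Invariance under the Markov semigroup of \<open>dH\<^sub>s = dR\<^sub>s - F(H\<^sub>s) ds\<close>: \<open>H x\<close> is the solution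
  started at \<open>x\<close>, so the law of \<open>H x s\<close> is the transition probability from \<open>x\<close> in time \<open>s\<close>.\<close>

definition invariant_measure ::
  "'a measure \<Rightarrow> (real \<Rightarrow> 'a \<Rightarrow> real) \<Rightarrow> (real \<Rightarrow> real) \<Rightarrow> real measure \<Rightarrow> bool" where
  "invariant_measure M R F \<mu> \<longleftrightarrow>
     prob_space \<mu> \<and> sets \<mu> = sets borel \<and>
     (\<exists>H. (\<forall>x. additive_sde_solution M 0 (\<lambda>_ h. - F h) R (H x) \<and> (AE \<omega> in M. H x 0 \<omega> = x)) \<and>
          (\<forall>s\<ge>0. \<forall>A\<in>sets borel.
             (\<integral>\<^sup>+x. emeasure (distr M borel (H x s)) A \<partial>\<mu>) = emeasure \<mu> A))"

abbreviation path_space :: "(real \<Rightarrow> real) measure" where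
  "path_space \<equiv> \<Pi>\<^sub>M t\<in>{0..}. borel"

definition path :: "(real \<Rightarrow> 'a \<Rightarrow> real) \<Rightarrow> 'a \<Rightarrow> real \<Rightarrow> real" where
  "path H \<omega> = (\<lambda>t\<in>{0..}. H t \<omega>)"

definition path_law :: "'a measure \<Rightarrow> (real \<Rightarrow> 'a \<Rightarrow> real) \<Rightarrow> (real \<Rightarrow> real) measure" where
  "path_law M H = distr M path_space (path H)"

definition shift :: "real \<Rightarrow> (real \<Rightarrow> real) \<Rightarrow> real \<Rightarrow> real" where
  "shift s x = (\<lambda>t\<in>{0..}. x (s + t))"

definition stationary_process :: "'a measure \<Rightarrow> (real \<Rightarrow> 'a \<Rightarrow> real) \<Rightarrow> bool" where
  "stationary_process M H \<longleftrightarrow>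
     (\<forall>s\<ge>0. distr (path_law M H) path_space (shift s) = path_law M H)"

text \<open>Invariance of events is required only up to null sets: a set of the product \<open>\<sigma>\<close>-algebra
  depends on countably many coordinates, so that the strictly shift invariant ones are trivial.\<close>

definition ergodic_process :: "'a measure \<Rightarrow> (real \<Rightarrow> 'a \<Rightarrow> real) \<Rightarrow> bool" where
  "ergodic_process M H \<longleftrightarrow>
     stationary_process M H \<and>
     (\<forall>A\<in>sets path_space.
        (\<forall>s\<ge>0. measure (path_law M H) (sym_diff A (shift s -` A \<inter> space path_space)) = 0) \<longrightarrow>
        measure (path_law M H) A = 0 \<or> measure (path_law M H) A = 1)"

definition ergodic_solution ::
  "'a measure \<Rightarrow> (real \<Rightarrow> 'a \<Rightarrow> real) \<Rightarrow> (real \<Rightarrow> real) \<Rightarrow> real measure \<Rightarrow> (real \<Rightarrow> 'a \<Rightarrow> real) \<Rightarrow> bool"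
  where
  "ergodic_solution M R F \<mu> H \<longleftrightarrow>
     additive_sde_solution M 0 (\<lambda>_ h. - F h) R H \<and>
     prob_space.indep_set M (sets (vimage_algebra (space M) (H 0) borel))
       (sets (vimage_algebra (space M) (path R) path_space)) \<and>
     distr M borel (H 0) = \<mu> \<and>
     ergodic_process M H \<and>
     invariant_measure M R F \<mu> \<and>
     (\<forall>\<mu>'. invariant_measure M R F \<mu>' \<longrightarrow> \<mu>' = \<mu>)"

section \<open>Convergence of finite-dimensional distributions\<close>

definition fdd :: "'a measure \<Rightarrow> (real \<Rightarrow> 'a \<Rightarrow> real) \<Rightarrow> real set \<Rightarrow> (real \<Rightarrow> real) measure" where
  "fdd M Z S = distr M (\<Pi>\<^sub>M t\<in>S. borel) (\<lambda>\<omega>. \<lambda>t\<in>S. Z t \<omega>)"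

definition converges_weakly ::
  "'x topology \<Rightarrow> ('e \<Rightarrow> 'x measure) \<Rightarrow> 'x measure \<Rightarrow> 'e filter \<Rightarrow> bool" where
  "converges_weakly T m m' G \<longleftrightarrow>
     (\<forall>f. continuous_map T euclideanreal f \<longrightarrow> bounded (f ` topspace T) \<longrightarrow>
        ((\<lambda>e. \<integral>x. f x \<partial>m e) \<longlongrightarrow> (\<integral>x. f x \<partial>m')) G)"

definition fdd_converges ::
  "'a measure \<Rightarrow> (real \<Rightarrow> real \<Rightarrow> 'a \<Rightarrow> real) \<Rightarrow> 'b measure \<Rightarrow> (real \<Rightarrow> 'b \<Rightarrow> real) \<Rightarrow> bool" where
  "fdd_converges M Z M' Z' \<longleftrightarrow>
     (\<forall>S. finite S \<longrightarrow> S \<subseteq> {0<..} \<longrightarrow>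
        converges_weakly (product_topology (\<lambda>_. euclideanreal) S)
          (\<lambda>\<epsilon>. fdd M (Z \<epsilon>) S) (fdd M' Z' S) (at_right 0))"

text \<open>The pushforward of the product of copies of \<open>\<mu>\<close> by \<open>(u\<^sub>t) \<mapsto> (t\<^sup>q u\<^sub>t)\<close>.
  Meant for positive times: \<open>0 powr 0\<close> is \<open>0\<close>.\<close>

definition scaled_product :: "real measure \<Rightarrow> real \<Rightarrow> real set \<Rightarrow> (real \<Rightarrow> real) measure" where
  "scaled_product \<mu> q S =
     distr (\<Pi>\<^sub>M t\<in>S. \<mu>) (\<Pi>\<^sub>M t\<in>S. borel) (\<lambda>u. \<lambda>t\<in>S. t powr q * u t)"

end

(*
Homogeneity and the sign condition make F nondecreasing, so two solutions driven by the same noise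
contract. On the window [tau - sigma tau^(q alpha), tau], with tau = t / eps and
sigma = (ln (1 / eps))^2, self-similarity of the noise turns the equation for V / tau^q into
dH = dR - F(H) ds over a time sigma, up to the factor (s / tau)^(- beta) of the drift, which tends to 1
because q alpha < 1. Since sigma tends to infinity, the contraction forgets the value of V at the start
of the window, whose size is controlled by the maximum of the noise; the error made by freezing the
factor is O(sigma^2 tau^(- (alpha - gamma) (1 / alpha - q))). Hence V_tau / tau^q is close to a
functional of the increments of L on the window, whose law is close to Pi_F by the same contraction
applied to the stationary solution. Windows belonging to different times are disjoint, which gives the
independence in the limit. The functional is an implicit Euler scheme: it is a contraction as well,
and its law is determined by the law of the increments, so that no solution has to be constructed.
The contraction is strict because uniqueness of the invariant measure excludes that F vanishes on a
half-line.
*)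

theory Submission
  imports Defs "HOL-Real_Asymp.Real_Asymp"
begin

section \<open>The implicit Euler scheme\<close>

text \<open>For \<gamma> > 1 the drift is flat at 0, so the contraction is linear only up to a slack
  \<eta>, with a rate k that vanishes together with \<eta>. The rescaled velocity at the start of a
  window is only known to be of order \<tau> powr (1 / \<alpha> - q). A length \<sigma> of order ln
  \<tau> would beat this power only for large k; with the square, exp (- k * \<sigma>) beats every
  power for every k > 0, while \<sigma>^2 still loses against the power in the freezing error, which
  is negative because \<gamma> < \<alpha> and q < 1 / \<alpha>. The velocity and the stationary
  process live on different spaces, and solutions are given, not built as measurable functions of
  their noise, so equality in law of the noises says nothing directly about them. An explicit
  function of finitely many increments carries it over. The number of its steps is fixed last, for
  each given T = 1 / \<epsilon>, from pathwise convergence, so no rate uniform in T enters. The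
  stationary initial value has no known moments, hence tightness and truncation in place of
  expectations.\<close>

lemma cadlag_bounded_on:
  assumes "cadlag l" "0 \<le> a"
  shows "\<exists>K. \<forall>s\<in>{a..b}. \<bar>l s\<bar> \<le> K"
proof (cases "a \<le> b")
  case True
  \<comment> \<open>The guard \<open>0 \<le> s\<close> is there because \<open>cadlag\<close> says
    nothing at negative times, while the neighbourhoods in the bisection argument may reach below 0;
    at \<open>x = 0\<close> it makes the left side vacuous.\<close>
  define P where "P = (\<lambda>c d. \<exists>K. \<forall>s\<in>{c..d}. 0 \<le> s \<longrightarrow> \<bar>l s\<bar> \<le> K)"
  have "P a b"
    using True
  proof (induction rule: Bolzano)
    case (trans u v w)
    then obtain K K' where "\<forall>s\<in>{u..v}. 0 \<le> s \<longrightarrow> \<bar>l s\<bar> \<le> K" "\<forall>s\<in>{v..w}. 0 \<le> s \<longrightarrow> \<bar>l s\<bar> \<le> K'"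
      unfolding P_def by blast
    then have "\<forall>s\<in>{u..w}. 0 \<le> s \<longrightarrow> \<bar>l s\<bar> \<le> max K K'"
      by (metis atLeastAtMost_iff le_max_iff_disj linear)
    then show ?case
      unfolding P_def by blast
  next
    case (local x)
    then have "0 \<le> x"
      using assms by simp
    then have "(l \<longlongrightarrow> l x) (at_right x)"
      using assms by (simp add: cadlag_def)
    then have "\<forall>\<^sub>F s in at_right x. dist (l s) (l x) < 1"
      by (rule tendstoD) simp
    then obtain d1 where d1: "x < d1" "\<And>s. x < s \<Longrightarrow> s < d1 \<Longrightarrow> dist (l s) (l x) < 1"
      unfolding eventually_at_right_field by blast
    obtain d2 z where d2: "d2 < x" "\<And>s. d2 < s \<Longrightarrow> s < x \<Longrightarrow> 0 \<le> s \<Longrightarrow> dist (l s) z < 1"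
    proof (cases "x = 0")
      case True
      show ?thesis
        by (rule that[of "x - 1"]) (use True in auto)
    next
      case False
      then have "0 < x"
        using \<open>0 \<le> x\<close> by simp
      then obtain z where "(l \<longlongrightarrow> z) (at_left x)"
        using assms unfolding cadlag_def by blast
      then have "\<forall>\<^sub>F s in at_left x. dist (l s) z < 1"
        by (rule tendstoD) simp
      then show ?thesis
        unfolding eventually_at_left_field using that by blast
    qed
    define K where "K = \<bar>l x\<bar> + \<bar>z\<bar> + 1"
    have "\<bar>l s\<bar> \<le> K" if "d2 < s" "s < d1" "0 \<le> s" for s
      using d1(2)[of s] d2(2)[of s] that unfolding K_def dist_real_def
      by (cases "s = x"; cases "s < x") auto
    then have "\<forall>u v. u \<le> x \<and> x \<le> v \<and> v - u < min (d1 - x) (x - d2) \<longrightarrow> P u v"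
      unfolding P_def by (intro allI impI exI[of _ K]) auto
    then show ?case
      using d1 d2 by (intro exI[of _ "min (d1 - x) (x - d2)"]) auto
  qed
  then show ?thesis
    using assms unfolding P_def by auto
qed auto

text \<open>Meaningful when \<open>e \<mapsto> e + a * F e\<close> is a bijection, for instance for \<open>F\<close> continuous and
  nondecreasing and \<open>a \<ge> 0\<close>.\<close>

definition resolvent :: "(real \<Rightarrow> real) \<Rightarrow> real \<Rightarrow> real \<Rightarrow> real" where
  "resolvent F a x = (THE e. e + a * F e = x)"

primrec implicit_euler :: "(real \<Rightarrow> real) \<Rightarrow> real \<Rightarrow> real \<Rightarrow> (nat \<Rightarrow> real) \<Rightarrow> nat \<Rightarrow> real" where
  "implicit_euler F a x \<xi> 0 = x"
| "implicit_euler F a x \<xi> (Suc k) = resolvent F a (implicit_euler F a x \<xi> k + \<xi> k)"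

section \<open>The resolvent and the error of one implicit step\<close>

lemma resolvent_ex1:
  assumes "mono F" "continuous_on UNIV F" "0 \<le> a"
  shows "\<exists>!e. e + a * F e = (x::real)"
proof -
  \<comment> \<open>Monotonicity compares \<open>a * F r\<close> and \<open>a * F (- r)\<close> with
    \<open>a * F 0\<close>, whose size is included in \<open>r\<close>; hence \<open>x\<close> lies
    between the values of \<open>e + a * F e\<close> at \<open>- r\<close> and at
    \<open>r\<close>.\<close>
  define r where "r = \<bar>x\<bar> + a * \<bar>F 0\<bar>"
  have "0 \<le> r"
    using assms by (simp add: r_def)
  have "a * F 0 \<le> a * F r" "a * F (- r) \<le> a * F 0"
    using \<open>0 \<le> r\<close> assms by (auto intro!: mult_left_mono monoD[of F])
  moreover have "\<bar>a * F 0\<bar> = a * \<bar>F 0\<bar>"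
    using assms by (simp add: abs_mult)
  ultimately have "- r + a * F (- r) \<le> x" "x \<le> r + a * F r"
    unfolding r_def by linarith+
  then have "\<exists>e. - r \<le> e \<and> e \<le> r \<and> e + a * F e = x"
    using \<open>0 \<le> r\<close> assms
    by (intro IVT') (auto intro!: continuous_intros intro: continuous_on_subset)
  moreover have "e = e'" if "e + a * F e = x" "e' + a * F e' = x" for e e'
  proof (rule ccontr)
    assume "e \<noteq> e'"
    moreover have "a * F e \<le> a * F e'" if "e \<le> e'" for e e'
      using that assms by (auto intro!: mult_left_mono monoD[of F])
    ultimately show False
      using that by (metis add.commute add_le_less_mono less_irrefl linorder_neqE_linordered_idom order_less_imp_le)
  qed
  ultimately show ?thesis
    by blast
qed

lemma resolvent_eq:
  assumes "mono F" "continuous_on UNIV F" "0 \<le> a"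
  shows "resolvent F a x + a * F (resolvent F a x) = x"
  unfolding resolvent_def by (rule theI'[OF resolvent_ex1[OF assms]])

lemma resolvent_unique:
  assumes "mono F" "continuous_on UNIV F" "0 \<le> a" "e + a * F e = x"
  shows "resolvent F a x = e"
  unfolding resolvent_def using resolvent_ex1[OF assms(1-3), of x] assms(4) by (rule the1_equality)

text \<open>\<open>u - v\<close> and \<open>F u - F v\<close> have the same sign, so nothing
  cancels. Dropping the second term makes the resolvent nonexpansive; keeping it gives the
  contraction.\<close>

lemma abs_add_mono_diff:
  fixes F :: "real \<Rightarrow> real"
  assumes "mono F" "0 \<le> a"
  shows "\<bar>(u + a * F u) - (v + a * F v)\<bar> = \<bar>u - v\<bar> + a * \<bar>F u - F v\<bar>"
proof -
  have *: "\<bar>(u + a * F u) - (v + a * F v)\<bar> = \<bar>u - v\<bar> + a * \<bar>F u - F v\<bar>" if "v \<le> u" for u v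
  proof -
    have "F v \<le> F u"
      using that assms by (auto intro: monoD)
    moreover then have "a * F v \<le> a * F u"
      using assms by (auto intro: mult_left_mono)
    ultimately show ?thesis
      using that by (simp add: algebra_simps)
  qed
  show ?thesis
    using *[of u v] *[of v u] by (cases "v \<le> u") (auto simp: abs_minus_commute)
qed

lemma continuous_on_resolvent:
  assumes "mono F" "continuous_on UNIV F" "0 \<le> a"
  shows "continuous_on UNIV (resolvent F a)"
proof (rule lipschitz_on_continuous_on[of 1], rule lipschitz_onI)
  fix x y :: real
  let ?u = "resolvent F a x" and ?v = "resolvent F a y"
  have "\<bar>x - y\<bar> = \<bar>?u - ?v\<bar> + a * \<bar>F ?u - F ?v\<bar>"
    using abs_add_mono_diff[of F a ?u ?v] resolvent_eq[OF assms] assms by simp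
  moreover have "0 \<le> a * \<bar>F ?u - F ?v\<bar>"
    using assms by simp
  ultimately show "dist ?u ?v \<le> 1 * dist x y"
    by (simp add: dist_real_def)
qed simp

lemma borel_measurable_implicit_euler:
  assumes "mono F" "continuous_on UNIV F" "0 \<le> a" "\<And>k. k < n \<Longrightarrow> (\<lambda>\<omega>. \<xi> \<omega> k) \<in> borel_measurable N"
  shows "(\<lambda>\<omega>. implicit_euler F a x (\<xi> \<omega>) n) \<in> borel_measurable N"
  using assms(4)
proof (induction n)
  case (Suc n)
  have [measurable]: "resolvent F a \<in> borel_measurable borel"
    using continuous_on_resolvent[OF assms(1-3)] by (rule borel_measurable_continuous_onI)
  note [measurable] = Suc.prems[of n, simplified]
  have [measurable]: "(\<lambda>\<omega>. implicit_euler F a x (\<xi> \<omega>) n) \<in> borel_measurable N"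
    using Suc by simp
  show ?case
    by simp measurable
qed simp

lemma implicit_euler_cong:
  "(\<And>k. k < n \<Longrightarrow> \<xi> k = \<xi>' k) \<Longrightarrow> implicit_euler F a x \<xi> n = implicit_euler F a x \<xi>' n"
  by (induction n) auto

text \<open>By homogeneity \<open>F (\<mu> * e) = \<mu> * \<mu> powr (\<gamma> - 1) * F e\<close>,
  so a factor \<mu> cancels from the resolvent equation and a change of the unit of space becomes a
  change of step size.\<close>

lemma implicit_euler_scale:
  assumes F: "mono F" "continuous_on UNIV F" "0 \<le> a" "0 < \<mu>"
    and hom: "\<And>v c. 0 < c \<Longrightarrow> F (c * v) = c powr \<gamma> * F v"
  shows "implicit_euler F a (\<mu> * x) (\<lambda>k. \<mu> * \<xi> k) n
    = \<mu> * implicit_euler F (a * \<mu> powr (\<gamma> - 1)) x \<xi> n"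
proof (induction n)
  case (Suc n)
  let ?e = "resolvent F (a * \<mu> powr (\<gamma> - 1)) (implicit_euler F (a * \<mu> powr (\<gamma> - 1)) x \<xi> n + \<xi> n)"
  have "?e + a * \<mu> powr (\<gamma> - 1) * F ?e = implicit_euler F (a * \<mu> powr (\<gamma> - 1)) x \<xi> n + \<xi> n"
    using F by (intro resolvent_eq) auto
  then have "\<mu> * ?e + a * (\<mu> * \<mu> powr (\<gamma> - 1)) * F ?e
      = \<mu> * implicit_euler F (a * \<mu> powr (\<gamma> - 1)) x \<xi> n + \<mu> * \<xi> n"
    by (metis (no_types, opaque_lifting) distrib_left mult.assoc mult.left_commute)
  moreover have "\<mu> * \<mu> powr (\<gamma> - 1) = \<mu> powr \<gamma>"
    using F by (simp add: powr_diff)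
  ultimately have "\<mu> * ?e + a * F (\<mu> * ?e)
      = \<mu> * implicit_euler F (a * \<mu> powr (\<gamma> - 1)) x \<xi> n + \<mu> * \<xi> n"
    using F by (simp add: hom)
  then show ?case
    using F Suc by (simp add: resolvent_unique)
qed simp

text \<open>The distance before the step, up to the defect \<rho>, is the distance after it plus
  \<open>a\<close> times the drift difference, and the latter is at least \<open>k\<close> times the
  excess of the distance over \<eta>. So this excess is reduced by the factor
  \<open>1 + a * k\<close>. In the application \<open>y\<close> is an exact path and \<rho> its
  failure to satisfy the scheme.\<close>

lemma implicit_euler_error_step:
  assumes F: "mono F" "continuous_on UNIV F" "0 \<le> a" and k: "0 \<le> k"
    and diss: "\<And>u v. v \<le> u \<Longrightarrow> k * (u - v - \<eta>) \<le> F u - F v"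
    and y': "y' + a * F y' = y + \<xi> - \<rho>"
  shows "\<bar>y' - resolvent F a (e + \<xi>)\<bar> - \<eta> \<le> (\<bar>y - e\<bar> - \<eta> + \<bar>\<rho>\<bar>) / (1 + a * k)"
proof -
  let ?e = "resolvent F a (e + \<xi>)"
  have "k * (\<bar>y' - ?e\<bar> - \<eta>) \<le> \<bar>F y' - F ?e\<bar>"
    using diss[of ?e y'] diss[of y' ?e] by (cases "?e \<le> y'") (auto simp: abs_if)
  then have "a * (k * (\<bar>y' - ?e\<bar> - \<eta>)) \<le> a * \<bar>F y' - F ?e\<bar>"
    using F by (intro mult_left_mono)
  moreover have "\<bar>y' - ?e\<bar> + a * \<bar>F y' - F ?e\<bar> = \<bar>y + \<xi> - \<rho> - (e + \<xi>)\<bar>"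
    using abs_add_mono_diff[of F a y' ?e] resolvent_eq[OF F, of "e + \<xi>"] F y' by simp
  ultimately have "(\<bar>y' - ?e\<bar> - \<eta>) * (1 + a * k) \<le> \<bar>y - e\<bar> - \<eta> + \<bar>\<rho>\<bar>"
    by (simp add: algebra_simps)
  moreover have "0 < 1 + a * k"
    using F k by (simp add: add_pos_nonneg)
  ultimately show ?thesis
    by (simp add: pos_le_divide_eq)
qed

text \<open>Only the initial distance is tracked through the geometric decay. The defects are added
  up without damping, which is enough since in the limit of small steps their sum is bounded by an
  integral that is small by itself.\<close>

lemma implicit_euler_error_sum:
  assumes F: "mono F" "continuous_on UNIV F" "0 \<le> a" and k: "0 \<le> k" "0 \<le> \<eta>"
    and diss: "\<And>u v. v \<le> u \<Longrightarrow> k * (u - v - \<eta>) \<le> F u - F v"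
    and y: "\<And>j. j < n \<Longrightarrow> y (Suc j) + a * F (y (Suc j)) = y j + \<xi> j - \<rho> j"
  shows "\<bar>y n - implicit_euler F a e \<xi> n\<bar> \<le> \<eta> + \<bar>y 0 - e\<bar> / (1 + a * k) ^ n + (\<Sum>j<n. \<bar>\<rho> j\<bar>)"
  using y
proof (induction n)
  case (Suc n)
  let ?e = "implicit_euler F a e \<xi>" and ?q = "1 + a * k"
  have q: "1 \<le> ?q"
    using F k by simp
  have "\<bar>y (Suc n) - ?e (Suc n)\<bar> - \<eta> \<le> (\<bar>y n - ?e n\<bar> - \<eta> + \<bar>\<rho> n\<bar>) / ?q"
    unfolding implicit_euler.simps
    by (rule implicit_euler_error_step[OF F k(1) diss Suc.prems]) simp_all
  also have "\<dots> \<le> (\<bar>y 0 - e\<bar> / ?q ^ n + ((\<Sum>j<n. \<bar>\<rho> j\<bar>) + \<bar>\<rho> n\<bar>)) / ?q"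
    using Suc q by (intro divide_right_mono) auto
  also have "\<dots> = \<bar>y 0 - e\<bar> / ?q ^ Suc n + ((\<Sum>j<n. \<bar>\<rho> j\<bar>) + \<bar>\<rho> n\<bar>) / ?q"
    by (simp add: add_divide_distrib mult.commute)
  also have "((\<Sum>j<n. \<bar>\<rho> j\<bar>) + \<bar>\<rho> n\<bar>) / ?q \<le> ((\<Sum>j<n. \<bar>\<rho> j\<bar>) + \<bar>\<rho> n\<bar>) / 1"
    using q by (intro divide_left_mono) (auto intro: sum_nonneg add_nonneg_nonneg)
  finally show ?case
    by simp
qed (use k in auto)

lemma mono_abs_le:
  fixes F :: "real \<Rightarrow> real"
  assumes "mono F" "\<bar>v\<bar> \<le> B"
  shows "\<bar>F v\<bar> \<le> \<bar>F B\<bar> + \<bar>F (- B)\<bar>"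
proof -
  have "F v \<le> F B" "F (- B) \<le> F v"
    using assms by (auto intro!: monoD[of F])
  then show ?thesis
    by linarith
qed

text \<open>The rounding goes upwards: a cadlag path is continuous from the right only, and the
  implicit scheme evaluates the drift at the right end of each cell.\<close>

lemma tendsto_right_rounding:
  fixes a s h :: real
  assumes "0 < d"
  shows "(\<lambda>n. a + d / real n * \<lceil>(s - a) / (d / real n)\<rceil>) \<longlonglongrightarrow> s"
    and "\<forall>\<^sub>F n in sequentially. s \<le> a + d / real n * \<lceil>(s - a) / (d / real n)\<rceil>"
proof -
  have *: "s \<le> a + d / real n * \<lceil>(s - a) / (d / real n)\<rceil>
      \<and> a + d / real n * \<lceil>(s - a) / (d / real n)\<rceil> \<le> s + d / real n" if "0 < n" for n
  proof -
    let ?h = "d / real n"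
    have h: "0 < ?h"
      using that assms by simp
    have "(s - a) / ?h \<le> \<lceil>(s - a) / ?h\<rceil>" "\<lceil>(s - a) / ?h\<rceil> \<le> (s - a) / ?h + 1"
      by linarith+
    then have "?h * ((s - a) / ?h) \<le> ?h * \<lceil>(s - a) / ?h\<rceil>"
      "?h * \<lceil>(s - a) / ?h\<rceil> \<le> ?h * ((s - a) / ?h + 1)"
      using h by (intro mult_left_mono; simp)+
    moreover have "?h * ((s - a) / ?h) = s - a"
      using h by (metis less_irrefl nonzero_mult_div_cancel_left times_divide_eq_right)
    ultimately show ?thesis
      by (simp add: distrib_left)
  qed
  show "\<forall>\<^sub>F n in sequentially. s \<le> a + d / real n * \<lceil>(s - a) / (d / real n)\<rceil>"
    using eventually_gt_at_top[of 0] by eventually_elim (use * in blast)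
  have "(\<lambda>n. s + d / real n) \<longlonglongrightarrow> s + 0"
    by (intro tendsto_intros lim_const_over_n)
  then have lim: "(\<lambda>n. s + d / real n) \<longlonglongrightarrow> s"
    by simp
  show "(\<lambda>n. a + d / real n * \<lceil>(s - a) / (d / real n)\<rceil>) \<longlonglongrightarrow> s"
  proof (rule tendsto_sandwich[OF _ _ tendsto_const lim])
    show "\<forall>\<^sub>F n in sequentially. a + d / real n * \<lceil>(s - a) / (d / real n)\<rceil> \<le> s + d / real n"
      using eventually_gt_at_top[of 0] by eventually_elim (use * in blast)
    show "\<forall>\<^sub>F n in sequentially. s \<le> a + d / real n * \<lceil>(s - a) / (d / real n)\<rceil>"
      using eventually_gt_at_top[of 0] by eventually_elim (use * in blast)
  qed
qed

text \<open>The drift \<open>c s * F\<close> is replaced by \<open>cb * F\<close> with a constant \<open>cb\<close>. Allowing a slack \<open>\<eta>\<close> in the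
  dissipativity makes the contraction linear, also for superlinear \<open>F\<close>; with \<open>k = \<eta> = 0\<close> the
  hypothesis is just monotonicity.\<close>

lemma implicit_euler_limit:
  fixes F y l c :: "real \<Rightarrow> real"
  assumes ab: "a < b" and cb: "0 \<le> cb" and F: "mono F" "continuous_on UNIV F"
    and k: "0 \<le> k" "0 \<le> \<eta>"
    and diss: "\<And>u v. v \<le> u \<Longrightarrow> k * (u - v - \<eta>) \<le> F u - F v"
    and rc: "\<And>s. a \<le> s \<Longrightarrow> s \<le> b \<Longrightarrow> continuous (at s within {s..}) y"
    and bd: "\<And>s. a \<le> s \<Longrightarrow> s \<le> b \<Longrightarrow> \<bar>y s\<bar> \<le> B"
    and int: "set_integrable lborel {a<..b} (\<lambda>s. c s * F (y s))"
    and eq: "\<And>s t. a \<le> s \<Longrightarrow> s \<le> t \<Longrightarrow> t \<le> b \<Longrightarrow>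
        y t = y s + (l t - l s) - (LINT r:{s<..t}|lborel. c r * F (y r))"
    and \<theta>: "0 < \<theta>"
  shows "\<forall>\<^sub>F n in sequentially.
    \<bar>y b - implicit_euler F (cb * ((b - a) / real n)) e
        (\<lambda>j. l (a + real (Suc j) * ((b - a) / real n)) - l (a + real j * ((b - a) / real n))) n\<bar>
      \<le> \<eta> + exp (- (k * cb * (b - a))) * \<bar>y a - e\<bar>
        + (LINT s:{a<..b}|lborel. \<bar>c s - cb\<bar> * \<bar>F (y s)\<bar>) + \<theta>"
proof -
  define G where "G = (\<lambda>s. c s * F (y s))"
  define CF where "CF = \<bar>F B\<bar> + \<bar>F (- B)\<bar>"
  define h where "h = (\<lambda>n. (b - a) / real n)"
  define T where "T = (\<lambda>n s. a + h n * \<lceil>(s - a) / h n\<rceil>)"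
  define t where "t = (\<lambda>n j. a + real j * h n)"
  define g where "g = (\<lambda>n s. \<bar>G s - cb * F (y (T n s))\<bar>)"
  have [measurable]: "F \<in> borel_measurable borel"
    using F by (intro borel_measurable_continuous_onI)
  have yF: "\<bar>F (y s)\<bar> \<le> CF" if "a \<le> s" "s \<le> b" for s
    unfolding CF_def using F(1) bd[OF that] by (rule mono_abs_le)
  have h_pos: "0 < h n" if "0 < n" for n
    using that ab by (simp add: h_def)
  have t_le: "t n j \<le> b" if "j \<le> n" "0 < n" for n j
  proof -
    have "real j * (b - a) \<le> real n * (b - a)"
      using that ab by (intro mult_right_mono) auto
    then show ?thesis
      using that by (simp add: t_def h_def field_simps)
  qed
  have t_ge: "a \<le> t n j" if "0 < n" for n j
    using h_pos[OF that] by (simp add: t_def)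
  have t_Suc: "t n (Suc j) = t n j + h n" for n j
    by (simp add: t_def algebra_simps)
  have T_eq: "T n s = t n (Suc j)" if "t n j < s" "s \<le> t n (Suc j)" "0 < n" for n s j
  proof -
    have "real j < (s - a) / h n" "(s - a) / h n \<le> real (Suc j)"
      using that h_pos[OF that(3)] by (auto simp: t_def field_simps)
    then have "\<lceil>(s - a) / h n\<rceil> = int (Suc j)"
      by (intro ceiling_unique) auto
    then show ?thesis
      by (simp add: T_def t_def)
  qed
  have T_range: "a \<le> T n s \<and> T n s \<le> b" if "a < s" "s \<le> b" "0 < n" for n s
  proof -
    have "0 < (s - a) / h n" "(s - a) / h n \<le> real n"
      using that h_pos[OF that(3)] by (auto simp: h_def field_simps)
    then have "0 < \<lceil>(s - a) / h n\<rceil>" "\<lceil>(s - a) / h n\<rceil> \<le> int n"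
      by (auto simp: ceiling_le_iff)
    then have "0 \<le> real_of_int \<lceil>(s - a) / h n\<rceil>" "real_of_int \<lceil>(s - a) / h n\<rceil> \<le> real n"
      by linarith+
    then have "0 \<le> h n * real_of_int \<lceil>(s - a) / h n\<rceil>"
       "h n * real_of_int \<lceil>(s - a) / h n\<rceil> \<le> h n * real n"
      using h_pos[OF that(3)] by (auto intro: mult_left_mono)
    moreover have "h n * real n = b - a"
      using that by (simp add: h_def)
    ultimately show ?thesis
      by (simp add: T_def)
  qed
  have T_lim: "(\<lambda>n. F (y (T n s))) \<longlonglongrightarrow> F (y s)" if "a < s" "s \<le> b" for s
  proof -
    have "(\<lambda>n. y (T n s)) \<longlonglongrightarrow> y s"
      using rc[of s] that tendsto_right_rounding[where d = "b - a" and a = a and s = s] ab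
      unfolding T_def h_def
      by (intro continuous_within_tendsto_compose[of s "{s..}" y]) auto
    then show ?thesis
      using F by (auto intro: continuous_on_tendsto_compose)
  qed
  \<comment> \<open>As a function of \<open>s\<close> this factors through an integer, so it is
    measurable although nothing is assumed on the measurability of \<open>y\<close>. Its limit
    settles \<open>F (y s)\<close> on the interval; measurability of the product
    \<open>c s * F (y s)\<close> alone would not.\<close>
  have [measurable]: "(\<lambda>s. F (y (T n s))) \<in> borel_measurable borel" for n
  proof -
    have "(\<lambda>s::real. \<lceil>(s - a) / h n\<rceil>) \<in> measurable borel (count_space UNIV)"
      by measurable
    then have "(\<lambda>s. (\<lambda>i. F (y (a + h n * real_of_int i))) \<lceil>(s - a) / h n\<rceil>) \<in> borel_measurable borel"
      by (rule measurable_compose) simp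
    then show ?thesis
      by (simp add: T_def)
  qed
  have Fy_meas: "(\<lambda>s. indicator {a<..b} s * F (y s)) \<in> borel_measurable borel"
    by (rule borel_measurable_LIMSEQ_real[where u = "\<lambda>n s. indicator {a<..b} s * F (y (T n s))"])
      (auto simp: indicator_def intro: T_lim)
  have G_int: "integrable lborel (\<lambda>s. indicator {a<..b} s * G s)"
    using int by (simp add: set_integrable_def G_def)
  then have [measurable]: "(\<lambda>s. indicator {a<..b} s * G s) \<in> borel_measurable borel"
    by (auto dest: borel_measurable_integrable)
  have const_int: "integrable lborel (\<lambda>s. indicator {a<..b} s * C)" for C :: real
    by (intro integrable_mult_left integrable_real_indicator) (auto simp: ab less_imp_le)
  have gT_int: "integrable lborel (\<lambda>s. indicator {a<..b} s * F (y (T n s)))" if "0 < n" for n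
    by (rule Bochner_Integration.integrable_bound[OF const_int[of CF]])
      (auto simp: indicator_def abs_mult intro!: order.trans[OF yF abs_ge_self] dest: T_range[OF _ _ that])
  have g_eq: "indicator {a<..b} s * g n s
      = \<bar>indicator {a<..b} s * G s - cb * (indicator {a<..b} s * F (y (T n s)))\<bar>" for n s
    by (auto simp: g_def indicator_def)
  have g_int: "set_integrable lborel {a<..b} (g n)" if "0 < n" for n
    unfolding set_integrable_def real_scaleR_def g_eq
    by (intro integrable_abs Bochner_Integration.integrable_diff G_int integrable_mult_right gT_int that)
  have I_lim: "(\<lambda>n. LINT s:{a<..b}|lborel. g n s) \<longlonglongrightarrow>
      (LINT s:{a<..b}|lborel. \<bar>c s - cb\<bar> * \<bar>F (y s)\<bar>)"
    unfolding set_lebesgue_integral_def real_scaleR_def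
  \<comment> \<open>The shift by one avoids \<open>n = 0\<close>, for which \<open>h n\<close> is 0
    by the convention on division.\<close>
  proof (rule LIMSEQ_offset[where k = 1], rule integral_dominated_convergence)
    show "integrable lborel (\<lambda>s. \<bar>indicator {a<..b} s * G s\<bar> + cb * (indicator {a<..b} s * CF))"
      by (intro Bochner_Integration.integrable_add integrable_abs G_int integrable_mult_right const_int)
    show "AE s in lborel. norm (indicator {a<..b} s * g (n + 1) s)
        \<le> \<bar>indicator {a<..b} s * G s\<bar> + cb * (indicator {a<..b} s * CF)" for n
    proof (rule AE_I2)
      fix s
      have "\<bar>G s - cb * F (y (T (n + 1) s))\<bar> \<le> \<bar>G s\<bar> + cb * CF" if "a < s" "s \<le> b"
      proof -
        have "\<bar>cb * F (y (T (n + 1) s))\<bar> \<le> cb * CF"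
          using T_range[OF that, of "n + 1"] cb by (auto simp: abs_mult intro!: mult_left_mono yF)
        then show ?thesis
          by linarith
      qed
      then show "norm (indicator {a<..b} s * g (n + 1) s)
          \<le> \<bar>indicator {a<..b} s * G s\<bar> + cb * (indicator {a<..b} s * CF)"
        by (auto simp: g_def indicator_def)
    qed
    show "AE s in lborel. (\<lambda>n. indicator {a<..b} s * g (n + 1) s) \<longlonglongrightarrow>
        indicator {a<..b} s * (\<bar>c s - cb\<bar> * \<bar>F (y s)\<bar>)"
    proof (rule AE_I2)
      fix s
      have "(\<lambda>n. g (n + 1) s) \<longlonglongrightarrow> \<bar>c s - cb\<bar> * \<bar>F (y s)\<bar>" if "a < s" "s \<le> b"
      proof -
        have "(\<lambda>n. g n s) \<longlonglongrightarrow> \<bar>G s - cb * F (y s)\<bar>"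
          unfolding g_def by (intro tendsto_intros T_lim that)
        moreover have "\<bar>G s - cb * F (y s)\<bar> = \<bar>c s - cb\<bar> * \<bar>F (y s)\<bar>"
          by (simp add: G_def abs_mult[symmetric] algebra_simps)
        ultimately show ?thesis
          using LIMSEQ_ignore_initial_segment[of "\<lambda>n. g n s" "\<bar>c s - cb\<bar> * \<bar>F (y s)\<bar>" 1] by metis
      qed
      then show "(\<lambda>n. indicator {a<..b} s * g (n + 1) s) \<longlonglongrightarrow>
        indicator {a<..b} s * (\<bar>c s - cb\<bar> * \<bar>F (y s)\<bar>)"
        by (auto simp: indicator_def)
    qed
    have "(\<lambda>s. indicator {a<..b} s * (\<bar>c s - cb\<bar> * \<bar>F (y s)\<bar>))
      = (\<lambda>s. \<bar>indicator {a<..b} s * G s - cb * (indicator {a<..b} s * F (y s))\<bar>)"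
      by (auto simp: G_def indicator_def abs_mult[symmetric] algebra_simps)
    then show "(\<lambda>s. indicator {a<..b} s * (\<bar>c s - cb\<bar> * \<bar>F (y s)\<bar>)) \<in> borel_measurable lborel"
      using Fy_meas by simp
    show "(\<lambda>s. indicator {a<..b} s * g (n + 1) s) \<in> borel_measurable lborel" for n
      using g_int[of "n + 1"] by (auto simp: set_integrable_def dest: borel_measurable_integrable)
  qed
  have bound: "\<bar>y b - implicit_euler F (cb * h n) e (\<lambda>j. l (t n (Suc j)) - l (t n j)) n\<bar>
      \<le> \<eta> + \<bar>y a - e\<bar> / (1 + k * cb * (b - a) / real n) ^ n + (LINT s:{a<..b}|lborel. g n s)"
    if n: "0 < n" for n
  proof -
    \<comment> \<open>The defect of the exact path on the cell of index \<open>j\<close>: the true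
      drift against one implicit step with constant coefficient \<open>cb\<close>. It is bounded by
      the integral of \<open>g n\<close> over the cell, and these bounds add up to an integral over
      the whole interval.\<close>
    define \<rho> where "\<rho> = (\<lambda>j. LINT s:{t n j<..t n (Suc j)}|lborel. (G s - cb * F (y (t n (Suc j)))))"
    have sub: "{t n j<..t n (Suc j)} \<subseteq> {a<..b}" if "j < n" for j
      using t_le[of "Suc j" n] t_ge[of n j] that n by auto
    have G_int': "set_integrable lborel {t n j<..t n (Suc j)} G" if "j < n" for j
      using int sub[OF that] unfolding G_def by (auto intro: set_integrable_subset)
    have c_int': "set_integrable lborel {t n j<..t n (Suc j)} (\<lambda>_. C)" for j and C :: real
      unfolding set_integrable_def real_scaleR_def using h_pos[OF n]
      by (intro integrable_mult_left integrable_real_indicator) (auto simp: t_Suc)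
    have step: "y (t n (Suc j)) + cb * h n * F (y (t n (Suc j)))
        = y (t n j) + (l (t n (Suc j)) - l (t n j)) - \<rho> j" if "j < n" for j
    proof -
      have "\<rho> j = (LINT s:{t n j<..t n (Suc j)}|lborel. G s)
          - (LINT s:{t n j<..t n (Suc j)}|lborel. cb * F (y (t n (Suc j))))"
        unfolding \<rho>_def by (intro set_integral_diff G_int' c_int' that)
      also have "(LINT s:{t n j<..t n (Suc j)}|lborel. cb * F (y (t n (Suc j))))
          = cb * h n * F (y (t n (Suc j)))"
        using h_pos[OF n] by (simp add: set_lebesgue_integral_def t_Suc)
      finally show ?thesis
        using eq[of "t n j" "t n (Suc j)"] t_ge[of n j] t_le[of "Suc j" n] that n h_pos[OF n]
        by (simp add: G_def t_Suc)
    qed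
    have "\<bar>\<rho> j\<bar> \<le> (LINT s:{t n j<..t n (Suc j)}|lborel. g n s)" if "j < n" for j
    proof -
      have "norm (\<rho> j) \<le> (LINT s:{t n j<..t n (Suc j)}|lborel. norm (G s - cb * F (y (t n (Suc j)))))"
        unfolding \<rho>_def
        by (rule set_integral_norm_bound) (intro set_integral_diff G_int' c_int' that)
      also have "\<dots> = (LINT s:{t n j<..t n (Suc j)}|lborel. g n s)"
        by (rule set_lebesgue_integral_cong) (auto simp: g_def T_eq n)
      finally show ?thesis
        by simp
    qed
    then have "(\<Sum>j<n. \<bar>\<rho> j\<bar>) \<le> (\<Sum>j<n. LINT s:{t n j<..t n (Suc j)}|lborel. g n s)"
      by (intro sum_mono) auto
    also have "m \<le> n \<Longrightarrow> (\<Sum>j<m. LINT s:{t n j<..t n (Suc j)}|lborel. g n s)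
        = (LINT s:{a<..t n m}|lborel. g n s)" for m
    proof (induction m)
      case (Suc m)
      have *: "{a<..t n (Suc m)} = {a<..t n m} \<union> {t n m<..t n (Suc m)}"
        using t_ge[of n m] n h_pos[OF n] by (auto simp: t_Suc)
      have "set_integrable lborel {a<..t n m} (g n)" "set_integrable lborel {t n m<..t n (Suc m)} (g n)"
        using g_int[OF n] sub[of m] Suc t_le[of m n] n by (auto elim!: set_integrable_subset)
      then show ?case
        using Suc unfolding * by (subst set_integral_Un) auto
    qed (simp add: t_def set_lebesgue_integral_def)
    also have "t n n = b"
      using n by (simp add: t_def h_def)
    finally have "(\<Sum>j<n. \<bar>\<rho> j\<bar>) \<le> (LINT s:{a<..b}|lborel. g n s)"
      by simp
    moreover have "\<bar>y (t n n) - implicit_euler F (cb * h n) e (\<lambda>j. l (t n (Suc j)) - l (t n j)) n\<bar>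
        \<le> \<eta> + \<bar>y (t n 0) - e\<bar> / (1 + cb * h n * k) ^ n + (\<Sum>j<n. \<bar>\<rho> j\<bar>)"
      using step cb h_pos[OF n]
      by (intro implicit_euler_error_sum[where y = "\<lambda>j. y (t n j)", OF F _ k diss]) auto
    moreover have "cb * h n * k = k * cb * (b - a) / real n"
      by (simp add: h_def)
    ultimately show ?thesis
      using \<open>t n n = b\<close> by (simp add: t_def)
  qed
  have "(\<lambda>n. \<eta> + \<bar>y a - e\<bar> / (1 + k * cb * (b - a) / real n) ^ n + (LINT s:{a<..b}|lborel. g n s))
      \<longlonglongrightarrow> \<eta> + \<bar>y a - e\<bar> / exp (k * cb * (b - a))
        + (LINT s:{a<..b}|lborel. \<bar>c s - cb\<bar> * \<bar>F (y s)\<bar>)"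
    by (intro tendsto_intros I_lim tendsto_exp_limit_sequentially) auto
  then have "\<forall>\<^sub>F n in sequentially.
      \<eta> + \<bar>y a - e\<bar> / (1 + k * cb * (b - a) / real n) ^ n + (LINT s:{a<..b}|lborel. g n s)
      < \<eta> + \<bar>y a - e\<bar> / exp (k * cb * (b - a))
        + (LINT s:{a<..b}|lborel. \<bar>c s - cb\<bar> * \<bar>F (y s)\<bar>) + \<theta>"
    using \<theta> by (intro order_tendstoD) auto
  then show ?thesis
    using eventually_gt_at_top[of 0]
  proof eventually_elim
    case (elim n)
    then show ?case
      using bound[of n] unfolding h_def t_def
      by (simp add: exp_minus divide_inverse mult.commute)
  qed
qed

section \<open>Paths of the integral equation: restart, regularity and a priori bounds\<close>

lemma integral_equation_restart:
  fixes y l G :: "real \<Rightarrow> real"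
  assumes int: "\<And>t. a \<le> t \<Longrightarrow> set_integrable lborel {a..t} G"
    and eq: "\<And>t. a \<le> t \<Longrightarrow> y t = y a + (l t - l a) - (LINT r:{a..t}|lborel. G r)"
    and "a \<le> s" "s \<le> t"
  shows "y t = y s + (l t - l s) - (LINT r:{s<..t}|lborel. G r)"
proof -
  have *: "{a..t} = {a..s} \<union> {s<..t}"
    using assms by auto
  have "(LINT r:{a..t}|lborel. G r) = (LINT r:{a..s}|lborel. G r) + (LINT r:{s<..t}|lborel. G r)"
    unfolding *
  proof (rule set_integral_Un)
    show "set_integrable lborel {s<..t} G"
      by (rule set_integrable_subset[OF int[of t]]) (use \<open>a \<le> s\<close> \<open>s \<le> t\<close> in auto)
  qed (use \<open>a \<le> s\<close> in \<open>auto intro: int\<close>)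
  then show ?thesis
    using eq[of s] eq[of t] \<open>a \<le> s\<close> \<open>s \<le> t\<close> by linarith
qed

lemma continuous_on_indefinite_set_integral:
  fixes G :: "real \<Rightarrow> real"
  assumes "\<And>t. a \<le> t \<Longrightarrow> set_integrable lborel {a..t} G"
  shows "continuous_on {a..b} (\<lambda>t. LINT r:{a..t}|lborel. G r)"
proof (cases "a \<le> b")
  case True
  have eq: "(LINT r:{a..t}|lborel. G r) = integral {a..t} G" "G integrable_on {a..t}" if "a \<le> t" for t
    using set_borel_integral_eq_integral[OF assms[OF that]] by auto
  have "continuous_on {a..b} (\<lambda>t. integral {a..t} G)"
    by (intro indefinite_integral_continuous_1 eq True)
  then show ?thesis
    by (rule continuous_on_eq) (auto simp: eq)
qed auto

lemma integral_equation_regular: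
  fixes y l G :: "real \<Rightarrow> real"
  assumes int: "\<And>t. a \<le> t \<Longrightarrow> set_integrable lborel {a..t} G"
    and eq: "\<And>t. a \<le> t \<Longrightarrow> y t = y a + (l t - l a) - (LINT r:{a..t}|lborel. G r)"
    and l: "cadlag l" "0 \<le> a"
  shows "\<And>s. a \<le> s \<Longrightarrow> continuous (at s within {s..}) y"
    and "\<exists>B. \<forall>s\<in>{a..b}. \<bar>y s\<bar> \<le> B"
proof -
  let ?I = "\<lambda>t. LINT r:{a..t}|lborel. G r"
  show "continuous (at s within {s..}) y" if "a \<le> s" for s
  proof -
    have "continuous (at s within {a..s + 1}) ?I"
      using continuous_on_indefinite_set_integral[OF int, of "s + 1"] that
      by (auto simp: continuous_on_eq_continuous_within)
    then have "(?I \<longlongrightarrow> ?I s) (at s within {s..s + 1})"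
      unfolding continuous_within by (rule tendsto_within_subset) (use that in auto)
    then have "(?I \<longlongrightarrow> ?I s) (at_right s)"
      by (simp add: at_within_Icc_at_right)
    moreover have "(l \<longlongrightarrow> l s) (at_right s)"
      using l that by (simp add: cadlag_def)
    ultimately have "((\<lambda>t. y a + (l t - l a) - ?I t) \<longlongrightarrow> y a + (l s - l a) - ?I s) (at_right s)"
      by (intro tendsto_intros)
    moreover have "\<forall>\<^sub>F t in at_right s. y a + (l t - l a) - ?I t = y t"
      using that by (intro eventually_at_rightI[of s "s + 1"] eq[symmetric]) auto
    ultimately have "(y \<longlongrightarrow> y s) (at_right s)"
      unfolding eq[OF that, symmetric] by (rule Lim_transform_eventually)
    then show ?thesis
      unfolding continuous_within at_within_Ici_at_right .
  qed
  obtain K where K: "\<forall>s\<in>{a..b}. \<bar>l s\<bar> \<le> K"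
    using cadlag_bounded_on[OF l] by blast
  have "compact (?I ` {a..b})"
    by (intro compact_continuous_image continuous_on_indefinite_set_integral int) auto
  then obtain C where C: "\<forall>s\<in>{a..b}. \<bar>?I s\<bar> \<le> C"
    by (auto dest!: compact_imp_bounded simp: bounded_iff)
  have "\<bar>y s\<bar> \<le> \<bar>y a\<bar> + (K + \<bar>l a\<bar>) + C" if "s \<in> {a..b}" for s
    using eq[of s] K C that by (auto dest!: bspec[where x = s])
  then show "\<exists>B. \<forall>s\<in>{a..b}. \<bar>y s\<bar> \<le> B"
    by blast
qed

lemma implicit_euler_solution_limit:
  fixes F y l c :: "real \<Rightarrow> real"
  assumes F: "mono F" "continuous_on UNIV F"
    and l: "cadlag l" "0 \<le> t\<^sub>0"
    and int: "\<And>t. t\<^sub>0 \<le> t \<Longrightarrow> set_integrable lborel {t\<^sub>0..t} (\<lambda>s. c s * F (y s))"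
    and eq: "\<And>t. t\<^sub>0 \<le> t \<Longrightarrow>
      y t = y t\<^sub>0 + (l t - l t\<^sub>0) - (LINT s:{t\<^sub>0..t}|lborel. c s * F (y s))"
    and ab: "t\<^sub>0 \<le> a" "a < b" and "0 \<le> cb" and k: "0 \<le> k" "0 \<le> \<eta>"
    and diss: "\<And>u v. v \<le> u \<Longrightarrow> k * (u - v - \<eta>) \<le> F u - F v"
    and "0 < \<theta>"
  shows "\<forall>\<^sub>F n in sequentially.
    \<bar>y b - implicit_euler F (cb * ((b - a) / real n)) e
        (\<lambda>j. l (a + real (Suc j) * ((b - a) / real n)) - l (a + real j * ((b - a) / real n))) n\<bar>
      \<le> \<eta> + exp (- (k * cb * (b - a))) * \<bar>y a - e\<bar>
        + (LINT s:{a<..b}|lborel. \<bar>c s - cb\<bar> * \<bar>F (y s)\<bar>) + \<theta>"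
proof -
  obtain B where B: "\<forall>s\<in>{t\<^sub>0..b}. \<bar>y s\<bar> \<le> B"
    using integral_equation_regular(2)[OF int eq l] by blast
  show ?thesis
  proof (rule implicit_euler_limit[OF ab(2) \<open>0 \<le> cb\<close> F k diss])
    show "set_integrable lborel {a<..b} (\<lambda>s. c s * F (y s))"
      by (rule set_integrable_subset[OF int[of b]]) (use ab in auto)
    show "continuous (at s within {s..}) y" if "a \<le> s" for s
      using ab that by (intro integral_equation_regular(1)[OF int eq l]) auto
    show "y t = y s + (l t - l s) - (LINT r:{s<..t}|lborel. c r * F (y r))" if "a \<le> s" "s \<le> t" for s t
      using ab that by (intro integral_equation_restart[OF int eq]) auto
    show "\<bar>y s\<bar> \<le> B" if "a \<le> s" "s \<le> b" for s
      using B ab that by auto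
  qed (use \<open>0 < \<theta>\<close> in auto)
qed

text \<open>\<open>z\<close>, the path without its noise, is continuous even where \<open>y\<close>
  jumps. After the last time at which \<open>z\<close> is at most
  \<open>\<bar>y a\<bar> + K\<close>, the path \<open>y\<close> is nonnegative because the noise
  moves it by at most \<open>K\<close>, so the drift can only lower \<open>z\<close>. One
  \<open>K\<close> sits in this level and one in the passage from \<open>z\<close> back to
  \<open>y\<close>.\<close>

lemma dissipative_upper_bound:
  fixes y l c F :: "real \<Rightarrow> real"
  assumes int: "\<And>t. a \<le> t \<Longrightarrow> set_integrable lborel {a..t} (\<lambda>s. c s * F (y s))"
    and eq: "\<And>t. a \<le> t \<Longrightarrow> y t = y a + (l t - l a) - (LINT r:{a..t}|lborel. c r * F (y r))"
    and c: "\<And>s. a \<le> s \<Longrightarrow> 0 \<le> c s" and F: "\<And>v. 0 \<le> v \<Longrightarrow> 0 \<le> F v"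
    and K: "\<And>s. a \<le> s \<Longrightarrow> s \<le> b \<Longrightarrow> \<bar>l s - l a\<bar> \<le> K" and "a \<le> b"
  shows "y b \<le> \<bar>y a\<bar> + 2 * K"
proof (rule ccontr)
  let ?I = "\<lambda>t. LINT r:{a..t}|lborel. c r * F (y r)"
  define z where "z = (\<lambda>t. y a - ?I t)"
  define M where "M = \<bar>y a\<bar> + K"
  define A where "A = {s \<in> {a..b}. z s \<le> M}"
  have yz: "y s = z s + (l s - l a)" if "a \<le> s" for s
    using eq[OF that] by (simp add: z_def)
  assume "\<not> y b \<le> \<bar>y a\<bar> + 2 * K"
  then have "M < z b"
    using yz[of b] K[of b] \<open>a \<le> b\<close> by (simp add: M_def)
  have cont: "continuous_on {a..b} z"
    unfolding z_def by (intro continuous_intros continuous_on_indefinite_set_integral int)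
  have "0 \<le> K"
    using K[of a] \<open>a \<le> b\<close> by simp
  have "z a = y a"
    using eq[of a] by (simp add: z_def)
  then have "a \<in> A"
    using \<open>a \<le> b\<close> \<open>0 \<le> K\<close> by (auto simp: A_def M_def)
  have "closed A"
    unfolding A_def using cont by (intro continuous_on_closed_Collect_le continuous_intros) auto
  moreover have "bdd_above A"
    unfolding A_def by auto
  ultimately have \<sigma>: "Sup A \<in> A"
    using \<open>a \<in> A\<close> by (intro closed_contains_Sup) auto
  define \<sigma> where "\<sigma> = Sup A"
  have \<sigma>A: "a \<le> \<sigma>" "\<sigma> \<le> b" "z \<sigma> \<le> M"
    using \<sigma> by (auto simp: A_def \<sigma>_def)
  have "0 \<le> y s" if "\<sigma> < s" "s \<le> b" for s
  proof -
    have "s \<notin> A"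
      using that \<open>bdd_above A\<close> cSup_upper[of s A] by (auto simp: \<sigma>_def)
    then have "M < z s"
      using that \<sigma>A by (auto simp: A_def)
    then show ?thesis
      using yz[of s] K[of s] that \<sigma>A by (simp add: M_def)
  qed
  then have "0 \<le> (LINT r:{\<sigma><..b}|lborel. c r * F (y r))"
    unfolding set_lebesgue_integral_def using \<sigma>A c F
    by (intro Bochner_Integration.integral_nonneg) (auto simp: indicator_def)
  moreover have "y b = y \<sigma> + (l b - l \<sigma>) - (LINT r:{\<sigma><..b}|lborel. c r * F (y r))"
    using \<sigma>A by (intro integral_equation_restart[OF int eq])
  ultimately have "z b \<le> z \<sigma>"
    using yz[of b] yz[of \<sigma>] \<sigma>A by simp
  then show False
    using \<open>M < z b\<close> \<sigma>A by simp
qed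

lemma dissipative_abs_bound:
  fixes y l c F :: "real \<Rightarrow> real"
  assumes int: "\<And>t. a \<le> t \<Longrightarrow> set_integrable lborel {a..t} (\<lambda>s. c s * F (y s))"
    and eq: "\<And>t. a \<le> t \<Longrightarrow> y t = y a + (l t - l a) - (LINT r:{a..t}|lborel. c r * F (y r))"
    and c: "\<And>s. a \<le> s \<Longrightarrow> 0 \<le> c s" and F: "\<And>v. 0 \<le> v \<Longrightarrow> 0 \<le> F v" "\<And>v. v \<le> 0 \<Longrightarrow> F v \<le> 0"
    and K: "\<And>s. a \<le> s \<Longrightarrow> s \<le> b \<Longrightarrow> \<bar>l s - l a\<bar> \<le> K" and "a \<le> b"
  shows "\<bar>y b\<bar> \<le> \<bar>y a\<bar> + 2 * K"
proof -
  have "y b \<le> \<bar>y a\<bar> + 2 * K"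
    using int eq c F(1) K \<open>a \<le> b\<close> by (rule dissipative_upper_bound)
  moreover have "- y b \<le> \<bar>- y a\<bar> + 2 * K"
  proof (rule dissipative_upper_bound[where y = "\<lambda>s. - y s" and l = "\<lambda>s. - l s"
        and F = "\<lambda>v. - F (- v)" and c = c])
    show "set_integrable lborel {a..t} (\<lambda>s. c s * - F (- (- y s)))" if "a \<le> t" for t
      using int[OF that] by (simp add: set_integrable_def)
    show "- y t = - y a + (- l t - (- l a)) - (LINT r:{a..t}|lborel. c r * - F (- (- y r)))" if "a \<le> t" for t
      using eq[OF that] by (simp add: set_lebesgue_integral_def)
    show "\<bar>- l s - (- l a)\<bar> \<le> K" if "a \<le> s" "s \<le> b" for s
      using K[OF that] by simp
  qed (use c F \<open>a \<le> b\<close> in auto)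
  ultimately show ?thesis
    by simp
qed

section \<open>Poisson integrals and scaling of stable processes\<close>

text \<open>Only the probabilities of the finite values are given. They add up to 1, so
  \<open>X\<close> is almost surely a natural number and its whole law is known; mean and
  characteristic function are then exponential series.\<close>

lemma poisson_transforms:
  fixes X :: "'a \<Rightarrow> ennreal" and r :: real
  assumes "prob_space M" and [measurable]: "X \<in> borel_measurable M" and r: "0 \<le> r"
    and P: "\<And>k::nat. measure M {\<omega> \<in> space M. X \<omega> = of_nat k} = r ^ k / fact k * exp (- r)"
  shows "AE \<omega> in M. \<exists>k::nat. X \<omega> = of_nat k"
    and "(\<integral>\<^sup>+\<omega>. X \<omega> \<partial>M) = ennreal r"
    and "(\<integral>\<omega>. iexp (v * enn2real (X \<omega>)) \<partial>M) = exp (of_real r * (iexp v - 1))"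
proof -
  interpret prob_space M by fact
  define w where "w = (\<lambda>k::nat. r ^ k / fact k * exp (- r))"
  define K where "K = (\<lambda>\<omega>. nat \<lfloor>enn2real (X \<omega>)\<rfloor>)"
  have [measurable]: "K \<in> measurable M (count_space UNIV)"
    unfolding K_def by measurable
  have w_nonneg: "0 \<le> w k" for k
    using r by (simp add: w_def)
  have exp_sums: "(\<lambda>k. z ^ k / fact k * exp (- z')) sums (exp z * exp (- z'))" for z z' :: complex
    using sums_mult2[OF exp_converges[of z], of "exp (- z')"] by (simp add: scaleR_conv_of_real divide_inverse mult.commute)
  have exp_sums_real: "(\<lambda>k. r ^ k / fact k * exp (- r)) sums (exp r * exp (- r))"
    using sums_mult2[OF exp_converges[of r], of "exp (- r)"] by (simp add: divide_inverse mult.commute)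
  define A where "A = (\<lambda>k::nat. {\<omega> \<in> space M. X \<omega> = of_nat k})"
  have "(\<lambda>k. measure M (A k)) sums measure M (\<Union>k. A k)"
    by (rule finite_measure_UNION) (auto simp: A_def disjoint_family_on_def)
  moreover have "(\<lambda>k. measure M (A k)) sums 1"
    using exp_sums_real by (simp add: A_def P exp_minus)
  ultimately have "measure M (\<Union>k. A k) = 1"
    by (rule sums_unique2)
  then have "AE \<omega> in M. \<omega> \<in> (\<Union>k. A k)"
    by (subst (asm) prob_eq_1) (auto simp: A_def)
  then show AE_nat: "AE \<omega> in M. \<exists>k::nat. X \<omega> = of_nat k"
    by eventually_elim (auto simp: A_def)
  have enn2real_nat: "enn2real (of_nat k) = real k" for k
    by (simp add: ennreal_of_nat_eq_real_of_nat)
  have AE_K: "AE \<omega> in M. X \<omega> = of_nat (K \<omega>)"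
    using AE_nat by eventually_elim (auto simp: K_def enn2real_nat)
  have D: "distr M (count_space UNIV) K = density (count_space UNIV) (\<lambda>k. ennreal (w k))"
  proof (rule measure_eqI_countable[of _ UNIV])
    show "emeasure (distr M (count_space UNIV) K) {k} = emeasure (density (count_space UNIV) (\<lambda>k. ennreal (w k))) {k}" for k
    proof -
      have "emeasure (distr M (count_space UNIV) K) {k} = emeasure M (K -` {k} \<inter> space M)"
        by (simp add: emeasure_distr)
      also have "\<dots> = emeasure M (A k)"
        using AE_K by (intro emeasure_eq_AE) (auto simp: A_def)
      also have "\<dots> = w k"
        by (simp add: emeasure_eq_measure A_def P w_def)
      finally show ?thesis
        by (simp add: emeasure_density nn_integral_count_space_indicator[symmetric] flip: one_ennreal_def)
    qed
  qed auto
  have "(\<integral>\<^sup>+\<omega>. X \<omega> \<partial>M) = (\<integral>\<^sup>+\<omega>. of_nat (K \<omega>) \<partial>M)"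
    using AE_K by (intro nn_integral_cong_AE)
  also have "\<dots> = (\<integral>\<^sup>+k. of_nat k \<partial>distr M (count_space UNIV) K)"
    by (simp add: nn_integral_distr)
  also have "\<dots> = (\<Sum>k. ennreal (w k * k))"
    unfolding D by (simp add: nn_integral_density nn_integral_count_space_nat ennreal_mult' w_nonneg ennreal_of_nat_eq_real_of_nat)
  also have "\<dots> = ennreal r"
  proof (rule suminf_ennreal_eq)
    have "(\<lambda>k. w (Suc k) * real (Suc k)) = (\<lambda>k. r * (r ^ k / fact k * exp (- r)))"
      by (simp add: w_def fact_Suc mult.assoc del: of_nat_Suc)
    moreover have "(\<lambda>k. r * (r ^ k / fact k * exp (- r))) sums (r * (exp r * exp (- r)))"
      by (rule sums_mult[OF exp_sums_real])
    ultimately have "(\<lambda>k. w (Suc k) * real (Suc k)) sums r"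
      by (simp add: exp_minus)
    then show "(\<lambda>k. w k * real k) sums r"
      by (subst (asm) sums_Suc_iff) simp
  qed (simp add: w_nonneg)
  finally show "(\<integral>\<^sup>+\<omega>. X \<omega> \<partial>M) = ennreal r" .
  have "(\<integral>\<omega>. iexp (v * enn2real (X \<omega>)) \<partial>M) = (\<integral>\<omega>. iexp (v * real (K \<omega>)) \<partial>M)"
    using AE_K by (intro integral_cong_AE) (auto simp: enn2real_nat elim!: eventually_mono)
  also have "\<dots> = (\<integral>k. iexp (v * real k) \<partial>distr M (count_space UNIV) K)"
    by (simp add: integral_distr)
  also have "\<dots> = (\<integral>k. w k *\<^sub>R iexp (v * real k) \<partial>count_space UNIV)"
    unfolding D by (intro integral_density) (auto simp: w_nonneg)
  also have "\<dots> = exp (of_real r * iexp v) * exp (- of_real r)"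
  proof (rule sums_unique2)
    have "w k *\<^sub>R iexp (v * real k) = (of_real r * iexp v) ^ k / fact k * exp (- of_real r)" for k
      by (simp add: w_def scaleR_conv_of_real power_mult_distrib exp_of_nat_mult[symmetric] mult_ac exp_of_real[symmetric])
    then show "(\<lambda>k. w k *\<^sub>R iexp (v * real k)) sums (exp (of_real r * iexp v) * exp (- of_real r))"
      using exp_sums by simp
    show "(\<lambda>k. w k *\<^sub>R iexp (v * real k)) sums (\<integral>k. w k *\<^sub>R iexp (v * real k) \<partial>count_space UNIV)"
    proof -
      have "summable w"
        using sums_summable[OF exp_sums_real] unfolding w_def .
      then show ?thesis
        by (intro sums_integral_count_space_nat)
          (simp add: integrable_count_space_nat_iff w_nonneg)
    qed
  qed
  also have "\<dots> = exp (of_real r * (iexp v - 1))"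
    by (simp add: exp_add[symmetric] algebra_simps)
  finally show "(\<integral>\<omega>. iexp (v * enn2real (X \<omega>)) \<partial>M) = exp (of_real r * (iexp v - 1))" .
qed

section \<open>Integrals against a Poisson random measure\<close>

context
  fixes M :: "'a measure" and N :: "'a \<Rightarrow> 'b measure" and m :: "'b measure"
  assumes M: "prob_space M" and N: "poisson_random_measure M N m"
begin

lemma sets_poisson_random_measure:
  "\<omega> \<in> space M \<Longrightarrow> sets (N \<omega>) = sets m" "\<omega> \<in> space M \<Longrightarrow> space (N \<omega>) = space m"
  using N by (auto simp: poisson_random_measure_def dest: sets_eq_imp_space_eq)

lemma measurable_emeasure_poisson_random_measure:
  "A \<in> sets m \<Longrightarrow> (\<lambda>\<omega>. emeasure (N \<omega>) A) \<in> borel_measurable M"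
  using N by (auto simp: poisson_random_measure_def)

lemma poisson_random_measure_transforms:
  assumes "A \<in> sets m" "emeasure m A < \<infinity>"
  shows "AE \<omega> in M. emeasure (N \<omega>) A < \<infinity>"
    and "(\<integral>\<^sup>+\<omega>. emeasure (N \<omega>) A \<partial>M) = emeasure m A"
    and "(\<integral>\<omega>. iexp (v * measure (N \<omega>) A) \<partial>M) = exp (of_real (measure m A) * (iexp v - 1))"
proof -
  have P: "measure M {\<omega> \<in> space M. emeasure (N \<omega>) A = of_nat k}
           = measure m A ^ k / fact k * exp (- measure m A)" for k :: nat
    using N assms unfolding poisson_random_measure_def by blast
  note * = poisson_transforms[OF M measurable_emeasure_poisson_random_measure[OF assms(1)] measure_nonneg P]
  show "AE \<omega> in M. emeasure (N \<omega>) A < \<infinity>"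
    using *(1) by eventually_elim (auto simp: of_nat_less_top)
  show "(\<integral>\<^sup>+\<omega>. emeasure (N \<omega>) A \<partial>M) = emeasure m A"
    using *(2) assms by (simp add: emeasure_eq_ennreal_measure)
  show "(\<integral>\<omega>. iexp (v * measure (N \<omega>) A) \<partial>M) = exp (of_real (measure m A) * (iexp v - 1))"
    using *(3) by (simp add: measure_def)
qed

text \<open>Measurability in \<omega> and the value of the mean go through one induction over
  \<open>f\<close>, since additivity and monotone convergence under the outer integral need the
  inner ones to be measurable. The factor \<open>indicator A\<close> keeps to a set of finite
  intensity, where the counts have a Poisson law.\<close>

lemma poisson_random_measure_campbell:
  assumes A: "A \<in> sets m" "emeasure m A < \<infinity>" and f: "f \<in> borel_measurable m"
  shows "(\<lambda>\<omega>. \<integral>\<^sup>+x. f x * indicator A x \<partial>N \<omega>) \<in> borel_measurable M"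
    and "(\<integral>\<^sup>+\<omega>. (\<integral>\<^sup>+x. f x * indicator A x \<partial>N \<omega>) \<partial>M) = (\<integral>\<^sup>+x. f x * indicator A x \<partial>m)"
proof -
  note [simp] = sets_poisson_random_measure
  note [measurable] = A(1)
  have "(\<lambda>\<omega>. \<integral>\<^sup>+x. f x * indicator A x \<partial>N \<omega>) \<in> borel_measurable M \<and>
    (\<integral>\<^sup>+\<omega>. (\<integral>\<^sup>+x. f x * indicator A x \<partial>N \<omega>) \<partial>M) = (\<integral>\<^sup>+x. f x * indicator A x \<partial>m)"
    using f
  proof (induction rule: borel_measurable_induct)
    case (cong f g)
    have "(\<integral>\<^sup>+x. f x * indicator A x \<partial>N \<omega>) = (\<integral>\<^sup>+x. g x * indicator A x \<partial>N \<omega>)" if "\<omega> \<in> space M" for \<omega>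
      using cong(3) that by (intro nn_integral_cong) auto
    moreover have "(\<integral>\<^sup>+x. f x * indicator A x \<partial>m) = (\<integral>\<^sup>+x. g x * indicator A x \<partial>m)"
      using cong(3) by (intro nn_integral_cong) auto
    ultimately show ?case
      using cong(4) by (auto cong: measurable_cong nn_integral_cong)
  next
    case (set B)
    have eq: "(\<integral>\<^sup>+x. indicator B x * indicator A x \<partial>n) = emeasure n (A \<inter> B)" if "sets n = sets m" for n
      using set A that by (simp add: indicator_inter_arith[symmetric] Int_commute)
    have "emeasure m (A \<inter> B) \<le> emeasure m A"
      using A by (intro emeasure_mono) auto
    then have "(\<integral>\<^sup>+\<omega>. emeasure (N \<omega>) (A \<inter> B) \<partial>M) = emeasure m (A \<inter> B)"
      using A set by (intro poisson_random_measure_transforms) auto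
    moreover have "(\<lambda>\<omega>. emeasure (N \<omega>) (A \<inter> B)) \<in> borel_measurable M"
      using A set by (intro measurable_emeasure_poisson_random_measure) auto
    ultimately show ?case
      by (simp add: eq cong: measurable_cong nn_integral_cong)
  next
    case (mult u c)
    have "(\<integral>\<^sup>+x. c * u x * indicator A x \<partial>n) = c * (\<integral>\<^sup>+x. u x * indicator A x \<partial>n)"
      if "sets n = sets m" for n
    proof -
      have [measurable]: "u \<in> borel_measurable n" "A \<in> sets n"
        using mult A that by (auto cong: measurable_cong_sets)
      show ?thesis
        by (simp add: mult.assoc nn_integral_cmult)
    qed
    moreover have [measurable]: "(\<lambda>\<omega>. \<integral>\<^sup>+x. u x * indicator A x \<partial>N \<omega>) \<in> borel_measurable M"
      using mult by simp
    ultimately show ?case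
      using mult by (simp add: nn_integral_cmult cong: measurable_cong nn_integral_cong)
  next
    case (add u v)
    have "(\<integral>\<^sup>+x. (v x + u x) * indicator A x \<partial>n)
        = (\<integral>\<^sup>+x. v x * indicator A x \<partial>n) + (\<integral>\<^sup>+x. u x * indicator A x \<partial>n)"
      if "sets n = sets m" for n
    proof -
      have [measurable]: "u \<in> borel_measurable n" "v \<in> borel_measurable n" "A \<in> sets n"
        using add A that by (auto cong: measurable_cong_sets)
      show ?thesis
        by (simp add: distrib_right nn_integral_add)
    qed
    moreover have [measurable]: "(\<lambda>\<omega>. \<integral>\<^sup>+x. u x * indicator A x \<partial>N \<omega>) \<in> borel_measurable M"
      "(\<lambda>\<omega>. \<integral>\<^sup>+x. v x * indicator A x \<partial>N \<omega>) \<in> borel_measurable M"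
      using add by simp_all
    ultimately show ?case
      using add by (simp add: nn_integral_add cong: measurable_cong nn_integral_cong)
  next
    case (seq U)
    have inc: "incseq U"
      by fact
    have U: "U i \<in> borel_measurable m" for i
      by fact
    have eq: "(\<integral>\<^sup>+x. (SUP i. U i) x * indicator A x \<partial>n) = (SUP i. \<integral>\<^sup>+x. U i x * indicator A x \<partial>n)"
      if "sets n = sets m" for n
    proof -
      have "(\<integral>\<^sup>+x. (SUP i. U i) x * indicator A x \<partial>n) = (\<integral>\<^sup>+x. (SUP i. U i x * indicator A x) \<partial>n)"
        by (simp add: SUP_mult_right_ennreal image_comp)
      also have "\<dots> = (SUP i. \<integral>\<^sup>+x. U i x * indicator A x \<partial>n)"
      proof (rule nn_integral_monotone_convergence_SUP)
        show "incseq (\<lambda>i x. U i x * indicator A x)"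
          using inc by (auto simp: incseq_def le_fun_def intro!: mult_right_mono)
        have [measurable]: "U i \<in> borel_measurable n" "A \<in> sets n" for i
          using U A that by (auto cong: measurable_cong_sets)
        show "(\<lambda>x. U i x * indicator A x) \<in> borel_measurable n" for i
          by measurable
      qed
      finally show ?thesis .
    qed
    have "(\<integral>\<^sup>+\<omega>. (SUP i. \<integral>\<^sup>+x. U i x * indicator A x \<partial>N \<omega>) \<partial>M)
        = (SUP i. \<integral>\<^sup>+\<omega>. (\<integral>\<^sup>+x. U i x * indicator A x \<partial>N \<omega>) \<partial>M)"
      using seq inc
      by (intro nn_integral_monotone_convergence_SUP)
        (auto simp: incseq_def le_fun_def intro!: nn_integral_mono mult_right_mono)
    moreover have [measurable]: "(\<lambda>\<omega>. \<integral>\<^sup>+x. U i x * indicator A x \<partial>N \<omega>) \<in> borel_measurable M" for i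
      using seq by simp
    ultimately show ?case
      using seq by (simp add: eq cong: measurable_cong nn_integral_cong del: SUP_apply Sup_apply)
  qed
  then show "(\<lambda>\<omega>. \<integral>\<^sup>+x. f x * indicator A x \<partial>N \<omega>) \<in> borel_measurable M"
    and "(\<integral>\<^sup>+\<omega>. (\<integral>\<^sup>+x. f x * indicator A x \<partial>N \<omega>) \<partial>M) = (\<integral>\<^sup>+x. f x * indicator A x \<partial>m)"
    by auto
qed

text \<open>Counts of disjoint sets are independent, so the characteristic function is a product of
  Poisson ones. For the step function with value \<open>v i\<close> on \<open>B i\<close> the
  exponent is already an integral against \<open>m\<close>.\<close>

lemma poisson_random_measure_step_char:
  fixes B :: "nat \<Rightarrow> 'b set" and v :: "nat \<Rightarrow> real"
  assumes "\<And>i. i < n \<Longrightarrow> B i \<in> sets m" "\<And>i. i < n \<Longrightarrow> emeasure m (B i) < \<infinity>" "disjoint_family_on B {..<n}"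
  shows "(\<integral>\<omega>. iexp (\<Sum>i<n. v i * measure (N \<omega>) (B i)) \<partial>M)
    = exp (\<Sum>i<n. of_real (measure m (B i)) * (iexp (v i) - 1))"
proof -
  interpret prob_space M by (rule M)
  have *: "(\<lambda>x. iexp (v i * enn2real x)) \<in> borel_measurable borel" for i
    by measurable
  have "indep_vars (\<lambda>_. borel) (\<lambda>i \<omega>. emeasure (N \<omega>) (B i)) {..<n}"
    using N assms unfolding poisson_random_measure_def by blast
  then have "indep_vars (\<lambda>_. borel) (\<lambda>i \<omega>. iexp (v i * enn2real (emeasure (N \<omega>) (B i)))) {..<n}"
    using * by (rule indep_vars_compose2)
  then have ind: "indep_vars (\<lambda>_. borel) (\<lambda>i \<omega>. iexp (v i * measure (N \<omega>) (B i))) {..<n}"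
    by (simp add: measure_def)
  have "(\<integral>\<omega>. iexp (\<Sum>i<n. v i * measure (N \<omega>) (B i)) \<partial>M) = (\<integral>\<omega>. (\<Prod>i<n. iexp (v i * measure (N \<omega>) (B i))) \<partial>M)"
    by (simp add: exp_sum sum_distrib_left)
  also have "\<dots> = (\<Prod>i<n. \<integral>\<omega>. iexp (v i * measure (N \<omega>) (B i)) \<partial>M)"
  proof (rule indep_vars_lebesgue_integral[OF _ ind])
    show "integrable M (\<lambda>\<omega>. iexp (v i * measure (N \<omega>) (B i)))" if "i \<in> {..<n}" for i
      using ind that by (intro integrable_const_bound[of _ 1]) (auto simp: indep_vars_def)
  qed simp
  also have "\<dots> = (\<Prod>i<n. exp (of_real (measure m (B i)) * (iexp (v i) - 1)))"
    using assms by (intro prod.cong refl poisson_random_measure_transforms(3)) auto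
  finally show ?thesis
    by (simp add: exp_sum)
qed

end

text \<open>\<open>n\<close> is kept apart from \<open>m\<close> so that one decomposition into
  level sets serves both the intensity and its random realisations, which share the
  \<sigma>-algebra.\<close>

lemma set_integral_simple_function:
  fixes g :: "real \<Rightarrow> 'b::{banach, second_countable_topology}" and F :: "'a \<Rightarrow> real"
  assumes F: "simple_function m F" and A: "A \<in> sets m" and n: "sets n = sets m" "emeasure n A < \<infinity>"
  shows "(LINT x:A|n. g (F x)) = (\<Sum>v\<in>F ` space m. measure n (A \<inter> (F -` {v} \<inter> space m)) *\<^sub>R g v)"
proof -
  let ?B = "\<lambda>v. A \<inter> (F -` {v} \<inter> space m)"
  have fin: "finite (F ` space m)"
    using F by (rule simple_functionD)
  have B: "?B v \<in> sets n" for v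
    using simple_functionD(2)[OF F, of "{v}"] A n by auto
  have sp: "space n = space m"
    using n(1) by (rule sets_eq_imp_space_eq)
  have "(LINT x:A|n. g (F x)) = (\<integral>x. (\<Sum>v\<in>F ` space m. indicator (?B v) x *\<^sub>R g v) \<partial>n)"
    unfolding set_lebesgue_integral_def
  proof (rule Bochner_Integration.integral_cong[OF refl])
    fix x assume x: "x \<in> space n"
    have "(\<Sum>v\<in>F ` space m. indicator (?B v) x *\<^sub>R g v) = (\<Sum>v\<in>{F x}. indicator A x *\<^sub>R g v)"
      using x sp fin by (intro sum.mono_neutral_cong_right) (auto simp: indicator_def)
    then show "indicator A x *\<^sub>R g (F x) = (\<Sum>v\<in>F ` space m. indicator (?B v) x *\<^sub>R g v)"
      by (simp only: sum.empty sum.insert finite.emptyI empty_iff not_False_eq_True add_0_right)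
  qed
  also have "\<dots> = (\<Sum>v\<in>F ` space m. \<integral>x. indicator (?B v) x *\<^sub>R g v \<partial>n)"
  proof (rule Bochner_Integration.integral_sum)
    fix v
    have "emeasure n (?B v) \<le> emeasure n A"
      using A n by (intro emeasure_mono) auto
    then show "integrable n (\<lambda>x. indicator (?B v) x *\<^sub>R g v)"
      using B[of v] n(2) by (intro integrable_scaleR_left integrable_real_indicator) auto
  qed
  also have "\<dots> = (\<Sum>v\<in>F ` space m. measure n (?B v) *\<^sub>R g v)"
  proof (rule sum.cong[OF refl])
    fix v
    have "emeasure n (?B v) \<le> emeasure n A"
      using A n by (intro emeasure_mono) auto
    then have "integrable n (indicator (?B v) :: 'a \<Rightarrow> real)"
      using B[of v] n(2) by (intro integrable_real_indicator) auto
    moreover have "?B v \<inter> space n = ?B v"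
      using sp by auto
    ultimately show "(\<integral>x. indicator (?B v) x *\<^sub>R g v \<partial>n) = measure n (?B v) *\<^sub>R g v"
      by (simp add: integral_scaleR_left)
  qed
  finally show ?thesis .
qed

text \<open>The characteristic function passes from step functions to \<open>f\<close> by dominated
  convergence, pathwise under \<open>N \<omega>\<close> with bound
  \<open>2 * \<bar>f x\<bar>\<close> and under \<open>m\<close> with bound 2 on \<open>A\<close>.
  \<open>Y\<close> is introduced because the integral against \<open>N \<omega>\<close> is
  controlled only for almost every \<omega>, where its positive and negative parts are finite; the
  difference of these parts is measurable by construction.\<close>

lemma poisson_integral_char_mean:
  fixes f :: "'b \<Rightarrow> real"
  assumes M: "prob_space M" and N: "poisson_random_measure M N m"
    and A: "A \<in> sets m" "emeasure m A < \<infinity>" and f: "f \<in> borel_measurable m" "set_integrable m A f"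
  shows "\<exists>Y. integrable M Y \<and> (AE \<omega> in M. (LINT x:A|N \<omega>. f x) = Y \<omega>)
    \<and> (\<integral>\<omega>. Y \<omega> \<partial>M) = (LINT x:A|m. f x)
    \<and> (\<forall>\<theta>. (\<integral>\<omega>. iexp (\<theta> * Y \<omega>) \<partial>M) = exp (LINT x:A|m. (iexp (\<theta> * f x) - 1)))"
proof -
  interpret prob_space M by (rule M)
  note [simp] = sets_poisson_random_measure[OF M N]
  note [measurable] = f(1) A(1)
  define P where "P = (\<lambda>\<omega>. \<integral>\<^sup>+x. ennreal (f x) * indicator A x \<partial>N \<omega>)"
  define Q where "Q = (\<lambda>\<omega>. \<integral>\<^sup>+x. ennreal (- f x) * indicator A x \<partial>N \<omega>)"
  define Y where "Y = (\<lambda>\<omega>. enn2real (P \<omega>) - enn2real (Q \<omega>))"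
  have f_int: "integrable m (\<lambda>x. indicator A x * f x)"
    using f(2) by (simp add: set_integrable_def)
  have ind_f: "ennreal (indicator A x * f x) = ennreal (f x) * indicator A x"
    "ennreal (- (indicator A x * f x)) = ennreal (- f x) * indicator A x" for x
    by (auto simp: indicator_def)
  have [measurable]: "P \<in> borel_measurable M" "Q \<in> borel_measurable M"
    unfolding P_def Q_def by (intro poisson_random_measure_campbell[OF M N A]; measurable)+
  have PQ_int: "(\<integral>\<^sup>+\<omega>. P \<omega> \<partial>M) = (\<integral>\<^sup>+x. ennreal (indicator A x * f x) \<partial>m)"
    "(\<integral>\<^sup>+\<omega>. Q \<omega> \<partial>M) = (\<integral>\<^sup>+x. ennreal (- (indicator A x * f x)) \<partial>m)"
    unfolding P_def Q_def ind_f by (intro poisson_random_measure_campbell[OF M N A]; measurable)+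
  have fin: "(\<integral>\<^sup>+\<omega>. P \<omega> \<partial>M) \<noteq> \<infinity>" "(\<integral>\<^sup>+\<omega>. Q \<omega> \<partial>M) \<noteq> \<infinity>"
    using f_int unfolding PQ_int real_integrable_def by auto
  have AE_fin: "AE \<omega> in M. P \<omega> \<noteq> \<infinity>" "AE \<omega> in M. Q \<omega> \<noteq> \<infinity>"
    using fin by (intro nn_integral_PInf_AE; simp)+
  have enn2real_int: "integrable M (\<lambda>\<omega>. enn2real (R \<omega>)) \<and> (\<integral>\<omega>. enn2real (R \<omega>) \<partial>M) = enn2real (\<integral>\<^sup>+\<omega>. R \<omega> \<partial>M)"
    if [measurable]: "R \<in> borel_measurable M" and "(\<integral>\<^sup>+\<omega>. R \<omega> \<partial>M) \<noteq> \<infinity>" "AE \<omega> in M. R \<omega> \<noteq> \<infinity>" for R :: "'a \<Rightarrow> ennreal"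
  proof -
    have eq: "(\<integral>\<^sup>+\<omega>. ennreal (enn2real (R \<omega>)) \<partial>M) = (\<integral>\<^sup>+\<omega>. R \<omega> \<partial>M)"
      using that(3) by (intro nn_integral_cong_AE) (auto simp: less_top[symmetric])
    then have "integrable M (\<lambda>\<omega>. enn2real (R \<omega>))"
      using that(2) by (intro integrableI_nonneg) (auto simp: less_top[symmetric])
    moreover then have "(\<integral>\<omega>. enn2real (R \<omega>) \<partial>M) = enn2real (\<integral>\<^sup>+\<omega>. R \<omega> \<partial>M)"
      using eq by (simp add: integral_eq_nn_integral)
    ultimately show ?thesis
      by simp
  qed
  have Y_int: "integrable M Y"
    unfolding Y_def using enn2real_int[of P] enn2real_int[of Q] fin AE_fin by auto
  have Y_mean: "(\<integral>\<omega>. Y \<omega> \<partial>M) = (LINT x:A|m. f x)"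
  proof -
    have "(\<integral>\<omega>. Y \<omega> \<partial>M) = enn2real (\<integral>\<^sup>+\<omega>. P \<omega> \<partial>M) - enn2real (\<integral>\<^sup>+\<omega>. Q \<omega> \<partial>M)"
      unfolding Y_def using enn2real_int[of P] enn2real_int[of Q] fin AE_fin by simp
    also have "\<dots> = (\<integral>x. indicator A x * f x \<partial>m)"
      unfolding PQ_int using f_int by (rule real_lebesgue_integral_def[symmetric])
    finally show ?thesis
      by (simp add: set_lebesgue_integral_def)
  qed
  have AE_good: "AE \<omega> in M. emeasure (N \<omega>) A < \<infinity> \<and> integrable (N \<omega>) (\<lambda>x. indicator A x * f x)
      \<and> (LINT x:A|N \<omega>. f x) = Y \<omega>"
    using AE_fin poisson_random_measure_transforms(1)[OF M N A] AE_space
  proof eventually_elim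
    case (elim \<omega>)
    have [measurable]: "f \<in> borel_measurable (N \<omega>)" "A \<in> sets (N \<omega>)"
      using elim f A by (auto cong: measurable_cong_sets)
    have "integrable (N \<omega>) (\<lambda>x. indicator A x * f x)"
      unfolding real_integrable_def using elim by (simp add: ind_f P_def Q_def)
    moreover then have "(\<integral>x. indicator A x * f x \<partial>N \<omega>) = Y \<omega>"
      by (subst real_lebesgue_integral_def) (simp_all add: ind_f P_def Q_def Y_def)
    ultimately show ?case
      using elim by (simp add: set_lebesgue_integral_def)
  qed
  have Y_char: "(\<integral>\<omega>. iexp (\<theta> * Y \<omega>) \<partial>M) = exp (LINT x:A|m. (iexp (\<theta> * f x) - 1))" for \<theta>
  proof -
    obtain F where F: "\<And>i. simple_function m (F i)"
      and F_lim: "\<And>x. x \<in> space m \<Longrightarrow> (\<lambda>i. F i x) \<longlonglongrightarrow> f x"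
      and F_bd: "\<And>i x. x \<in> space m \<Longrightarrow> \<bar>F i x\<bar> \<le> 2 * \<bar>f x\<bar>"
      using borel_measurable_implies_sequence_metric[OF f(1), of 0]
      unfolding dist_real_def diff_0_right by blast
    have [measurable]: "F i \<in> borel_measurable m" for i
      using F by (rule borel_measurable_simple_function)
    define B where "B = (\<lambda>i v. A \<inter> (F i -` {v} \<inter> space m))"
    define S where "S = (\<lambda>i \<omega>. \<Sum>v\<in>F i ` space m. v * measure (N \<omega>) (B i v))"
    have B[measurable]: "B i v \<in> sets m" for i v
      unfolding B_def using simple_functionD(2)[OF F, of i "{v}"] A by auto
    have B_fin: "emeasure m (B i v) < \<infinity>" for i v
      using emeasure_mono[of "B i v" A m] A by (auto simp: B_def)
    have [measurable]: "S i \<in> borel_measurable M" for i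
      unfolding S_def measure_def
      using measurable_emeasure_poisson_random_measure[OF M N B] by measurable
    have S_char: "(\<integral>\<omega>. iexp (\<theta> * S i \<omega>) \<partial>M) = exp (LINT x:A|m. (iexp (\<theta> * F i x) - 1))" for i
    proof -
      have fin: "finite (F i ` space m)"
        using F by (rule simple_functionD)
      then obtain v n where v: "bij_betw v {..<n::nat} (F i ` space m)"
        using ex_bij_betw_nat_finite unfolding atLeast0LessThan by blast
      have "(\<integral>\<omega>. iexp (\<theta> * S i \<omega>) \<partial>M) = (\<integral>\<omega>. iexp (\<Sum>j<n. (\<theta> * v j) * measure (N \<omega>) (B i (v j))) \<partial>M)"
        unfolding S_def sum_distrib_left
        by (subst sum.reindex_bij_betw[OF v, symmetric]) (simp add: mult.assoc)
      also have "\<dots> = exp (\<Sum>j<n. of_real (measure m (B i (v j))) * (iexp (\<theta> * v j) - 1))"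
      proof (rule poisson_random_measure_step_char[OF M N])
        show "disjoint_family_on (\<lambda>j. B i (v j)) {..<n}"
          using bij_betw_imp_inj_on[OF v] by (auto simp: disjoint_family_on_def B_def dest: inj_onD)
      qed (use B B_fin in auto)
      also have "(\<Sum>j<n. of_real (measure m (B i (v j))) * (iexp (\<theta> * v j) - 1))
          = (\<Sum>w\<in>F i ` space m. measure m (B i w) *\<^sub>R (iexp (\<theta> * w) - 1))"
        by (subst sum.reindex_bij_betw[OF v, symmetric]) (simp add: scaleR_conv_of_real)
      also have "\<dots> = (LINT x:A|m. (iexp (\<theta> * F i x) - 1))"
        unfolding B_def by (rule set_integral_simple_function[OF F A(1) refl A(2), symmetric])
      finally show ?thesis .
    qed
    have S_lim: "AE \<omega> in M. (\<lambda>i. S i \<omega>) \<longlonglongrightarrow> Y \<omega>"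
      using AE_good AE_space
    proof eventually_elim
      case (elim \<omega>)
      have sets: "sets (N \<omega>) = sets m" and sp: "space (N \<omega>) = space m"
        using elim by auto
      have [measurable]: "f \<in> borel_measurable (N \<omega>)" "A \<in> sets (N \<omega>)" "F i \<in> borel_measurable (N \<omega>)" for i
        using f A sets by (auto cong: measurable_cong_sets)
      have "(\<lambda>i. LINT x:A|N \<omega>. F i x) \<longlonglongrightarrow> (LINT x:A|N \<omega>. f x)"
        unfolding set_lebesgue_integral_def real_scaleR_def
      proof (rule integral_dominated_convergence)
        show "integrable (N \<omega>) (\<lambda>x. 2 * \<bar>indicator A x * f x\<bar>)"
          using elim by (intro integrable_mult_right integrable_abs) auto
      qed (use F_lim F_bd in \<open>auto simp: sp indicator_def abs_mult\<close>)
      moreover have "(LINT x:A|N \<omega>. F i x) = S i \<omega>" for i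
        unfolding S_def B_def using elim sets
        by (subst set_integral_simple_function[OF F A(1), where g = "\<lambda>x. x"]) (auto simp: mult.commute)
      ultimately show ?case
        using elim by simp
    qed
    have "(\<lambda>i. \<integral>\<omega>. iexp (\<theta> * S i \<omega>) \<partial>M) \<longlonglongrightarrow> (\<integral>\<omega>. iexp (\<theta> * Y \<omega>) \<partial>M)"
    proof (rule integral_dominated_convergence)
      show "AE \<omega> in M. (\<lambda>i. iexp (\<theta> * S i \<omega>)) \<longlonglongrightarrow> iexp (\<theta> * Y \<omega>)"
        using S_lim by eventually_elim (auto intro!: tendsto_intros)
      show "integrable M (\<lambda>_. 1::real)"
        by simp
    qed (auto simp: Y_def)
    moreover have "(\<lambda>i. exp (LINT x:A|m. (iexp (\<theta> * F i x) - 1))) \<longlonglongrightarrow> exp (LINT x:A|m. (iexp (\<theta> * f x) - 1))"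
      unfolding set_lebesgue_integral_def
    proof (intro tendsto_intros, rule integral_dominated_convergence)
      show "integrable m (\<lambda>x. 2 * indicator A x :: real)"
        using A by (intro integrable_mult_right integrable_real_indicator) auto
      show "AE x in m. norm (indicator A x *\<^sub>R (iexp (\<theta> * F i x) - 1)) \<le> 2 * indicator A x" for i
        by (rule AE_I2) (auto simp: indicator_def intro: order.trans[OF norm_triangle_ineq4])
      show "AE x in m. (\<lambda>i. indicator A x *\<^sub>R (iexp (\<theta> * F i x) - 1)) \<longlonglongrightarrow> indicator A x *\<^sub>R (iexp (\<theta> * f x) - 1)"
        using F_lim by (intro AE_I2 tendsto_intros) auto
    qed measurable
    ultimately show ?thesis
      unfolding S_char by (rule LIMSEQ_unique)
  qed
  show ?thesis
    using Y_int Y_mean Y_char AE_good by (intro exI[of _ Y]) auto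
qed

section \<open>The stable Levy measure and the jump intensity\<close>

lemma sets_stable_levy_measure [simp, measurable_cong]: "sets (stable_levy_measure \<alpha> a\<^sub>p a\<^sub>m) = sets borel"
  and space_stable_levy_measure [simp]: "space (stable_levy_measure \<alpha> a\<^sub>p a\<^sub>m) = UNIV"
  by (simp_all add: stable_levy_measure_def)

lemma sigma_finite_stable_levy_measure: "sigma_finite_measure (stable_levy_measure \<alpha> a\<^sub>p a\<^sub>m)"
  unfolding stable_levy_measure_def
  by (subst sigma_finite_measure.sigma_finite_iff_density_finite[OF sigma_finite_lborel]) auto

text \<open>Substitute \<open>c * z\<close> for \<open>z\<close>: the density is homogeneous of
  degree \<open>- 1 - \<alpha>\<close> and the Jacobian adds one power of \<open>c\<close>. The
  truncation level must be scaled along.\<close>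

lemma stable_levy_measure_scale:
  fixes \<phi> :: "real \<Rightarrow> 'b::{banach, second_countable_topology}"
  assumes [measurable]: "\<phi> \<in> borel_measurable borel" and "0 < c" "0 \<le> a\<^sub>p" "0 \<le> a\<^sub>m"
  shows "(LINT z:{z. c * \<delta> < \<bar>z\<bar>}|stable_levy_measure \<alpha> a\<^sub>p a\<^sub>m. \<phi> z)
    = c powr (- \<alpha>) *\<^sub>R (LINT z:{z. \<delta> < \<bar>z\<bar>}|stable_levy_measure \<alpha> a\<^sub>p a\<^sub>m. \<phi> (c * z))"
proof -
  define d where "d = (\<lambda>z. \<bar>z\<bar> powr (- 1 - \<alpha>) * (a\<^sub>p * indicator {0<..} z + a\<^sub>m * indicator {..<0} z))"
  have [measurable]: "d \<in> borel_measurable borel"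
    unfolding d_def by measurable
  have eq: "(LINT z:{z. r < \<bar>z\<bar>}|stable_levy_measure \<alpha> a\<^sub>p a\<^sub>m. \<psi> z)
      = (\<integral>z. d z *\<^sub>R (indicator {z. r < \<bar>z\<bar>} z *\<^sub>R \<psi> z) \<partial>lborel)"
    if [measurable]: "\<psi> \<in> borel_measurable borel" for r and \<psi> :: "real \<Rightarrow> 'b"
  proof -
    have "stable_levy_measure \<alpha> a\<^sub>p a\<^sub>m = density lborel (\<lambda>z. ennreal (d z))"
      by (simp add: stable_levy_measure_def d_def)
    then show ?thesis
      unfolding set_lebesgue_integral_def
      using assms(3,4) by (simp add: integral_density d_def)
  qed
  have d: "d (c * z) = c powr (- 1 - \<alpha>) * d z" for z
    using \<open>0 < c\<close> by (auto simp: d_def indicator_def abs_mult powr_mult zero_less_mult_iff mult_less_0_iff)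
  have "(LINT z:{z. c * \<delta> < \<bar>z\<bar>}|stable_levy_measure \<alpha> a\<^sub>p a\<^sub>m. \<phi> z)
      = \<bar>c\<bar> *\<^sub>R (\<integral>z. d (0 + c * z) *\<^sub>R (indicator {z. c * \<delta> < \<bar>z\<bar>} (0 + c * z) *\<^sub>R \<phi> (0 + c * z)) \<partial>lborel)"
    unfolding eq[OF assms(1)] using \<open>0 < c\<close> by (intro lborel_integral_real_affine) auto
  also have "\<dots> = \<bar>c\<bar> *\<^sub>R (\<integral>z. c powr (- 1 - \<alpha>) *\<^sub>R (d z *\<^sub>R (indicator {z. \<delta> < \<bar>z\<bar>} z *\<^sub>R \<phi> (c * z))) \<partial>lborel)"
    using \<open>0 < c\<close> by (simp add: d indicator_def abs_mult mult.assoc)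
  also have "\<dots> = (c * c powr (- 1 - \<alpha>)) *\<^sub>R (LINT z:{z. \<delta> < \<bar>z\<bar>}|stable_levy_measure \<alpha> a\<^sub>p a\<^sub>m. \<phi> (c * z))"
    unfolding integral_scaleR_right using \<open>0 < c\<close> by (subst eq) simp_all
  also have "c * c powr (- 1 - \<alpha>) = c powr (- \<alpha>)"
    using \<open>0 < c\<close> powr_add[of c 1 "- 1 - \<alpha>"] by simp
  finally show ?thesis .
qed

text \<open>Integrability at infinity is where \<open>1 < \<alpha>\<close> enters:
  \<open>\<bar>z\<bar>\<close> times the density decays like
  \<open>\<bar>z\<bar> powr (- \<alpha>)\<close>. The total mass beyond \<delta> is finite because 1
  is at most \<open>\<bar>z\<bar> / \<delta>\<close> there.\<close>

lemma set_integrable_stable_levy_measure: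
  assumes "1 < \<alpha>" "0 \<le> a\<^sub>p" "0 \<le> a\<^sub>m" "0 < \<delta>"
  shows "set_integrable (stable_levy_measure \<alpha> a\<^sub>p a\<^sub>m) {z. \<delta> < \<bar>z\<bar>} (\<lambda>z. z)"
    and "emeasure (stable_levy_measure \<alpha> a\<^sub>p a\<^sub>m) {z. \<delta> < \<bar>z\<bar>} < \<infinity>"
proof -
  define h where "h = (\<lambda>z. indicator {\<delta>..} z * z powr (- \<alpha>) :: real)"
  have "(\<integral>\<^sup>+z. ennreal (z powr (- \<alpha>)) * indicator {\<delta>..} z \<partial>lborel)
      = ennreal (0 - (\<delta> powr (1 - \<alpha>) / (1 - \<alpha>)))"
  proof (rule nn_integral_FTC_atLeast[where F = "\<lambda>z. z powr (1 - \<alpha>) / (1 - \<alpha>)"])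
    show "((\<lambda>z. z powr (1 - \<alpha>) / (1 - \<alpha>)) has_real_derivative z powr - \<alpha>) (at z)" if "\<delta> \<le> z" for z
    proof -
      have "((\<lambda>z. z powr (1 - \<alpha>)) has_real_derivative (1 - \<alpha>) * z powr (1 - \<alpha> - 1)) (at z)"
        using that assms by (intro has_real_derivative_powr) auto
      from DERIV_cdivide[OF this, of "1 - \<alpha>"] show ?thesis
        using assms by simp
    qed
    have "((\<lambda>z. z powr (1 - \<alpha>)) \<longlongrightarrow> 0) at_top"
      using assms by (intro tendsto_neg_powr filterlim_ident) auto
    then show "((\<lambda>z. z powr (1 - \<alpha>) / (1 - \<alpha>)) \<longlongrightarrow> 0) at_top"
      by (rule tendsto_divide_zero)
  qed auto
  moreover have "ennreal (h z) = ennreal (z powr (- \<alpha>)) * indicator {\<delta>..} z" for z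
    by (auto simp: h_def indicator_def)
  ultimately have h: "integrable lborel h"
    by (intro integrableI_nonneg) (auto simp: h_def)
  have "integrable lborel (\<lambda>z. h (0 + (- 1) * z))"
    by (rule lborel_integrable_real_affine[OF h]) simp
  then have hh: "integrable lborel (\<lambda>z. (a\<^sub>p + a\<^sub>m) * (h z + h (- z)))"
    using h by (intro integrable_mult_right Bochner_Integration.integrable_add) auto
  define d where "d = (\<lambda>z. \<bar>z\<bar> powr (- 1 - \<alpha>) * (a\<^sub>p * indicator {0<..} z + a\<^sub>m * indicator {..<0} z))"
  have [measurable]: "d \<in> borel_measurable borel"
    unfolding d_def by measurable
  have d_nonneg: "0 \<le> d z" for z
    using assms by (auto simp: d_def)
  have bound: "\<bar>d z * (indicator {z. \<delta> < \<bar>z\<bar>} z * z)\<bar> \<le> (a\<^sub>p + a\<^sub>m) * (h z + h (- z))" for z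
  proof (cases "\<delta> < \<bar>z\<bar>")
    case True
    have "\<bar>z\<bar> powr (- 1 - \<alpha>) * \<bar>z\<bar> = \<bar>z\<bar> powr (- \<alpha>)"
      using True assms powr_add[of "\<bar>z\<bar>" "- 1 - \<alpha>" 1] by simp
    moreover have "h z + h (- z) = \<bar>z\<bar> powr (- \<alpha>)"
      using True assms by (auto simp: h_def indicator_def abs_if)
    moreover have "\<bar>d z * z\<bar> = (a\<^sub>p * indicator {0<..} z + a\<^sub>m * indicator {..<0} z) * (\<bar>z\<bar> powr (- 1 - \<alpha>) * \<bar>z\<bar>)"
      using assms by (simp add: d_def abs_mult)
    moreover have "a\<^sub>p * indicator {0<..} z + a\<^sub>m * indicator {..<0} z \<le> a\<^sub>p + a\<^sub>m"
      using assms by (auto simp: indicator_def)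
    ultimately show ?thesis
      using True by (auto intro!: mult_right_mono)
  next
    case False
    then show ?thesis
      using assms by (auto simp: h_def intro!: mult_nonneg_nonneg)
  qed
  have bound_int: "integrable lborel (\<lambda>z. d z * (indicator {z. \<delta> < \<bar>z\<bar>} z * z))"
    by (rule Bochner_Integration.integrable_bound[OF hh])
      (use bound order.trans[OF _ abs_ge_self] in auto)
  then show *: "set_integrable (stable_levy_measure \<alpha> a\<^sub>p a\<^sub>m) {z. \<delta> < \<bar>z\<bar>} (\<lambda>z. z)"
  proof -
    have "stable_levy_measure \<alpha> a\<^sub>p a\<^sub>m = density lborel (\<lambda>z. ennreal (d z))"
      by (simp add: stable_levy_measure_def d_def)
    then show ?thesis
      using bound_int unfolding set_integrable_def by (simp add: integrable_density d_nonneg)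
  qed
  have "integrable (stable_levy_measure \<alpha> a\<^sub>p a\<^sub>m) (indicator {z. \<delta> < \<bar>z\<bar>} :: real \<Rightarrow> real)"
  proof (rule Bochner_Integration.integrable_bound)
    show "integrable (stable_levy_measure \<alpha> a\<^sub>p a\<^sub>m) (\<lambda>z. indicator {z. \<delta> < \<bar>z\<bar>} z * z / \<delta>)"
      using * by (intro integrable_divide) (simp add: set_integrable_def)
    show "AE z in stable_levy_measure \<alpha> a\<^sub>p a\<^sub>m. norm (indicator {z. \<delta> < \<bar>z\<bar>} z :: real)
        \<le> norm (indicator {z. \<delta> < \<bar>z\<bar>} z * z / \<delta>)"
      using assms by (intro AE_I2) (auto simp: indicator_def)
  qed auto
  then show "emeasure (stable_levy_measure \<alpha> a\<^sub>p a\<^sub>m) {z. \<delta> < \<bar>z\<bar>} < \<infinity>"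
    by (auto simp: integrable_indicator_iff)
qed

lemma sets_jump_intensity:
  "sets \<nu> = sets borel \<Longrightarrow> sets (jump_intensity \<nu>) = sets (borel :: (real \<times> real) measure)"
  unfolding jump_intensity_def borel_prod[symmetric] by (intro sets_pair_measure_cong) auto

lemma emeasure_jump_intensity:
  assumes "sigma_finite_measure \<nu>" "sets \<nu> = sets borel" "0 \<le> t" "C \<in> sets borel"
  shows "emeasure (jump_intensity \<nu>) ({0<..t} \<times> C) = ennreal t * emeasure \<nu> C"
proof -
  have "emeasure (density lborel (indicator {0<..})) {0<..t} = ennreal t"
  proof -
    have "{0<..} \<inter> {0<..t} = {0<..t}"
      by auto
    then show ?thesis
      using assms(3) by (simp add: emeasure_density indicator_inter_arith[symmetric])
  qed
  then show ?thesis
    unfolding jump_intensity_def using assms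
    by (subst sigma_finite_measure.emeasure_pair_measure_Times) auto
qed

text \<open>The second marginal of the intensity restricted to times in \<open>(0, t]\<close> is
  \<open>t\<close> times \<nu>, so integrals of functions of the jump size reduce to \<nu>.\<close>

lemma jump_intensity_integral:
  fixes \<phi> :: "real \<Rightarrow> 'b::{banach, second_countable_topology}"
  assumes \<nu>: "sigma_finite_measure \<nu>" and [simp, measurable_cong]: "sets \<nu> = sets borel" and t: "0 \<le> t"
    and [measurable]: "B \<in> sets borel" "\<phi> \<in> borel_measurable borel"
  shows "(LINT p:{0<..t} \<times> B|jump_intensity \<nu>. \<phi> (snd p)) = t *\<^sub>R (LINT z:B|\<nu>. \<phi> z)"
    and "set_integrable \<nu> B \<phi> \<Longrightarrow> set_integrable (jump_intensity \<nu>) ({0<..t} \<times> B) (\<lambda>p. \<phi> (snd p))"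
proof -
  let ?m = "jump_intensity \<nu>" and ?I = "{0<..t} \<times> (UNIV :: real set)"
  note [simp, measurable_cong] = sets_jump_intensity[OF \<open>sets \<nu> = sets borel\<close>]
  have [simp]: "space ?m = UNIV" "space \<nu> = UNIV"
    using sets_eq_imp_space_eq[OF sets_jump_intensity[of \<nu>]] sets_eq_imp_space_eq[of \<nu> borel] by auto
  have [measurable]: "?I \<in> sets borel" "snd \<in> borel_measurable (borel :: (real \<times> real) measure)"
    by (auto simp: borel_prod[symmetric])
  have D: "distr (density ?m (\<lambda>p. ennreal (indicator ?I p))) borel snd = density \<nu> (\<lambda>_. ennreal t)"
  proof (rule measure_eqI)
    fix C assume "C \<in> sets (distr (density ?m (\<lambda>p. ennreal (indicator ?I p))) borel snd)"
    then have [measurable]: "C \<in> sets borel"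
      by simp
    have [measurable]: "snd -` C \<in> sets (borel :: (real \<times> real) measure)"
      using measurable_sets[of snd "borel :: (real \<times> real) measure" borel C] by simp
    have "emeasure (distr (density ?m (\<lambda>p. ennreal (indicator ?I p))) borel snd) C
        = (\<integral>\<^sup>+p. indicator ?I p * indicator (snd -` C) p \<partial>?m)"
      by (subst emeasure_distr) (auto simp: emeasure_density ennreal_indicator)
    also have "\<dots> = (\<integral>\<^sup>+p. indicator ({0<..t} \<times> C) p \<partial>?m)"
      by (intro nn_integral_cong) (auto simp: indicator_def)
    also have "\<dots> = emeasure ?m ({0<..t} \<times> C)"
      by (intro nn_integral_indicator) (auto simp: borel_prod[symmetric])
    also have "\<dots> = ennreal t * emeasure \<nu> C"
      using \<nu> t by (intro emeasure_jump_intensity) auto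
    finally show "emeasure (distr (density ?m (\<lambda>p. ennreal (indicator ?I p))) borel snd) C
        = emeasure (density \<nu> (\<lambda>_. ennreal t)) C"
      by (simp add: emeasure_density nn_integral_cmult_indicator)
  qed simp
  have ind: "indicator ({0<..t} \<times> B) p *\<^sub>R \<phi> (snd p)
      = indicator ?I p *\<^sub>R (indicator B (snd p) *\<^sub>R \<phi> (snd p))" for p
    by (cases p) (auto simp: indicator_def)
  have "(LINT p:{0<..t} \<times> B|?m. \<phi> (snd p))
      = (\<integral>p. indicator B (snd p) *\<^sub>R \<phi> (snd p) \<partial>density ?m (\<lambda>p. ennreal (indicator ?I p)))"
    unfolding set_lebesgue_integral_def ind by (subst integral_density) auto
  also have "\<dots> = (\<integral>z. indicator B z *\<^sub>R \<phi> z \<partial>density \<nu> (\<lambda>_. ennreal t))"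
    unfolding D[symmetric] by (subst integral_distr) auto
  also have "\<dots> = t *\<^sub>R (LINT z:B|\<nu>. \<phi> z)"
    unfolding set_lebesgue_integral_def using t by (subst integral_density) (auto simp del: scaleR_scaleR)
  finally show "(LINT p:{0<..t} \<times> B|jump_intensity \<nu>. \<phi> (snd p)) = t *\<^sub>R (LINT z:B|\<nu>. \<phi> z)" .
  assume "set_integrable \<nu> B \<phi>"
  then have "integrable (density \<nu> (\<lambda>_. ennreal t)) (\<lambda>z. indicator B z *\<^sub>R \<phi> z)"
    using t by (subst integrable_density) (auto simp: set_integrable_def simp del: scaleR_scaleR)
  then have "integrable (density ?m (\<lambda>p. ennreal (indicator ?I p))) (\<lambda>p. indicator B (snd p) *\<^sub>R \<phi> (snd p))"
    unfolding D[symmetric] by (subst (asm) integrable_distr_eq) auto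
  then show "set_integrable ?m ({0<..t} \<times> B) (\<lambda>p. \<phi> (snd p))"
    unfolding set_integrable_def ind by (subst (asm) integrable_density) auto
qed

text \<open>The Levy-Khintchine exponent of the jumps larger than \<delta>, fully compensated. It is
  kept truncated: scaling holds exactly at each level, and only the limit of its exponential is ever
  taken.\<close>

definition levy_exponent :: "real measure \<Rightarrow> real \<Rightarrow> real \<Rightarrow> complex" where
  "levy_exponent \<nu> \<theta> \<delta> = (LINT z:{z. \<delta> < \<bar>z\<bar>}|\<nu>. (iexp (\<theta> * z) - 1))
     - \<i> * of_real (\<theta> * (LINT z:{z. \<delta> < \<bar>z\<bar>}|\<nu>. z))"

lemma levy_exponent_scale:
  assumes "0 < c" "0 \<le> a\<^sub>p" "0 \<le> a\<^sub>m"
  shows "levy_exponent (stable_levy_measure \<alpha> a\<^sub>p a\<^sub>m) \<theta> (c * \<delta>)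
    = of_real (c powr (- \<alpha>)) * levy_exponent (stable_levy_measure \<alpha> a\<^sub>p a\<^sub>m) (c * \<theta>) \<delta>"
proof -
  let ?\<nu> = "stable_levy_measure \<alpha> a\<^sub>p a\<^sub>m"
  have 1: "(LINT z:{z. c * \<delta> < \<bar>z\<bar>}|?\<nu>. (iexp (\<theta> * z) - 1))
      = c powr (- \<alpha>) *\<^sub>R (LINT z:{z. \<delta> < \<bar>z\<bar>}|?\<nu>. (iexp (\<theta> * (c * z)) - 1))"
    by (rule stable_levy_measure_scale[OF _ assms]) measurable
  have 2: "(LINT z:{z. c * \<delta> < \<bar>z\<bar>}|?\<nu>. z)
      = c powr (- \<alpha>) *\<^sub>R (LINT z:{z. \<delta> < \<bar>z\<bar>}|?\<nu>. c * z)"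
    by (rule stable_levy_measure_scale[OF _ assms]) measurable
  show ?thesis
    unfolding levy_exponent_def 1 2
    by (simp add: scaleR_conv_of_real algebra_simps)
qed

section \<open>Characteristic functions and self-similarity of the stable process\<close>

lemma norm_iexp_diff_le: "norm (iexp x - iexp y) \<le> \<bar>x - y\<bar>"
proof -
  have "iexp x = iexp (y + (x - y))"
    by simp
  also have "\<dots> = iexp y * iexp (x - y)"
    by (simp only: of_real_add distrib_left exp_add)
  finally have "iexp x - iexp y = iexp y * (iexp (x - y) - 1)"
    by (simp add: algebra_simps)
  then have "norm (iexp x - iexp y) = norm (iexp (x - y) - 1)"
    by (simp add: norm_mult)
  also have "\<dots> \<le> \<bar>x - y\<bar>"
    using iexp_approx1[of "x - y" 0] by simp
  finally show ?thesis .
qed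

lemma (in prob_space) expectation_abs_le_of_square:
  assumes [measurable]: "D \<in> borel_measurable M" and "0 < \<eta>"
    and D: "(\<integral>\<^sup>+\<omega>. ennreal ((D \<omega>)\<^sup>2) \<partial>M) < ennreal (\<eta>\<^sup>2)"
  shows "integrable M D" and "expectation (\<lambda>\<omega>. \<bar>D \<omega>\<bar>) \<le> 2 * \<eta>"
proof -
  have sq: "integrable M (\<lambda>\<omega>. (D \<omega>)\<^sup>2)"
    using D by (intro integrableI_nonneg) (auto intro: order.strict_trans ennreal_less_top)
  have "ennreal (expectation (\<lambda>\<omega>. (D \<omega>)\<^sup>2)) < ennreal (\<eta>\<^sup>2)"
    using D nn_integral_eq_integral[OF sq] by simp
  then have E: "expectation (\<lambda>\<omega>. (D \<omega>)\<^sup>2) < \<eta>\<^sup>2"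
    by (simp add: ennreal_less_iff)
  \<comment> \<open>A weighted bound of the first power by the second, tuned so that a second moment
    below \<open>\<eta>\<^sup>2\<close> gives a first moment of at most
    \<open>2 * \<eta>\<close>.\<close>
  have le: "\<bar>x\<bar> \<le> \<eta> + x\<^sup>2 / \<eta>" for x
  proof (cases "\<bar>x\<bar> \<le> \<eta>")
    case False
    then have "\<eta> * \<bar>x\<bar> \<le> \<bar>x\<bar> * \<bar>x\<bar>"
      by (intro mult_right_mono) auto
    then have "\<bar>x\<bar> \<le> x\<^sup>2 / \<eta>"
      using \<open>0 < \<eta>\<close> by (simp add: field_simps power2_eq_square)
    then show ?thesis
      using \<open>0 < \<eta>\<close> by simp
  qed (use \<open>0 < \<eta>\<close> in \<open>simp add: add_increasing2\<close>)
  have int: "integrable M (\<lambda>\<omega>. \<eta> + (D \<omega>)\<^sup>2 / \<eta>)"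
    using sq by (intro Bochner_Integration.integrable_add integrable_divide) auto
  show D_int: "integrable M D"
    by (rule Bochner_Integration.integrable_bound[OF int])
      (auto intro: order.trans[OF le abs_ge_self])
  have "expectation (\<lambda>\<omega>. \<bar>D \<omega>\<bar>) \<le> expectation (\<lambda>\<omega>. \<eta> + (D \<omega>)\<^sup>2 / \<eta>)"
    using D_int int le by (intro integral_mono integrable_abs) auto
  also have "\<dots> = \<eta> + expectation (\<lambda>\<omega>. (D \<omega>)\<^sup>2) / \<eta>"
    using sq by (simp add: prob_space)
  also have "\<dots> \<le> 2 * \<eta>"
    using E \<open>0 < \<eta>\<close> by (simp add: field_simps power2_eq_square)
  finally show "expectation (\<lambda>\<omega>. \<bar>D \<omega>\<bar>) \<le> 2 * \<eta>" .
qed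

text \<open>Subtracting the constant \<open>c\<close>, the mean of the Poisson integral, multiplies
  the characteristic function by \<open>iexp (- (\<theta> * c))\<close>; this factor is the
  compensator in \<open>levy_exponent\<close>.\<close>

lemma compensated_jumps_char_mean:
  assumes L: "stable_levy_process M \<alpha> a\<^sub>p a\<^sub>m L" and "1 < \<alpha>" "0 \<le> a\<^sub>p" "0 \<le> a\<^sub>m" "0 \<le> t" "0 < \<delta>"
  shows "\<exists>Y. integrable M Y \<and> (\<integral>\<omega>. Y \<omega> \<partial>M) = 0
    \<and> (AE \<omega> in M. compensated_jumps (jump_measure (\<lambda>t. L t \<omega>))
         (jump_intensity (stable_levy_measure \<alpha> a\<^sub>p a\<^sub>m)) \<delta> t = Y \<omega>)
    \<and> (\<forall>\<theta>. (\<integral>\<omega>. iexp (\<theta> * Y \<omega>) \<partial>M)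
         = exp (of_real t * levy_exponent (stable_levy_measure \<alpha> a\<^sub>p a\<^sub>m) \<theta> \<delta>))"
proof -
  let ?\<nu> = "stable_levy_measure \<alpha> a\<^sub>p a\<^sub>m"
  let ?m = "jump_intensity ?\<nu>" and ?B = "{z::real. \<delta> < \<bar>z\<bar>}"
  let ?A = "{0<..t} \<times> ?B"
  have M: "prob_space M" and N: "poisson_random_measure M (\<lambda>\<omega>. jump_measure (\<lambda>t. L t \<omega>)) ?m"
    using L by (auto simp: stable_levy_process_def levy_process_def Let_def)
  interpret prob_space M by (rule M)
  note \<nu> = sigma_finite_stable_levy_measure[of \<alpha> a\<^sub>p a\<^sub>m] sets_stable_levy_measure[of \<alpha> a\<^sub>p a\<^sub>m]
  note \<nu>_int = set_integrable_stable_levy_measure[OF assms(2-4) \<open>0 < \<delta>\<close>]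
  have sets: "sets ?m = sets borel"
    by (rule sets_jump_intensity) simp
  have A: "?A \<in> sets ?m"
    unfolding sets by (auto simp: borel_prod[symmetric])
  have A_fin: "emeasure ?m ?A < \<infinity>"
    using \<nu>_int(2) \<open>0 \<le> t\<close> by (subst emeasure_jump_intensity[OF \<nu>]) (auto simp: ennreal_mult_less_top)
  have f: "snd \<in> borel_measurable ?m"
    using sets by (auto simp: borel_prod[symmetric] cong: measurable_cong_sets)
  have int: "set_integrable ?m ?A (\<lambda>p. snd p)"
    using \<nu>_int(1) \<open>0 \<le> t\<close> by (intro jump_intensity_integral(2)[OF \<nu>]) auto
  define c where "c = (LINT p:?A|?m. snd p)"
  have c: "c = t * (LINT z:?B|?\<nu>. z)"
    unfolding c_def using \<open>0 \<le> t\<close> by (subst jump_intensity_integral(1)[OF \<nu>]) auto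
  obtain Y where Y: "integrable M Y" "AE \<omega> in M. (LINT p:?A|jump_measure (\<lambda>t. L t \<omega>). snd p) = Y \<omega>"
    "(\<integral>\<omega>. Y \<omega> \<partial>M) = c"
    "\<And>\<theta>. (\<integral>\<omega>. iexp (\<theta> * Y \<omega>) \<partial>M) = exp (LINT p:?A|?m. (iexp (\<theta> * snd p) - 1))"
    using poisson_integral_char_mean[OF M N A A_fin f int] unfolding c_def by auto
  have "(\<integral>\<omega>. iexp (\<theta> * (Y \<omega> - c)) \<partial>M) = exp (of_real t * levy_exponent ?\<nu> \<theta> \<delta>)" for \<theta>
  proof -
    have "(\<integral>\<omega>. iexp (\<theta> * (Y \<omega> - c)) \<partial>M) = (\<integral>\<omega>. iexp (\<theta> * Y \<omega>) * iexp (- (\<theta> * c)) \<partial>M)"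
      by (simp add: exp_add[symmetric] algebra_simps)
    also have "\<dots> = exp (LINT p:?A|?m. (iexp (\<theta> * snd p) - 1)) * iexp (- (\<theta> * c))"
      by (simp only: integral_mult_left_zero Y(4))
    also have "(LINT p:?A|?m. (iexp (\<theta> * snd p) - 1)) = t *\<^sub>R (LINT z:?B|?\<nu>. (iexp (\<theta> * z) - 1))"
      using \<open>0 \<le> t\<close> by (intro jump_intensity_integral(1)[OF \<nu>]) auto
    finally show ?thesis
      by (simp add: levy_exponent_def exp_add[symmetric] scaleR_conv_of_real algebra_simps c)
  qed
  then show ?thesis
    using Y(1-3) by (intro exI[of _ "\<lambda>\<omega>. Y \<omega> - c"]) (auto simp: compensated_jumps_def c_def prob_space)
qed

text \<open>The defining limit in square mean implies convergence of first absolute moments, so that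
  the vanishing expectation and, \<open>iexp\<close> being Lipschitz, the characteristic functions
  of the compensated jumps pass to \<open>L t\<close>. The law is thereby determined as a limit over
  \<delta> without evaluating the limit exponent.\<close>

lemma stable_levy_process_char_mean:
  assumes L: "stable_levy_process M \<alpha> a\<^sub>p a\<^sub>m L" and a: "1 < \<alpha>" "0 \<le> a\<^sub>p" "0 \<le> a\<^sub>m" "0 \<le> t"
  shows "integrable M (L t)" and "(\<integral>\<omega>. L t \<omega> \<partial>M) = 0"
    and "((\<lambda>\<delta>. exp (of_real t * levy_exponent (stable_levy_measure \<alpha> a\<^sub>p a\<^sub>m) \<theta> \<delta>))
      \<longlongrightarrow> (\<integral>\<omega>. iexp (\<theta> * L t \<omega>) \<partial>M)) (at_right 0)"
proof -
  let ?\<nu> = "stable_levy_measure \<alpha> a\<^sub>p a\<^sub>m"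
  let ?c = "\<lambda>\<omega> \<delta>. compensated_jumps (jump_measure (\<lambda>t. L t \<omega>)) (jump_intensity ?\<nu>) \<delta> t"
  interpret prob_space M
    using L by (auto simp: stable_levy_process_def levy_process_def Let_def)
  have [measurable]: "L t \<in> borel_measurable M"
    using L \<open>0 \<le> t\<close> by (auto simp: stable_levy_process_def levy_process_def Let_def)
  have L2: "((\<lambda>\<delta>. \<integral>\<^sup>+\<omega>. ennreal ((L t \<omega> - ?c \<omega> \<delta>)\<^sup>2) \<partial>M) \<longlongrightarrow> 0) (at_right 0)"
    using L \<open>0 \<le> t\<close> by (auto simp: stable_levy_process_def Let_def)
  have "\<forall>\<delta>. \<exists>Y. 0 < \<delta> \<longrightarrow> integrable M Y \<and> expectation Y = 0 \<and> (AE \<omega> in M. ?c \<omega> \<delta> = Y \<omega>)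
      \<and> (\<forall>\<theta>. (\<integral>\<omega>. iexp (\<theta> * Y \<omega>) \<partial>M) = exp (of_real t * levy_exponent ?\<nu> \<theta> \<delta>))"
    using compensated_jumps_char_mean[OF L a] by blast
  then obtain Y where "\<forall>\<delta>>0. integrable M (Y \<delta>) \<and> expectation (Y \<delta>) = 0 \<and> (AE \<omega> in M. ?c \<omega> \<delta> = Y \<delta> \<omega>)
      \<and> (\<forall>\<theta>. (\<integral>\<omega>. iexp (\<theta> * Y \<delta> \<omega>) \<partial>M) = exp (of_real t * levy_exponent ?\<nu> \<theta> \<delta>))"
    unfolding choice_iff by (elim exE)
  then have Y: "\<And>\<delta>. 0 < \<delta> \<Longrightarrow> integrable M (Y \<delta>)" "\<And>\<delta>. 0 < \<delta> \<Longrightarrow> expectation (Y \<delta>) = 0"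
    "\<And>\<delta>. 0 < \<delta> \<Longrightarrow> AE \<omega> in M. ?c \<omega> \<delta> = Y \<delta> \<omega>"
    "\<And>\<delta> \<theta>. 0 < \<delta> \<Longrightarrow> (\<integral>\<omega>. iexp (\<theta> * Y \<delta> \<omega>) \<partial>M) = exp (of_real t * levy_exponent ?\<nu> \<theta> \<delta>)"
    by blast+
  have approx: "\<forall>\<^sub>F \<delta> in at_right 0. 0 < \<delta> \<and> integrable M (\<lambda>\<omega>. L t \<omega> - Y \<delta> \<omega>)
      \<and> expectation (\<lambda>\<omega>. \<bar>L t \<omega> - Y \<delta> \<omega>\<bar>) \<le> 2 * \<eta>" if "0 < \<eta>" for \<eta>
  proof -
    have "\<forall>\<^sub>F \<delta> in at_right 0. (\<integral>\<^sup>+\<omega>. ennreal ((L t \<omega> - ?c \<omega> \<delta>)\<^sup>2) \<partial>M) < ennreal (\<eta>\<^sup>2)"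
      using L2 that by (intro order_tendstoD) auto
    moreover have "\<forall>\<^sub>F \<delta> in at_right 0. 0 < (\<delta>::real)"
      by (simp add: eventually_at_right_less)
    ultimately show ?thesis
    proof eventually_elim
      case (elim \<delta>)
      have [measurable]: "Y \<delta> \<in> borel_measurable M"
        using Y(1)[OF \<open>0 < \<delta>\<close>] by (rule borel_measurable_integrable)
      have "(\<integral>\<^sup>+\<omega>. ennreal ((L t \<omega> - ?c \<omega> \<delta>)\<^sup>2) \<partial>M) = (\<integral>\<^sup>+\<omega>. ennreal ((L t \<omega> - Y \<delta> \<omega>)\<^sup>2) \<partial>M)"
        using Y(3)[OF \<open>0 < \<delta>\<close>] by (intro nn_integral_cong_AE) auto
      then show ?case
        using elim that expectation_abs_le_of_square[of "\<lambda>\<omega>. L t \<omega> - Y \<delta> \<omega>" \<eta>] by auto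
    qed
  qed
  have ex: "\<exists>\<delta>>0. integrable M (\<lambda>\<omega>. L t \<omega> - Y \<delta> \<omega>) \<and> expectation (\<lambda>\<omega>. \<bar>L t \<omega> - Y \<delta> \<omega>\<bar>) \<le> 2 * \<eta>"
    if "0 < \<eta>" for \<eta>
    using eventually_happens[OF approx[OF that]] by (auto simp: trivial_limit_at_right_real)
  show L_int: "integrable M (L t)"
  proof -
    obtain \<delta> where "0 < \<delta>" "integrable M (\<lambda>\<omega>. L t \<omega> - Y \<delta> \<omega>)"
      using ex[of 1] by auto
    then have "integrable M (\<lambda>\<omega>. (L t \<omega> - Y \<delta> \<omega>) + Y \<delta> \<omega>)"
      using Y(1) by (intro Bochner_Integration.integrable_add) auto
    then show ?thesis
      by simp
  qed
  have "\<bar>expectation (L t)\<bar> \<le> \<eta>" if "0 < \<eta>" for \<eta>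
  proof -
    obtain \<delta> where \<delta>: "0 < \<delta>" "expectation (\<lambda>\<omega>. \<bar>L t \<omega> - Y \<delta> \<omega>\<bar>) \<le> \<eta>"
      using ex[of "\<eta> / 2"] \<open>0 < \<eta>\<close> by auto
    have "expectation (L t) = expectation (\<lambda>\<omega>. L t \<omega> - Y \<delta> \<omega>)"
      using Y(1,2)[OF \<delta>(1)] L_int by simp
    also have "\<bar>\<dots>\<bar> \<le> expectation (\<lambda>\<omega>. \<bar>L t \<omega> - Y \<delta> \<omega>\<bar>)"
      by (rule integral_abs_bound)
    finally show ?thesis
      using \<delta> by simp
  qed
  then show "expectation (L t) = 0"
    by (metis abs_le_zero_iff dense_ge)
  show "((\<lambda>\<delta>. exp (of_real t * levy_exponent ?\<nu> \<theta> \<delta>)) \<longlongrightarrow> (\<integral>\<omega>. iexp (\<theta> * L t \<omega>) \<partial>M)) (at_right 0)"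
  proof (rule tendstoI)
    fix e :: real assume "0 < e"
    define \<eta> where "\<eta> = e / (4 * (\<bar>\<theta>\<bar> + 1))"
    have \<eta>: "0 < \<eta>" "\<bar>\<theta>\<bar> * (2 * \<eta>) < e"
      using \<open>0 < e\<close> by (auto simp: \<eta>_def field_simps intro: add_pos_nonneg)
    show "\<forall>\<^sub>F \<delta> in at_right 0.
        dist (exp (of_real t * levy_exponent ?\<nu> \<theta> \<delta>)) (\<integral>\<omega>. iexp (\<theta> * L t \<omega>) \<partial>M) < e"
      using approx[OF \<open>0 < \<eta>\<close>]
    proof eventually_elim
      case (elim \<delta>)
      have [measurable]: "Y \<delta> \<in> borel_measurable M"
        using Y(1)[of \<delta>] elim by (auto dest: borel_measurable_integrable)
      have int: "integrable M (\<lambda>\<omega>. iexp (\<theta> * Z \<omega>))" if [measurable]: "Z \<in> borel_measurable M" for Z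
        by (rule integrable_const_bound[of _ 1]) auto
      have "dist (exp (of_real t * levy_exponent ?\<nu> \<theta> \<delta>)) (\<integral>\<omega>. iexp (\<theta> * L t \<omega>) \<partial>M)
          = norm (\<integral>\<omega>. iexp (\<theta> * Y \<delta> \<omega>) - iexp (\<theta> * L t \<omega>) \<partial>M)"
        using Y(4)[of \<delta> \<theta>] elim int[of "Y \<delta>"] int[of "L t"] by (simp add: dist_norm)
      also have "\<dots> \<le> (\<integral>\<omega>. norm (iexp (\<theta> * Y \<delta> \<omega>) - iexp (\<theta> * L t \<omega>)) \<partial>M)"
        by (rule integral_norm_bound)
      also have "\<dots> \<le> (\<integral>\<omega>. \<bar>\<theta>\<bar> * \<bar>L t \<omega> - Y \<delta> \<omega>\<bar> \<partial>M)"
      proof (rule integral_mono)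
        show "integrable M (\<lambda>\<omega>. norm (iexp (\<theta> * Y \<delta> \<omega>) - iexp (\<theta> * L t \<omega>)))"
          using int by (intro integrable_norm Bochner_Integration.integrable_diff) auto
        show "norm (iexp (\<theta> * Y \<delta> \<omega>) - iexp (\<theta> * L t \<omega>)) \<le> \<bar>\<theta>\<bar> * \<bar>L t \<omega> - Y \<delta> \<omega>\<bar>" for \<omega>
          using norm_iexp_diff_le[of "\<theta> * Y \<delta> \<omega>" "\<theta> * L t \<omega>"]
          by (simp only: right_diff_distrib[symmetric] abs_mult abs_minus_commute)
      qed (use elim in \<open>auto intro: integrable_mult_right integrable_abs\<close>)
      also have "\<dots> = \<bar>\<theta>\<bar> * expectation (\<lambda>\<omega>. \<bar>L t \<omega> - Y \<delta> \<omega>\<bar>)"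
        by simp
      also have "\<dots> \<le> \<bar>\<theta>\<bar> * (2 * \<eta>)"
        using elim by (intro mult_left_mono) auto
      finally show ?case
        using \<eta> by simp
    qed
  qed
qed

lemma char_distr:
  assumes [measurable]: "X \<in> borel_measurable M"
  shows "char (distr M borel X) \<theta> = (\<integral>\<omega>. iexp (\<theta> * X \<omega>) \<partial>M)"
  unfolding char_def by (subst integral_distr) auto

text \<open>Both characteristic functions are limits of the same expression once \<delta> is
  replaced by \<open>c * \<delta>\<close> on the left: the factor \<open>c powr (- \<alpha>)\<close>
  of the exponent cancels the factor \<open>c powr \<alpha>\<close> of time. With two different
  spaces allowed, this also identifies the one-dimensional laws of \<open>L\<close> and
  \<open>R\<close>.\<close>

lemma stable_levy_process_scaling:
  assumes L: "stable_levy_process M \<alpha> a\<^sub>p a\<^sub>m L" and R: "stable_levy_process M' \<alpha> a\<^sub>p a\<^sub>m R"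
    and a: "1 < \<alpha>" "0 \<le> a\<^sub>p" "0 \<le> a\<^sub>m" and "0 \<le> t" "0 < c"
  shows "distr M borel (L (c powr \<alpha> * t)) = distr M' borel (\<lambda>\<omega>. c * R t \<omega>)"
proof -
  let ?\<psi> = "levy_exponent (stable_levy_measure \<alpha> a\<^sub>p a\<^sub>m)"
  have M: "prob_space M" "prob_space M'"
    using L R by (auto simp: stable_levy_process_def levy_process_def Let_def)
  have [measurable]: "L (c powr \<alpha> * t) \<in> borel_measurable M" "R t \<in> borel_measurable M'"
    using L R \<open>0 \<le> t\<close> by (auto simp: stable_levy_process_def levy_process_def Let_def)
  have "char (distr M borel (L (c powr \<alpha> * t))) \<theta> = char (distr M' borel (\<lambda>\<omega>. c * R t \<omega>)) \<theta>" for \<theta>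
  proof (rule tendsto_unique)
    have "((\<lambda>\<delta>. exp (of_real (c powr \<alpha> * t) * ?\<psi> \<theta> \<delta>))
        \<longlongrightarrow> char (distr M borel (L (c powr \<alpha> * t))) \<theta>) (at_right 0)"
      unfolding char_distr[OF \<open>L (c powr \<alpha> * t) \<in> borel_measurable M\<close>]
      using \<open>0 \<le> t\<close> by (intro stable_levy_process_char_mean(3)[OF L a]) simp
    moreover have "filterlim (\<lambda>\<delta>. c * \<delta>) (at_right 0) (at_right 0)"
    proof (rule filterlim_at_withinI)
      have "((\<lambda>\<delta>. c * \<delta>) \<longlongrightarrow> c * 0) (at_right 0)"
        by (intro tendsto_intros)
      then show "((\<lambda>\<delta>. c * \<delta>) \<longlongrightarrow> 0) (at_right 0)"
        by simp
      show "\<forall>\<^sub>F \<delta> in at_right 0. c * \<delta> \<in> {0<..} - {0}"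
        using eventually_at_right_less[of 0] by eventually_elim (use \<open>0 < c\<close> in auto)
    qed
    ultimately have "((\<lambda>\<delta>. exp (of_real (c powr \<alpha> * t) * ?\<psi> \<theta> (c * \<delta>)))
        \<longlongrightarrow> char (distr M borel (L (c powr \<alpha> * t))) \<theta>) (at_right 0)"
      by (rule filterlim_compose)
    moreover have "of_real (c powr \<alpha> * t) * ?\<psi> \<theta> (c * \<delta>) = of_real t * ?\<psi> (c * \<theta>) \<delta>" for \<delta>
    proof -
      have "c powr \<alpha> * c powr (- \<alpha>) = 1"
        using \<open>0 < c\<close> by (simp add: powr_minus)
      then have "of_real (c powr \<alpha>) * of_real (c powr (- \<alpha>)) = (1 :: complex)"
        by (metis of_real_1 of_real_mult)
      then show ?thesis
        using levy_exponent_scale[OF \<open>0 < c\<close> a(2,3), of \<alpha> \<theta> \<delta>] by (simp add: algebra_simps)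
    qed
    ultimately show "((\<lambda>\<delta>. exp (of_real t * ?\<psi> (c * \<theta>) \<delta>))
        \<longlongrightarrow> char (distr M borel (L (c powr \<alpha> * t))) \<theta>) (at_right 0)"
      by (simp only:)
    have "char (distr M' borel (\<lambda>\<omega>. c * R t \<omega>)) \<theta> = (\<integral>\<omega>. iexp ((c * \<theta>) * R t \<omega>) \<partial>M')"
      by (subst char_distr) (auto simp: mult_ac)
    then show "((\<lambda>\<delta>. exp (of_real t * ?\<psi> (c * \<theta>) \<delta>))
        \<longlongrightarrow> char (distr M' borel (\<lambda>\<omega>. c * R t \<omega>)) \<theta>) (at_right 0)"
      using stable_levy_process_char_mean(3)[OF R a \<open>0 \<le> t\<close>, of "c * \<theta>"] by (simp only:)
  qed (simp add: trivial_limit_at_right_real)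
  then show ?thesis
    by (intro Levy_uniqueness prob_space.real_distribution_distr M) auto
qed

section \<open>Increments and running maximum of Levy processes\<close>

lemma levy_processD:
  assumes "levy_process M L"
  shows "prob_space M" "\<And>t. 0 \<le> t \<Longrightarrow> L t \<in> borel_measurable M"
    "\<And>\<omega>. \<omega> \<in> space M \<Longrightarrow> L 0 \<omega> = 0" "\<And>\<omega>. \<omega> \<in> space M \<Longrightarrow> cadlag (\<lambda>t. L t \<omega>)"
  using assms by (auto simp: levy_process_def)

lemma levy_process_indep_increments:
  "levy_process M L \<Longrightarrow> 0 \<le> t 0 \<Longrightarrow> mono_on {..n} t \<Longrightarrow>
    prob_space.indep_vars M (\<lambda>_. borel) (\<lambda>i \<omega>. L (t (Suc i)) \<omega> - L (t i) \<omega>) {..<n::nat}"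
  unfolding levy_process_def by blast

lemma levy_process_increment_distr:
  assumes L: "levy_process M L" and "0 \<le> s" "0 \<le> h"
  shows "distr M borel (\<lambda>\<omega>. c * (L (s + h) \<omega> - L s \<omega>)) = distr M borel (\<lambda>\<omega>. c * L h \<omega>)"
proof -
  note [measurable] = levy_processD(2)[OF L]
  have [measurable]: "(\<lambda>\<omega>. L (s + h) \<omega> - L s \<omega>) \<in> borel_measurable M" "L h \<in> borel_measurable M"
    using assms by auto
  have "distr M borel (\<lambda>\<omega>. L (s + h) \<omega> - L s \<omega>) = distr M borel (L h)"
    using assms unfolding levy_process_def by blast
  then have "distr (distr M borel (\<lambda>\<omega>. L (s + h) \<omega> - L s \<omega>)) borel (\<lambda>x. c * x)
      = distr (distr M borel (L h)) borel (\<lambda>x. c * x)"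
    by simp
  then show ?thesis
    by (simp add: distr_distr comp_def)
qed

lemma levy_process_grid_distr:
  assumes L: "levy_process M L" and "0 \<le> a" "0 \<le> h" "0 < n"
  shows "distr M (\<Pi>\<^sub>M k\<in>{..<n}. borel)
      (\<lambda>\<omega>. \<lambda>k\<in>{..<n}. c * (L (a + real (Suc k) * h) \<omega> - L (a + real k * h) \<omega>))
    = (\<Pi>\<^sub>M k\<in>{..<n}. distr M borel (\<lambda>\<omega>. c * L h \<omega>))"
proof -
  interpret prob_space M
    using L by (rule levy_processD)
  let ?t = "\<lambda>k. a + real k * h"
  have meas: "(\<lambda>\<omega>. c * (L (?t (Suc k)) \<omega> - L (?t k) \<omega>)) \<in> borel_measurable M" for k
  proof -
    have [measurable]: "L (?t (Suc k)) \<in> borel_measurable M" "L (?t k) \<in> borel_measurable M"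
      using levy_processD(2)[OF L] assms by auto
    show ?thesis
      by measurable
  qed
  have "mono_on {..n} ?t"
    using \<open>0 \<le> h\<close> by (auto intro!: mono_onI mult_right_mono)
  then have "indep_vars (\<lambda>_. borel) (\<lambda>k \<omega>. L (?t (Suc k)) \<omega> - L (?t k) \<omega>) {..<n}"
    by (intro levy_process_indep_increments[OF L]) (use \<open>0 \<le> a\<close> in auto)
  then have "indep_vars (\<lambda>_. borel) (\<lambda>k \<omega>. c * (L (?t (Suc k)) \<omega> - L (?t k) \<omega>)) {..<n}"
    by (rule indep_vars_compose2) auto
  then have "distr M (\<Pi>\<^sub>M k\<in>{..<n}. borel) (\<lambda>\<omega>. \<lambda>k\<in>{..<n}. c * (L (?t (Suc k)) \<omega> - L (?t k) \<omega>))
      = (\<Pi>\<^sub>M k\<in>{..<n}. distr M borel (\<lambda>\<omega>. c * (L (?t (Suc k)) \<omega> - L (?t k) \<omega>)))"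
    by (subst (asm) indep_vars_iff_distr_eq_PiM'[OF _ meas]) (use \<open>0 < n\<close> in auto)
  also have "\<dots> = (\<Pi>\<^sub>M k\<in>{..<n}. distr M borel (\<lambda>\<omega>. c * L h \<omega>))"
  proof (rule PiM_cong[OF refl])
    fix k
    have "?t (Suc k) = ?t k + h"
      by (simp add: algebra_simps)
    then show "distr M borel (\<lambda>\<omega>. c * (L (?t (Suc k)) \<omega> - L (?t k) \<omega>)) = distr M borel (\<lambda>\<omega>. c * L h \<omega>)"
      using assms by (simp only:) (intro levy_process_increment_distr[OF L], simp_all)
  qed
  finally show ?thesis .
qed

text \<open>Increments over a uniform grid are independent and identically distributed, so an
  identity in law at one time step extends to every functional of them. Invariance under
  \<open>restrict\<close> says that \<open>g\<close> reads only the first \<open>n\<close>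
  increments, which lets it be applied to the unrestricted sequence.\<close>

lemma levy_process_grid_functional_distr:
  fixes g :: "(nat \<Rightarrow> real) \<Rightarrow> real"
  assumes L: "levy_process M L" "levy_process M' R"
    and scale: "distr M borel (\<lambda>\<omega>. c * L h \<omega>) = distr M' borel (\<lambda>\<omega>. c' * R h' \<omega>)"
    and "0 \<le> a" "0 \<le> h" "0 \<le> a'" "0 \<le> h'" "0 < n"
    and [measurable]: "g \<in> borel_measurable (\<Pi>\<^sub>M k\<in>{..<n}. borel)"
    and g: "\<And>\<xi>. g (restrict \<xi> {..<n}) = g \<xi>"
  shows "distr M borel (\<lambda>\<omega>. g (\<lambda>k. c * (L (a + real (Suc k) * h) \<omega> - L (a + real k * h) \<omega>)))
    = distr M' borel (\<lambda>\<omega>. g (\<lambda>k. c' * (R (a' + real (Suc k) * h') \<omega> - R (a' + real k * h') \<omega>)))"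
proof -
  have *: "distr M borel (\<lambda>\<omega>. g (\<lambda>k. c * (L (a + real (Suc k) * h) \<omega> - L (a + real k * h) \<omega>)))
    = distr (\<Pi>\<^sub>M k\<in>{..<n}. distr M borel (\<lambda>\<omega>. c * L h \<omega>)) borel g"
    if L: "levy_process M L" and a: "0 \<le> a" "0 \<le> h" for M :: "'c measure" and L and a h c :: real
  proof -
    have [measurable]: "L (a + real k * h) \<in> borel_measurable M" for k
      using levy_processD(2)[OF L, of "a + real k * h"] a by simp
    have [measurable]: "L (a + real (Suc k) * h) \<in> borel_measurable M" for k
      using levy_processD(2)[OF L, of "a + real (Suc k) * h"] a by simp
    show ?thesis
      unfolding levy_process_grid_distr[OF L a \<open>0 < n\<close>, symmetric]
      by (subst distr_distr) (auto simp: comp_def g simp del: of_nat_Suc)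
  qed
  show ?thesis
    using *[OF L(1), of a h c] *[OF L(2), of a' h' c'] assms by (simp add: scale)
qed

lemma borel_measurable_levy_process_euler:
  assumes L: "levy_process M L" and F: "mono F" "continuous_on UNIV F"
    and "0 \<le> d" "0 \<le> a" "0 \<le> h"
  shows "(\<lambda>\<omega>. implicit_euler F d x (\<lambda>k. c * (L (a + real (Suc k) * h) \<omega> - L (a + real k * h) \<omega>)) n)
    \<in> borel_measurable M"
proof (rule borel_measurable_implicit_euler[OF F \<open>0 \<le> d\<close>])
  fix k
  have [measurable]: "L (a + real (Suc k) * h) \<in> borel_measurable M" "L (a + real k * h) \<in> borel_measurable M"
    using assms by (intro levy_processD(2)[OF L]; simp)+
  show "(\<lambda>\<omega>. c * (L (a + real (Suc k) * h) \<omega> - L (a + real k * h) \<omega>)) \<in> borel_measurable M"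
    by measurable
qed

text \<open>The grid points of all windows are concatenated: the window of rank \<open>i\<close> occupies the indices from
  \<open>i * (n + 1)\<close> to \<open>i * (n + 1) + n\<close>, and the increment starting at its last index is the gap to the
  next window.\<close>

lemma levy_process_windows_indep:
  fixes g :: "real \<Rightarrow> (nat \<Rightarrow> real) \<Rightarrow> real"
  assumes L: "levy_process M L" and S: "finite S"
    and windows: "\<And>s. s \<in> S \<Longrightarrow> 0 \<le> a s \<and> 0 \<le> h s"
      "\<And>s s'. s \<in> S \<Longrightarrow> s' \<in> S \<Longrightarrow> s < s' \<Longrightarrow> a s + real n * h s \<le> a s'"
    and meas: "\<And>s. s \<in> S \<Longrightarrow> g s \<in> borel_measurable (\<Pi>\<^sub>M k\<in>{..<n}. borel)"
    and g: "\<And>s \<xi>. s \<in> S \<Longrightarrow> g s (restrict \<xi> {..<n}) = g s \<xi>"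
  shows "prob_space.indep_vars M (\<lambda>_. borel)
    (\<lambda>s \<omega>. g s (\<lambda>k. L (a s + real (Suc k) * h s) \<omega> - L (a s + real k * h s) \<omega>)) S"
proof (cases "S = {}")
  case True
  interpret prob_space M
    using L by (rule levy_processD)
  show ?thesis
    by (simp add: True indep_vars_def indep_sets_def)
next
  case False
  interpret prob_space M
    using L by (rule levy_processD)
  define d where "d = card S"
  \<comment> \<open>\<open>p\<close> lists \<open>S\<close> in increasing order and \<open>r\<close>
    is the rank of a time; ordered windows make the concatenated grid monotone.\<close>
  define p where "p = (\<lambda>i. sorted_list_of_set S ! i)"
  define r where "r = inv_into {..<d} p"
  have len: "length (sorted_list_of_set S) = d"
    using S by (simp add: d_def)
  have "0 < d"
    using S False by (simp add: d_def card_gt_0_iff)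
  have p_less: "p i < p j" if "i < j" "j < d" for i j
    unfolding p_def using that len by (intro sorted_wrt_nth_less[OF strict_sorted_list_of_set]) auto
  have p_img: "p ` {..<d} = S"
    using S len nth_image[of d "sorted_list_of_set S"] by (simp add: p_def atLeast0LessThan)
  have r: "r s < d" "p (r s) = s" if "s \<in> S" for s
    using that inv_into_into[of s p "{..<d}"] f_inv_into_f[of s p "{..<d}"] by (auto simp: p_img r_def)
  have pS: "p i \<in> S" if "i < d" for i
    using that p_img by auto
  define T where "T = (\<lambda>j. a (p (j div Suc n)) + real (j mod Suc n) * h (p (j div Suc n)))"
  \<comment> \<open>There are \<open>d * Suc n\<close> grid points, hence one increment
    less.\<close>
  define m where "m = d * Suc n - 1"
  have mono: "mono_on {..m} T"
  proof (rule mono_onI)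
    fix i j assume ij: "i \<in> {..m}" "j \<in> {..m}" "i \<le> j"
    have "j < d * Suc n"
      using ij \<open>0 < d\<close> by (auto simp: m_def)
    then have jd: "j div Suc n < d"
      by (simp add: less_mult_imp_div_less)
    have idj: "i div Suc n \<le> j div Suc n"
      using ij by (intro div_le_mono)
    then have id: "i div Suc n < d"
      using jd by simp
    show "T i \<le> T j"
    proof (cases "i div Suc n = j div Suc n")
      case True
      have "Suc n * (i div Suc n) + i mod Suc n \<le> Suc n * (j div Suc n) + j mod Suc n"
        using ij by (simp only: mult_div_mod_eq atMost_iff)
      then have "i mod Suc n \<le> j mod Suc n"
        unfolding True by (rule add_le_imp_le_left)
      then show ?thesis
        unfolding T_def True using windows(1)[OF pS[OF jd]] by (auto intro!: mult_right_mono)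
    next
      case False
      then have less: "p (i div Suc n) < p (j div Suc n)"
        using idj jd by (intro p_less) auto
      have "i mod Suc n < Suc n"
        by simp
      then have "i mod Suc n \<le> n"
        by linarith
      then have "T i \<le> a (p (i div Suc n)) + real n * h (p (i div Suc n))"
        unfolding T_def using windows(1)[OF pS[OF id]] by (auto intro!: mult_right_mono)
      also have "\<dots> \<le> a (p (j div Suc n))"
        using windows(2)[OF pS[OF id] pS[OF jd] less] .
      also have "\<dots> \<le> T j"
        unfolding T_def using windows(1)[OF pS[OF jd]] by auto
      finally show ?thesis .
    qed
  qed
  have "0 \<le> T 0"
    using windows(1)[OF pS[OF \<open>0 < d\<close>]] by (simp add: T_def)
  then have "indep_vars (\<lambda>_. borel) (\<lambda>i \<omega>. L (T (Suc i)) \<omega> - L (T i) \<omega>) {..<m}"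
    using mono by (rule levy_process_indep_increments[OF L])
  define X where "X = (\<lambda>i \<omega>. L (T (Suc i)) \<omega> - L (T i) \<omega>)"
  \<comment> \<open>The \<open>n\<close> increments inside a window; the gap increment of index
    \<open>r s * Suc n + n\<close> is left out.\<close>
  define K where "K = (\<lambda>s. {r s * Suc n..<r s * Suc n + n})"
  have T_eq: "T (r s * Suc n + k) = a s + real k * h s" if "s \<in> S" "k \<le> n" for s k
  proof -
    have "(r s * Suc n + k) div Suc n = r s" "(r s * Suc n + k) mod Suc n = k"
      using that(2) by (simp_all del: mult_Suc_right)
    then show ?thesis
      using r[OF that(1)] by (simp add: T_def del: mult_Suc_right)
  qed
  have "indep_vars (\<lambda>s. PiM (K s) (\<lambda>_. borel)) (\<lambda>s \<omega>. restrict (\<lambda>i. X i \<omega>) (K s)) S"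
  proof (rule indep_vars_restrict)
    show "indep_vars (\<lambda>_. borel) X {..<m}"
      unfolding X_def by fact
    show "K s \<subseteq> {..<m}" if "s \<in> S" for s
    proof -
      have "Suc (r s) * Suc n \<le> d * Suc n"
        using r(1)[OF that] by (intro mult_right_mono) auto
      then show ?thesis
        by (auto simp: K_def m_def)
    qed
    show "disjoint_family_on K S"
    proof (unfold disjoint_family_on_def, intro ballI impI)
      have *: "K s \<inter> K s' = {}" if "r s < r s'" for s s'
      proof -
        have "Suc (r s) * Suc n \<le> r s' * Suc n"
          using that by (intro mult_right_mono) auto
        then show ?thesis
          by (auto simp: K_def)
      qed
      fix s s' assume "s \<in> S" "s' \<in> S" "s \<noteq> s'"
      then have "r s \<noteq> r s'"
        using r by metis
      then show "K s \<inter> K s' = {}"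
        using *[of s s'] *[of s' s] by (auto simp: neq_iff)
    qed
  qed
  moreover have "(\<lambda>\<phi>. g s (\<lambda>k\<in>{..<n}. \<phi> (r s * Suc n + k))) \<in> borel_measurable (PiM (K s) (\<lambda>_. borel))"
    if "s \<in> S" for s
  proof -
    have "(\<lambda>\<phi>. \<lambda>k\<in>{..<n}. \<phi> (r s * Suc n + k)) \<in> measurable (PiM (K s) (\<lambda>_. borel :: real measure)) (\<Pi>\<^sub>M k\<in>{..<n}. borel)"
      by (intro measurable_restrict measurable_component_singleton) (auto simp: K_def)
    then show ?thesis
      using meas[OF that] by (rule measurable_compose)
  qed
  ultimately have "indep_vars (\<lambda>_. borel)
      (\<lambda>s \<omega>. g s (\<lambda>k\<in>{..<n}. restrict (\<lambda>i. X i \<omega>) (K s) (r s * Suc n + k))) S"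
    by (rule indep_vars_compose2)
  moreover have "g s (\<lambda>k\<in>{..<n}. restrict (\<lambda>i. X i \<omega>) (K s) (r s * Suc n + k))
      = g s (\<lambda>k. L (a s + real (Suc k) * h s) \<omega> - L (a s + real k * h s) \<omega>)" if "s \<in> S" for s \<omega>
  proof -
    have "restrict (\<lambda>i. X i \<omega>) (K s) (r s * Suc n + k)
        = L (a s + real (Suc k) * h s) \<omega> - L (a s + real k * h s) \<omega>" if "k < n" for k
      using T_eq[OF \<open>s \<in> S\<close>, of k] T_eq[OF \<open>s \<in> S\<close>, of "Suc k"] that by (simp add: K_def X_def)
    then have "(\<lambda>k\<in>{..<n}. restrict (\<lambda>i. X i \<omega>) (K s) (r s * Suc n + k))
        = restrict (\<lambda>k. L (a s + real (Suc k) * h s) \<omega> - L (a s + real k * h s) \<omega>) {..<n}"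
      by (intro restrict_ext) auto
    then show ?thesis
      using g[OF that] by simp
  qed
  ultimately show ?thesis
    by (simp cong: indep_vars_cong)
qed

text \<open>By right continuity a strict excess at \<open>s\<close> persists on an interval to the
  right of \<open>s\<close>, which contains a dyadic multiple of \<tau>; the end point \<tau> has no
  right neighbours in the range but is itself on the grid. This turns the supremum over a continuum
  into a countable condition.\<close>

lemma cadlag_exceeds_dyadic:
  assumes l: "cadlag l" and "0 < \<tau>"
  shows "(\<exists>s\<in>{0..\<tau>}. x < \<bar>l s\<bar>) \<longleftrightarrow> (\<exists>n. \<exists>k\<le>2 ^ n. x < \<bar>l (real k * (\<tau> / 2 ^ n))\<bar>)"
proof
  assume "\<exists>s\<in>{0..\<tau>}. x < \<bar>l s\<bar>"
  then obtain s where s: "0 \<le> s" "s \<le> \<tau>" "x < \<bar>l s\<bar>"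
    by auto
  show "\<exists>n. \<exists>k\<le>2 ^ n. x < \<bar>l (real k * (\<tau> / 2 ^ n))\<bar>"
  proof (cases "s = \<tau>")
    case True
    then show ?thesis
      using s by (intro exI[of _ 0] exI[of _ 1]) auto
  next
    case False
    have "((\<lambda>u. \<bar>l u\<bar>) \<longlongrightarrow> \<bar>l s\<bar>) (at_right s)"
      using l s by (intro tendsto_intros) (simp add: cadlag_def)
    then have "\<forall>\<^sub>F u in at_right s. x < \<bar>l u\<bar>"
      using s by (intro order_tendstoD)
    then obtain b where b: "s < b" "\<And>u. s < u \<Longrightarrow> u < b \<Longrightarrow> x < \<bar>l u\<bar>"
      unfolding eventually_at_right_field by blast
    define b' where "b' = min b \<tau>"
    have b': "s < b'" "b' \<le> b" "b' \<le> \<tau>"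
      using b s False by (auto simp: b'_def)
    obtain n where n: "\<tau> / (b' - s) < 2 ^ n"
      using real_arch_pow[of 2] by auto
    \<comment> \<open>The first grid index strictly beyond \<open>s\<close>; the mesh is smaller
      than \<open>b' - s\<close>, so this grid point falls before \<open>b'\<close>.\<close>
    define k where "k = nat (\<lfloor>s * 2 ^ n / \<tau>\<rfloor> + 1)"
    have "0 \<le> s * 2 ^ n / \<tau>"
      using s \<open>0 < \<tau>\<close> by simp
    then have k: "real k = real_of_int \<lfloor>s * 2 ^ n / \<tau>\<rfloor> + 1"
      by (simp add: k_def)
    have "s * 2 ^ n / \<tau> < real k" "real k \<le> s * 2 ^ n / \<tau> + 1"
      unfolding k by linarith+
    then have "s < real k * (\<tau> / 2 ^ n)" "real k * (\<tau> / 2 ^ n) \<le> s + \<tau> / 2 ^ n"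
      using \<open>0 < \<tau>\<close> by (auto simp: field_simps)
    moreover have "\<tau> / 2 ^ n < b' - s"
      using n b' by (simp add: field_simps)
    ultimately have u: "s < real k * (\<tau> / 2 ^ n)" "real k * (\<tau> / 2 ^ n) < b'"
      by auto
    have "real k * (\<tau> / 2 ^ n) < 2 ^ n * (\<tau> / 2 ^ n)"
      using u b' by simp
    then have "real k < 2 ^ n"
      by (rule mult_right_less_imp_less) (use \<open>0 < \<tau>\<close> in simp)
    then have "k \<le> 2 ^ n"
      by (metis less_imp_le of_nat_less_iff of_nat_numeral of_nat_power)
    then show ?thesis
      using u b(2)[of "real k * (\<tau> / 2 ^ n)"] b' by auto
  qed
next
  assume "\<exists>n. \<exists>k\<le>2 ^ n. x < \<bar>l (real k * (\<tau> / 2 ^ n))\<bar>"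
  then obtain n k where k: "k \<le> 2 ^ n" "x < \<bar>l (real k * (\<tau> / 2 ^ n))\<bar>"
    by auto
  have "real k \<le> 2 ^ n"
    using k(1) by (metis of_nat_le_iff of_nat_numeral of_nat_power)
  then have "real k * \<tau> \<le> 2 ^ n * \<tau>"
    using \<open>0 < \<tau>\<close> by (intro mult_right_mono) auto
  then show "\<exists>s\<in>{0..\<tau>}. x < \<bar>l s\<bar>"
    using k(2) \<open>0 < \<tau>\<close> by (intro bexI[of _ "real k * (\<tau> / 2 ^ n)"]) (auto simp: field_simps)
qed

text \<open>By exact scaling the running maximum over \<open>[0, \<tau>]\<close> is distributed as a multiple of that over
  \<open>[0, 1]\<close>, so that its tightness needs no maximal inequality.\<close>

lemma levy_process_sup_distr:
  assumes L: "levy_process M L"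
    and scale: "\<And>t. 0 \<le> t \<Longrightarrow> distr M borel (L (\<tau> * t)) = distr M borel (\<lambda>\<omega>. c * L t \<omega>)"
    and "0 < \<tau>" "0 < c"
  shows "{\<omega> \<in> space M. \<exists>s\<in>{0..\<tau>}. c * x < \<bar>L s \<omega>\<bar>} \<in> sets M"
    and "measure M {\<omega> \<in> space M. \<exists>s\<in>{0..\<tau>}. c * x < \<bar>L s \<omega>\<bar>}
      = measure M {\<omega> \<in> space M. \<exists>s\<in>{0..1}. x < \<bar>L s \<omega>\<bar>}"
proof -
  interpret prob_space M
    using L by (rule levy_processD)
  define B where "B = (\<lambda>b y n. {\<omega> \<in> space M. \<exists>k\<le>2 ^ n. y < \<bar>L (real k * (b / 2 ^ n)) \<omega>\<bar>})"
  have B_sets: "B b y n \<in> sets M" if "0 < b" for b y n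
  proof -
    have [measurable]: "L (real k * (b / 2 ^ n)) \<in> borel_measurable M" for k
      using levy_processD(2)[OF L, of "real k * (b / 2 ^ n)"] that by simp
    show ?thesis
      unfolding B_def by measurable
  qed
  have B_Un: "{\<omega> \<in> space M. \<exists>s\<in>{0..b}. y < \<bar>L s \<omega>\<bar>} = (\<Union>n. B b y n)" if "0 < b" for b y
    unfolding B_def using cadlag_exceeds_dyadic[OF levy_processD(4)[OF L] that] by blast
  have B_inc: "incseq (B b y)" for b y
  proof (rule incseq_SucI, rule subsetI)
    fix n \<omega> assume "\<omega> \<in> B b y n"
    then obtain k where "\<omega> \<in> space M" "k \<le> 2 ^ n" "y < \<bar>L (real k * (b / 2 ^ n)) \<omega>\<bar>"
      by (auto simp: B_def)
    moreover then have "y < \<bar>L (real (2 * k) * (b / 2 ^ Suc n)) \<omega>\<bar>" "2 * k \<le> 2 ^ Suc n"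
      by auto
    ultimately show "\<omega> \<in> B b y (Suc n)"
      unfolding B_def by blast
  qed
  have lim: "(\<lambda>n. measure M (B b y n)) \<longlonglongrightarrow> measure M {\<omega> \<in> space M. \<exists>s\<in>{0..b}. y < \<bar>L s \<omega>\<bar>}"
    if "0 < b" for b y
    unfolding B_Un[OF that] using B_sets[OF that] B_inc by (intro finite_Lim_measure_incseq) auto
  show "{\<omega> \<in> space M. \<exists>s\<in>{0..\<tau>}. c * x < \<bar>L s \<omega>\<bar>} \<in> sets M"
    unfolding B_Un[OF \<open>0 < \<tau>\<close>] using B_sets[OF \<open>0 < \<tau>\<close>] by auto
  have eq: "measure M (B \<tau> (c * x) n) = measure M (B 1 x n)" for n
  proof -
    define N where "N = (2 ^ n :: nat)"
    \<comment> \<open>The event as a functional of increments. Both sides of the scaling become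
      events with the same threshold \<open>c * x\<close> for partial sums, on a grid of [0, \<tau>]
      and on a grid of [0, 1] with increments multiplied by \<open>c\<close>.\<close>
    define g where "g = (\<lambda>\<xi>. if \<exists>k\<le>N. c * x < \<bar>\<Sum>j<k. \<xi> j\<bar> then 1 else 0 :: real)"
    have g_meas[measurable]: "g \<in> borel_measurable (\<Pi>\<^sub>M k\<in>{..<N}. borel)"
    proof -
      have "(\<lambda>\<xi>. \<Sum>j<k. \<xi> j) \<in> borel_measurable (\<Pi>\<^sub>M k\<in>{..<N}. borel :: real measure)" if "k \<le> N" for k
        using that by (intro borel_measurable_sum measurable_component_singleton) auto
      then have "Measurable.pred (\<Pi>\<^sub>M k\<in>{..<N}. borel) (\<lambda>\<xi>. k \<le> N \<and> c * x < \<bar>\<Sum>j<k. \<xi> j\<bar>)" for k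
        by (cases "k \<le> N") auto
      then have "Measurable.pred (\<Pi>\<^sub>M k\<in>{..<N}. borel) (\<lambda>\<xi>. \<exists>k\<le>N. c * x < \<bar>\<Sum>j<k. \<xi> j\<bar>)"
        by (intro pred_intros_countable)
      then show ?thesis
        unfolding g_def by measurable
    qed
    have g_cong: "g (restrict \<xi> {..<N}) = g \<xi>" for \<xi>
    proof -
      have "(\<Sum>j<k. restrict \<xi> {..<N} j) = (\<Sum>j<k. \<xi> j)" if "k \<le> N" for k
        using that by (intro sum.cong) auto
      then show ?thesis
        by (simp add: g_def cong: conj_cong)
    qed
    have g_eq: "{\<omega> \<in> space M. g (\<lambda>k. e * (L (0 + real (Suc k) * (b / N)) \<omega> - L (0 + real k * (b / N)) \<omega>)) = 1}
        = B b (c * x / e) n" if "0 < e" for e b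
    proof -
      have "(\<Sum>j<k. e * (L (0 + real (Suc j) * (b / N)) \<omega> - L (0 + real j * (b / N)) \<omega>))
          = e * L (real k * (b / N)) \<omega>" if "\<omega> \<in> space M" for k \<omega>
        using sum_lessThan_telescope[of "\<lambda>j. L (real j * (b / N)) \<omega>" k] levy_processD(3)[OF L that]
        by (simp add: sum_distrib_left[symmetric])
      then show ?thesis
        using that by (auto simp: g_def B_def N_def abs_mult field_simps)
    qed
    have "distr M borel (\<lambda>\<omega>. g (\<lambda>k. 1 * (L (0 + real (Suc k) * (\<tau> / N)) \<omega> - L (0 + real k * (\<tau> / N)) \<omega>)))
      = distr M borel (\<lambda>\<omega>. g (\<lambda>k. c * (L (0 + real (Suc k) * (1 / N)) \<omega> - L (0 + real k * (1 / N)) \<omega>)))"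
      using scale[of "1 / N"] assms g_cong
      by (intro levy_process_grid_functional_distr[where n = N, OF L L] g_meas g_cong) (auto simp: N_def)
    then have distr_eq: "measure (distr M borel (\<lambda>\<omega>. g (\<lambda>k. 1 * (L (0 + real (Suc k) * (\<tau> / N)) \<omega> - L (0 + real k * (\<tau> / N)) \<omega>)))) {1}
      = measure (distr M borel (\<lambda>\<omega>. g (\<lambda>k. c * (L (0 + real (Suc k) * (1 / N)) \<omega> - L (0 + real k * (1 / N)) \<omega>)))) {1}"
      by simp
    have mB: "measure (distr M borel (\<lambda>\<omega>. g (\<lambda>k. e * (L (0 + real (Suc k) * (b / N)) \<omega> - L (0 + real k * (b / N)) \<omega>)))) {1}
        = measure M (B b (c * x / e) n)" if "0 < e" "0 < b" for e b
    proof -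
      have [measurable]: "L (0 + real k * (b / N)) \<in> borel_measurable M" for k
        using levy_processD(2)[OF L, of "0 + real k * (b / N)"] that by simp
      have [measurable]: "L (0 + real (Suc k) * (b / N)) \<in> borel_measurable M" for k
        using levy_processD(2)[OF L, of "0 + real (Suc k) * (b / N)"] that by simp
      have "(\<lambda>\<omega>. g (restrict (\<lambda>k. e * (L (0 + real (Suc k) * (b / N)) \<omega> - L (0 + real k * (b / N)) \<omega>)) {..<N})) \<in> borel_measurable M"
        by measurable
      then have "(\<lambda>\<omega>. g (\<lambda>k. e * (L (0 + real (Suc k) * (b / N)) \<omega> - L (0 + real k * (b / N)) \<omega>))) \<in> borel_measurable M"
        by (simp add: g_cong)
      then show ?thesis
        unfolding g_eq[OF that(1), symmetric]
        by (subst measure_distr) (auto intro!: arg_cong[where f = "measure M"])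
    qed
    show ?thesis
      using distr_eq unfolding mB[OF zero_less_one \<open>0 < \<tau>\<close>] mB[OF \<open>0 < c\<close> zero_less_one]
      using \<open>0 < c\<close> by simp
  qed
  show "measure M {\<omega> \<in> space M. \<exists>s\<in>{0..\<tau>}. c * x < \<bar>L s \<omega>\<bar>}
      = measure M {\<omega> \<in> space M. \<exists>s\<in>{0..1}. x < \<bar>L s \<omega>\<bar>}"
    using lim[OF \<open>0 < \<tau>\<close>, of "c * x"] lim[of 1 x] unfolding eq by (intro LIMSEQ_unique) auto
qed

text \<open>Each path is bounded on [0, 1], so the events that its absolute value exceeds
  \<open>n\<close> there decrease to the empty set.\<close>

lemma levy_process_sup_tight:
  assumes L: "levy_process M L" and "0 < e"
  shows "\<exists>K>0. measure M {\<omega> \<in> space M. \<exists>s\<in>{0..1}. K < \<bar>L s \<omega>\<bar>} < e"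
proof -
  interpret prob_space M
    using L by (rule levy_processD)
  define A where "A = (\<lambda>n. {\<omega> \<in> space M. \<exists>s\<in>{0..1}. real n < \<bar>L s \<omega>\<bar>})"
  have sets: "range A \<subseteq> sets M"
    unfolding A_def using levy_process_sup_distr(1)[OF L, of 1 1] by auto
  have dec: "decseq A"
    unfolding decseq_def
  proof (intro allI impI subsetI)
    fix m n \<omega> assume "m \<le> n" "\<omega> \<in> A n"
    then obtain s where "\<omega> \<in> space M" "s \<in> {0..1}" "real n < \<bar>L s \<omega>\<bar>"
      by (auto simp: A_def)
    moreover then have "real m < \<bar>L s \<omega>\<bar>"
      using \<open>m \<le> n\<close> by simp
    ultimately show "\<omega> \<in> A m"
      unfolding A_def by blast
  qed
  have "(\<Inter>n. A n) = {}"
  proof -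
    have "\<exists>n. \<omega> \<notin> A n" if \<omega>: "\<omega> \<in> space M" for \<omega>
    proof -
      have "0 \<le> (0::real)"
        by simp
      obtain K where "\<forall>s\<in>{0..1}. \<bar>L s \<omega>\<bar> \<le> K"
        using cadlag_bounded_on[OF levy_processD(4)[OF L \<omega>] \<open>0 \<le> 0\<close>, of 1] by blast
      moreover obtain n where "K \<le> real n"
        using real_arch_simple by blast
      ultimately have "\<omega> \<notin> A n"
        by (force simp: A_def)
      then show ?thesis ..
    qed
    moreover have "A 0 \<subseteq> space M"
      by (auto simp: A_def)
    ultimately show ?thesis
      by blast
  qed
  then have "(\<lambda>n. measure M (A n)) \<longlonglongrightarrow> 0"
    using finite_Lim_measure_decseq[OF sets dec] by simp
  then have "\<forall>\<^sub>F n in sequentially. 0 < n \<and> measure M (A n) < e"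
    using \<open>0 < e\<close> by (intro eventually_conj eventually_gt_at_top order_tendstoD)
  then obtain n where "0 < n" "measure M (A n) < e"
    by (auto dest: eventually_happens)
  then show ?thesis
    unfolding A_def by (intro exI[of _ "real n"]) auto
qed

section \<open>Weak convergence from couplings\<close>

text \<open>Continuity is given through the abstract product topology on
  \<open>extensional S\<close>. For finite \<open>S\<close> a basic open set contains a cube around
  each of its points, and the arguments below only use cubes; the 1 inserted under
  \<open>Min\<close> covers the empty index set.\<close>

lemma continuous_map_product_ball:
  assumes S: "finite S" and f: "continuous_map (product_topology (\<lambda>_. euclideanreal) S) euclideanreal f"
    and w: "w \<in> extensional S" and "0 < e"
  shows "\<exists>\<delta>>0. \<forall>u\<in>extensional S. (\<forall>i\<in>S. \<bar>u i - w i\<bar> < \<delta>) \<longrightarrow> \<bar>f u - f w\<bar> < e"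
proof -
  let ?T = "product_topology (\<lambda>_. euclideanreal) S"
  define U where "U = {u \<in> topspace ?T. f u \<in> ball (f w) e}"
  have "openin ?T U"
    unfolding U_def using f by (rule openin_continuous_map_preimage) simp
  then have "\<forall>x\<in>U. \<exists>V. finite {i \<in> S. V i \<noteq> topspace euclideanreal} \<and>
      (\<forall>i\<in>S. openin euclideanreal (V i)) \<and> x \<in> Pi\<^sub>E S V \<and> Pi\<^sub>E S V \<subseteq> U"
    unfolding openin_product_topology_alt .
  moreover have "w \<in> U"
    using w \<open>0 < e\<close> by (auto simp: U_def PiE_def)
  ultimately obtain V where V: "\<forall>i\<in>S. openin euclideanreal (V i)" "w \<in> Pi\<^sub>E S V" "Pi\<^sub>E S V \<subseteq> U"
    by (elim ballE[where x = w] exE conjE) blast+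
  have "\<forall>i\<in>S. \<exists>d>0. ball (w i) d \<subseteq> V i"
  proof
    fix i assume "i \<in> S"
    then have "openin euclideanreal (V i)" "w i \<in> V i"
      using V(1) PiE_mem[OF V(2)] by blast+
    then show "\<exists>d>0. ball (w i) d \<subseteq> V i"
      by (simp add: open_contains_ball)
  qed
  then obtain d where d: "\<And>i. i \<in> S \<Longrightarrow> 0 < d i \<and> ball (w i) (d i) \<subseteq> V i"
    by metis
  define \<delta> where "\<delta> = Min (insert 1 (d ` S))"
  have \<delta>: "0 < \<delta>" "\<And>i. i \<in> S \<Longrightarrow> \<delta> \<le> d i"
    using S d by (auto simp: \<delta>_def)
  have "\<bar>f u - f w\<bar> < e" if "u \<in> extensional S" "\<forall>i\<in>S. \<bar>u i - w i\<bar> < \<delta>" for u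
  proof -
    have "u i \<in> V i" if "i \<in> S" for i
      using d[OF that] \<delta>(2)[OF that] \<open>\<forall>i\<in>S. \<bar>u i - w i\<bar> < \<delta>\<close> that
      by (force simp: subset_eq dist_real_def abs_minus_commute)
    then have "u \<in> U"
      using V that by (auto simp: PiE_def)
    then show ?thesis
      by (simp add: U_def dist_real_def abs_minus_commute)
  qed
  then show ?thesis
    using \<delta>(1) by blast
qed

text \<open>For finite \<open>S\<close> these points form a countable set for each \<open>n\<close>,
  which becomes dense as \<open>n\<close> grows; they take the place of a countable dense subset of
  the product space. The denominator \<open>Suc n\<close> is never 0.\<close>

definition grid_point :: "'i set \<Rightarrow> nat \<Rightarrow> ('i \<Rightarrow> int) \<Rightarrow> 'i \<Rightarrow> real" where
  "grid_point S n k = (\<lambda>i\<in>S. of_int (k i) / real (Suc n))"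

lemma grid_point_approx:
  assumes "0 < \<delta>"
  shows "\<forall>\<^sub>F n in sequentially. \<forall>i\<in>S. \<bar>grid_point S n (\<lambda>i\<in>S. \<lfloor>real (Suc n) * u i\<rfloor>) i - u i\<bar> < \<delta>"
proof -
  have "(\<lambda>n. 1 / real (Suc n)) \<longlonglongrightarrow> 0"
    by (rule LIMSEQ_Suc[OF lim_1_over_n])
  then have "\<forall>\<^sub>F n in sequentially. 1 / real (Suc n) < \<delta>"
    using assms by (rule order_tendstoD)
  then show ?thesis
  proof (eventually_elim, intro ballI)
    fix n i assume n: "1 / real (Suc n) < \<delta>" "i \<in> S"
    let ?N = "real (Suc n)"
    have "\<bar>of_int \<lfloor>?N * u i\<rfloor> - ?N * u i\<bar> < \<delta> * ?N"
      using n by (simp add: field_simps del: of_nat_Suc) linarith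
    moreover have "of_int \<lfloor>?N * u i\<rfloor> / ?N - u i = (of_int \<lfloor>?N * u i\<rfloor> - ?N * u i) / ?N"
      by (simp add: field_simps)
    ultimately show "\<bar>grid_point S n (\<lambda>i\<in>S. \<lfloor>?N * u i\<rfloor>) i - u i\<bar> < \<delta>"
      using n by (simp add: grid_point_def abs_divide pos_divide_less_eq del: of_nat_Suc)
  qed
qed

lemma continuous_map_grid_limit:
  assumes S: "finite S" and f: "continuous_map (product_topology (\<lambda>_. euclideanreal) S) euclideanreal f"
    and u: "u \<in> extensional S"
  shows "(\<lambda>n. f (grid_point S n (\<lambda>i\<in>S. \<lfloor>real (Suc n) * u i\<rfloor>))) \<longlonglongrightarrow> f u"
proof (rule tendstoI)
  fix e :: real assume "0 < e"
  then obtain \<delta> where \<delta>: "0 < \<delta>" "\<And>v. v \<in> extensional S \<Longrightarrow> (\<forall>i\<in>S. \<bar>v i - u i\<bar> < \<delta>) \<Longrightarrow> \<bar>f v - f u\<bar> < e"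
    using continuous_map_product_ball[OF S f u] by blast
  show "\<forall>\<^sub>F n in sequentially. dist (f (grid_point S n (\<lambda>i\<in>S. \<lfloor>real (Suc n) * u i\<rfloor>))) (f u) < e"
    using grid_point_approx[OF \<delta>(1), of S u]
    by eventually_elim (auto simp: dist_real_def grid_point_def intro!: \<delta>(2))
qed

text \<open>\<open>f\<close> is a pointwise limit of functions that depend on \<open>u\<close> only
  through an integer vector from a countable set, so the Borel sets of the product topology need not
  be compared with the product \<sigma>-algebra.\<close>

lemma continuous_map_borel_measurable_PiM:
  assumes S: "finite S" and f: "continuous_map (product_topology (\<lambda>_. euclideanreal) S) euclideanreal f"
  shows "f \<in> borel_measurable (\<Pi>\<^sub>M i\<in>S. borel)"
proof (rule borel_measurable_LIMSEQ_real)
  show "(\<lambda>n. f (grid_point S n (\<lambda>i\<in>S. \<lfloor>real (Suc n) * u i\<rfloor>))) \<longlonglongrightarrow> f u"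
    if "u \<in> space (\<Pi>\<^sub>M i\<in>S. borel)" for u
    using that by (intro continuous_map_grid_limit[OF S f]) (auto simp: space_PiM PiE_def)
  show "(\<lambda>u. f (grid_point S n (\<lambda>i\<in>S. \<lfloor>real (Suc n) * u i\<rfloor>))) \<in> borel_measurable (\<Pi>\<^sub>M i\<in>S. borel)" for n
  proof -
    have "(\<lambda>u. \<lambda>i\<in>S. \<lfloor>real (Suc n) * u i\<rfloor>) \<in> measurable (\<Pi>\<^sub>M i\<in>S. borel) (\<Pi>\<^sub>M i\<in>S. count_space (UNIV :: int set))"
      by measurable
    moreover have "(\<Pi>\<^sub>M i\<in>S. count_space (UNIV :: int set)) = count_space (\<Pi>\<^sub>E i\<in>S. UNIV)"
      using S by (intro count_space_PiM_finite) auto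
    ultimately have "(\<lambda>u. \<lambda>i\<in>S. \<lfloor>real (Suc n) * u i\<rfloor>) \<in> measurable (\<Pi>\<^sub>M i\<in>S. borel) (count_space (\<Pi>\<^sub>E i\<in>S. UNIV))"
      by simp
    then show ?thesis
      by (rule measurable_compose) simp
  qed
qed

text \<open>The law of the limit gives small mass to these sets as \<open>\<delta>\<close> decreases to \<open>0\<close>. This replaces tightness and
  uniform continuity on compact sets when passing from closeness in probability to weak convergence.\<close>

definition oscillation_set :: "'i set \<Rightarrow> (('i \<Rightarrow> real) \<Rightarrow> real) \<Rightarrow> real \<Rightarrow> real \<Rightarrow> ('i \<Rightarrow> real) set" where
  "oscillation_set S f \<delta> e =
    {w \<in> extensional S. \<exists>u\<in>extensional S. (\<forall>i\<in>S. \<bar>u i - w i\<bar> < \<delta>) \<and> e < \<bar>f u - f w\<bar>}"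

text \<open>The quantifier over all \<open>u\<close> reduces to grid points, and so to a countable
  union: both conditions on \<open>u\<close> are strict inequalities and survive a small
  perturbation of \<open>u\<close>.\<close>

lemma sets_oscillation_set:
  assumes S: "finite S" and f: "continuous_map (product_topology (\<lambda>_. euclideanreal) S) euclideanreal f"
  shows "oscillation_set S f \<delta> e \<in> sets (\<Pi>\<^sub>M i\<in>S. borel)"
proof -
  let ?P = "\<Pi>\<^sub>M i\<in>S. (borel :: real measure)"
  note [measurable] = continuous_map_borel_measurable_PiM[OF S f]
  have sp: "space ?P = extensional S"
    by (auto simp: space_PiM PiE_def)
  define B where "B = (\<lambda>v. {w \<in> space ?P. (\<forall>i\<in>S. \<bar>v i - w i\<bar> < \<delta>) \<and> e < \<bar>f v - f w\<bar>})"
  have B_sets: "B v \<in> sets ?P" for v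
    unfolding B_def using S by measurable
  have "oscillation_set S f \<delta> e = (\<Union>n. \<Union>k\<in>(\<Pi>\<^sub>E i\<in>S. UNIV). B (grid_point S n k))"
  proof (intro equalityI subsetI)
    fix w assume "w \<in> oscillation_set S f \<delta> e"
    then obtain u where w: "w \<in> extensional S" and u: "u \<in> extensional S" "\<And>i. i \<in> S \<Longrightarrow> \<bar>u i - w i\<bar> < \<delta>" "e < \<bar>f u - f w\<bar>"
      by (auto simp: oscillation_set_def)
    define r where "r = Min (insert 1 ((\<lambda>i. \<delta> - \<bar>u i - w i\<bar>) ` S))"
    have r: "0 < r" "\<And>i. i \<in> S \<Longrightarrow> r \<le> \<delta> - \<bar>u i - w i\<bar>"
      using S u(2) by (auto simp: r_def)
    let ?g = "\<lambda>n. grid_point S n (\<lambda>i\<in>S. \<lfloor>real (Suc n) * u i\<rfloor>)"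
    have "(\<lambda>n. \<bar>f (?g n) - f w\<bar>) \<longlonglongrightarrow> \<bar>f u - f w\<bar>"
      by (intro tendsto_intros continuous_map_grid_limit[OF S f u(1)])
    then have "\<forall>\<^sub>F n in sequentially. e < \<bar>f (?g n) - f w\<bar>"
      using u(3) by (rule order_tendstoD)
    then have "\<forall>\<^sub>F n in sequentially. w \<in> B (?g n)"
      using grid_point_approx[OF r(1), of S u]
    proof eventually_elim
      case (elim n)
      have "\<bar>?g n i - w i\<bar> < \<delta>" if "i \<in> S" for i
        using elim(2) r(2)[OF that] that by (auto dest!: bspec[where x = i])
      then show ?case
        using elim w by (auto simp: B_def sp)
    qed
    then obtain n where "w \<in> B (?g n)"
      by (auto dest: eventually_happens)
    then show "w \<in> (\<Union>n. \<Union>k\<in>(\<Pi>\<^sub>E i\<in>S. UNIV). B (grid_point S n k))"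
      by (intro UN_I[of n] UN_I[of "\<lambda>i\<in>S. \<lfloor>real (Suc n) * u i\<rfloor>"]) auto
  next
    fix w assume "w \<in> (\<Union>n. \<Union>k\<in>(\<Pi>\<^sub>E i\<in>S. UNIV). B (grid_point S n k))"
    then obtain n k where k: "w \<in> B (grid_point S n k)"
      by blast
    have "grid_point S n k \<in> extensional S"
      by (simp add: grid_point_def)
    then show "w \<in> oscillation_set S f \<delta> e"
      using k unfolding oscillation_set_def B_def sp by blast
  qed
  moreover have "(\<Union>n. \<Union>k\<in>(\<Pi>\<^sub>E i\<in>S. UNIV). B (grid_point S n k)) \<in> sets ?P"
  proof (rule sets.countable_UN, rule image_subsetI)
    show "(\<Union>k\<in>(\<Pi>\<^sub>E i\<in>S. UNIV). B (grid_point S n k)) \<in> sets ?P" for n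
      using S B_sets by (intro sets.countable_UN' countable_PiE) auto
  qed
  ultimately show ?thesis
    by simp
qed

text \<open>By continuity at \<open>w\<close> each point leaves the oscillation sets when \<delta>
  is small enough, so they decrease to the empty set.\<close>

lemma oscillation_set_small:
  assumes S: "finite S" and f: "continuous_map (product_topology (\<lambda>_. euclideanreal) S) euclideanreal f"
    and \<mu>: "prob_space \<mu>" "sets \<mu> = sets (\<Pi>\<^sub>M i\<in>S. borel)" and "0 < e" "0 < p"
  shows "\<exists>\<delta>>0. measure \<mu> (oscillation_set S f \<delta> e) < p"
proof -
  interpret prob_space \<mu> by (rule \<mu>)
  let ?A = "\<lambda>n. oscillation_set S f (1 / real (Suc n)) e"
  have "range ?A \<subseteq> sets \<mu>"
    using sets_oscillation_set[OF S f] \<mu>(2) by auto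
  moreover have "decseq ?A"
    unfolding decseq_def
  proof (intro allI impI subsetI)
    fix m n w assume "m \<le> n" and w: "w \<in> ?A n"
    have "1 / real (Suc n) \<le> 1 / real (Suc m)"
      using \<open>m \<le> n\<close> by (intro divide_left_mono) auto
    then show "w \<in> ?A m"
      using w unfolding oscillation_set_def by (blast intro: less_le_trans)
  qed
  moreover have "(\<Inter>n. ?A n) = {}"
  proof (rule ccontr)
    assume "(\<Inter>n. ?A n) \<noteq> {}"
    then obtain w where w: "\<And>n. w \<in> ?A n"
      by blast
    then have "w \<in> extensional S"
      by (auto simp: oscillation_set_def)
    then obtain \<delta> where \<delta>: "0 < \<delta>" "\<And>u. u \<in> extensional S \<Longrightarrow> (\<forall>i\<in>S. \<bar>u i - w i\<bar> < \<delta>) \<Longrightarrow> \<bar>f u - f w\<bar> < e"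
      using continuous_map_product_ball[OF S f _ \<open>0 < e\<close>] by blast
    obtain n where n: "1 / real (Suc n) < \<delta>"
      using \<delta>(1) nat_approx_posE by blast
    obtain u where u: "u \<in> extensional S" "\<forall>i\<in>S. \<bar>u i - w i\<bar> < 1 / real (Suc n)" "e < \<bar>f u - f w\<bar>"
      using w[of n] by (auto simp: oscillation_set_def)
    have "\<bar>f u - f w\<bar> < e"
      using u(2) n by (intro \<delta>(2) u(1)) (auto intro: less_trans)
    then show False
      using u(3) by simp
  qed
  ultimately have "(\<lambda>n. measure \<mu> (?A n)) \<longlonglongrightarrow> 0"
    using finite_Lim_measure_decseq[of ?A] by simp
  then have "\<forall>\<^sub>F n in sequentially. measure \<mu> (?A n) < p"
    using \<open>0 < p\<close> by (rule order_tendstoD)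
  then obtain n where "measure \<mu> (?A n) < p"
    by (auto dest: eventually_happens)
  then show ?thesis
    by (intro exI[of _ "1 / real (Suc n)"]) auto
qed

lemma (in prob_space) expectation_diff_le:
  fixes U W :: "'a \<Rightarrow> real"
  assumes [measurable]: "U \<in> borel_measurable M" "W \<in> borel_measurable M"
    and C: "\<And>\<omega>. \<omega> \<in> space M \<Longrightarrow> \<bar>U \<omega>\<bar> \<le> C" "\<And>\<omega>. \<omega> \<in> space M \<Longrightarrow> \<bar>W \<omega>\<bar> \<le> C"
    and A[measurable]: "A \<in> events"
    and e: "0 \<le> e" "\<And>\<omega>. \<omega> \<in> space M \<Longrightarrow> \<omega> \<notin> A \<Longrightarrow> \<bar>U \<omega> - W \<omega>\<bar> \<le> e"
  shows "\<bar>expectation U - expectation W\<bar> \<le> e + 2 * C * prob A"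
proof -
  have int: "integrable M U" "integrable M W"
    using C by (auto intro!: integrable_const_bound[of _ C])
  have "\<bar>expectation U - expectation W\<bar> = \<bar>expectation (\<lambda>\<omega>. U \<omega> - W \<omega>)\<bar>"
    using int by simp
  also have "\<dots> \<le> expectation (\<lambda>\<omega>. \<bar>U \<omega> - W \<omega>\<bar>)"
    by (rule integral_abs_bound)
  also have "\<dots> \<le> expectation (\<lambda>\<omega>. e + 2 * C * indicator A \<omega>)"
  proof (rule integral_mono)
    show "integrable M (\<lambda>\<omega>. e + 2 * C * indicator A \<omega>)"
      by (intro Bochner_Integration.integrable_add integrable_mult_right integrable_real_indicator)
        (auto simp: less_top[symmetric])
    show "\<bar>U \<omega> - W \<omega>\<bar> \<le> e + 2 * C * indicator A \<omega>" if "\<omega> \<in> space M" for \<omega>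
      using C[OF that] e that by (cases "\<omega> \<in> A") auto
  qed (use int in auto)
  also have "\<dots> = e + 2 * C * prob A"
    by (subst Bochner_Integration.integral_add) (auto simp: prob_space less_top[symmetric])
  finally show ?thesis .
qed

section \<open>Product laws and comparison of expectations under couplings\<close>

lemma distr_PiM_same:
  assumes "finite S" "prob_space N" and [measurable]: "E \<in> borel_measurable N"
  shows "distr (\<Pi>\<^sub>M i\<in>S. N) (\<Pi>\<^sub>M i\<in>S. borel) (\<lambda>w. \<lambda>i\<in>S. E (w i)) = (\<Pi>\<^sub>M i\<in>S. distr N borel E)"
proof -
  let ?D = "distr N borel E"
  have D: "prob_space ?D"
    using assms by (intro prob_space.prob_space_distr) auto
  have "distr (\<Pi>\<^sub>M i\<in>S. N) (\<Pi>\<^sub>M i\<in>S. ?D) (compose S E) = (\<Pi>\<^sub>M i\<in>S. distr N ?D E)"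
    using assms D by (intro distr_PiM_finite_prob_space') auto
  moreover have "distr N ?D E = ?D"
    by (intro distr_cong) auto
  moreover have "distr (\<Pi>\<^sub>M i\<in>S. N) (\<Pi>\<^sub>M i\<in>S. ?D) (compose S E)
      = distr (\<Pi>\<^sub>M i\<in>S. N) (\<Pi>\<^sub>M i\<in>S. borel) (\<lambda>w. \<lambda>i\<in>S. E (w i))"
    by (intro distr_cong sets_PiM_cong) (auto simp: compose_def)
  ultimately show ?thesis
    by simp
qed

lemma prob_PiM_coordinate:
  assumes "prob_space N" "i \<in> S" and B: "B \<in> sets N"
  shows "measure (\<Pi>\<^sub>M i\<in>S. N) {w \<in> space (\<Pi>\<^sub>M i\<in>S. N). w i \<in> B} = measure N B"
proof -
  have "measure N B = measure (distr (\<Pi>\<^sub>M i\<in>S. N) N (\<lambda>w. w i)) B"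
    using assms by (subst distr_PiM_component) auto
  also have "\<dots> = measure (\<Pi>\<^sub>M i\<in>S. N) ((\<lambda>w. w i) -` B \<inter> space (\<Pi>\<^sub>M i\<in>S. N))"
    using assms by (intro measure_distr measurable_component_singleton)
  also have "(\<lambda>w. w i) -` B \<inter> space (\<Pi>\<^sub>M i\<in>S. N) = {w \<in> space (\<Pi>\<^sub>M i\<in>S. N). w i \<in> B}"
    by auto
  finally show ?thesis ..
qed

lemma (in prob_space) prob_exists_le:
  fixes p :: real
  assumes "finite S" "\<And>i. i \<in> S \<Longrightarrow> {\<omega> \<in> space M. P i \<omega>} \<in> events"
    "\<And>i. i \<in> S \<Longrightarrow> prob {\<omega> \<in> space M. P i \<omega>} \<le> p"
  shows "{\<omega> \<in> space M. \<exists>i\<in>S. P i \<omega>} \<in> events" "prob {\<omega> \<in> space M. \<exists>i\<in>S. P i \<omega>} \<le> card S * p"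
proof -
  have eq: "{\<omega> \<in> space M. \<exists>i\<in>S. P i \<omega>} = (\<Union>i\<in>S. {\<omega> \<in> space M. P i \<omega>})"
    by auto
  show "{\<omega> \<in> space M. \<exists>i\<in>S. P i \<omega>} \<in> events"
    unfolding eq using assms by auto
  have "prob (\<Union>i\<in>S. {\<omega> \<in> space M. P i \<omega>}) \<le> (\<Sum>i\<in>S. prob {\<omega> \<in> space M. P i \<omega>})"
    using assms by (intro finite_measure_subadditive_finite) auto
  also have "\<dots> \<le> card S * p"
    by (rule sum_bounded_above) (rule assms)
  finally show "prob {\<omega> \<in> space M. \<exists>i\<in>S. P i \<omega>} \<le> card S * p"
    unfolding eq .
qed

text \<open>\<open>X\<close> is compared with \<open>Z\<close> on \<open>M\<close>, and
  \<open>E\<close> with \<open>H\<close> on \<open>N\<close>; the only link between the two spaces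
  is the common law of \<open>Z\<close> and \<open>E\<close>. Continuity of \<open>f\<close> is
  controlled where the limit law is known, namely at \<open>H\<close>, and carried over to
  \<open>E\<close> and then to \<open>Z\<close> at the cost of halving the radius and doubling the
  error. The bound adds up errors \<open>e\<close> and \<open>2 * e\<close> and, with weight
  \<open>2 * C\<close>, exceptional events of probability at most 2 and 3 times
  \<open>card S * p\<close>.\<close>

lemma indep_coupling_expectation:
  fixes f :: "('i \<Rightarrow> real) \<Rightarrow> real" and X Z :: "'i \<Rightarrow> 'a \<Rightarrow> real" and E H :: "'b \<Rightarrow> real" and p :: real
  assumes S: "finite S" "S \<noteq> {}"
    and f: "continuous_map (product_topology (\<lambda>_. euclideanreal) S) euclideanreal f"
    and C: "\<And>u. u \<in> extensional S \<Longrightarrow> \<bar>f u\<bar> \<le> C"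
    and M: "prob_space M" and N: "prob_space N"
    and X: "\<And>i. i \<in> S \<Longrightarrow> X i \<in> borel_measurable M"
    and Z: "prob_space.indep_vars M (\<lambda>_. borel) Z S"
      "\<And>i. i \<in> S \<Longrightarrow> distr M borel (Z i) = distr N borel E"
    and EH[measurable]: "E \<in> borel_measurable N" "H \<in> borel_measurable N"
    and XZ: "\<And>i. i \<in> S \<Longrightarrow> measure M {\<omega> \<in> space M. \<delta> \<le> \<bar>X i \<omega> - Z i \<omega>\<bar>} \<le> p"
    and EH_p: "measure N {\<omega> \<in> space N. \<delta> \<le> \<bar>E \<omega> - H \<omega>\<bar>} \<le> p"
    and osc: "measure (\<Pi>\<^sub>M i\<in>S. distr N borel H) (oscillation_set S f (2 * \<delta>) e) \<le> p"
    and "0 < e" "0 < \<delta>" "0 \<le> p"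
  shows "\<bar>(\<integral>\<omega>. f (\<lambda>i\<in>S. X i \<omega>) \<partial>M) - (\<integral>u. f u \<partial>(\<Pi>\<^sub>M i\<in>S. distr N borel H))\<bar>
    \<le> 3 * e + 10 * C * (card S * p)"
proof -
  interpret M: prob_space M by (rule M)
  interpret N: prob_space N by (rule N)
  let ?NS = "\<Pi>\<^sub>M i\<in>S. N" and ?P = "\<Pi>\<^sub>M i\<in>S. (borel :: real measure)"
  interpret NS: prob_space ?NS
    by (intro prob_space_PiM N)
  note [measurable] = X continuous_map_borel_measurable_PiM[OF S(1) f] sets_oscillation_set[OF S(1) f]
  have Z_meas[measurable]: "Z i \<in> borel_measurable M" if "i \<in> S" for i
    using Z(1) that by (auto simp: M.indep_vars_def)
  have C0: "0 \<le> C"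
    using C[of "\<lambda>i\<in>S. 0"] by fastforce
  have card1: "1 \<le> real (card S)"
    using S by (simp add: Suc_le_eq card_gt_0_iff)
  have comp_meas[measurable]: "(\<lambda>w. w i) \<in> measurable ?NS N" if "i \<in> S" for i
    using that by (rule measurable_component_singleton)
  define Xv where "Xv = (\<lambda>\<omega>. \<lambda>i\<in>S. X i \<omega>)"
  define Zv where "Zv = (\<lambda>\<omega>. \<lambda>i\<in>S. Z i \<omega>)"
  \<comment> \<open>\<open>Ev\<close> and \<open>Hv\<close> are evaluated at the same point of the
    product space, so each coordinate carries a copy of the coupled pair \<open>E\<close>,
    \<open>H\<close>.\<close>
  define Ev where "Ev = (\<lambda>w. \<lambda>i\<in>S. E (w i))"
  define Hv where "Hv = (\<lambda>w. \<lambda>i\<in>S. H (w i))"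
  have [measurable]: "Xv \<in> measurable M ?P" "Zv \<in> measurable M ?P"
    unfolding Xv_def Zv_def by measurable
  have [measurable]: "Ev \<in> measurable ?NS ?P" "Hv \<in> measurable ?NS ?P"
    unfolding Ev_def Hv_def by measurable
  have ext: "Xv \<omega> \<in> extensional S" "Zv \<omega> \<in> extensional S" "Ev w \<in> extensional S" "Hv w \<in> extensional S" for \<omega> w
    by (auto simp: Xv_def Zv_def Ev_def Hv_def)
  have Hv_law: "distr ?NS ?P Hv = (\<Pi>\<^sub>M i\<in>S. distr N borel H)"
    unfolding Hv_def by (rule distr_PiM_same[OF S(1) N]) measurable
  have Zv_law: "distr M ?P Zv = distr ?NS ?P Ev"
  proof -
    have "distr M ?P Zv = (\<Pi>\<^sub>M i\<in>S. distr M borel (Z i))"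
      using Z(1) unfolding Zv_def by (subst (asm) M.indep_vars_iff_distr_eq_PiM'[OF S(2) Z_meas]) auto
    also have "\<dots> = (\<Pi>\<^sub>M i\<in>S. distr N borel E)"
      using Z(2) by (intro PiM_cong) auto
    also have "\<dots> = distr ?NS ?P Ev"
      unfolding Ev_def by (rule distr_PiM_same[OF S(1) N, symmetric]) measurable
    finally show ?thesis .
  qed
  define BX where "BX = {\<omega> \<in> space M. \<exists>i\<in>S. \<delta> \<le> \<bar>X i \<omega> - Z i \<omega>\<bar>}"
  have BX: "BX \<in> sets M" "measure M BX \<le> card S * p"
    unfolding BX_def using S(1) XZ by (auto intro!: M.prob_exists_le)
  define BE where "BE = {w \<in> space ?NS. \<exists>i\<in>S. \<delta> \<le> \<bar>E (w i) - H (w i)\<bar>}"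
  have BE: "BE \<in> sets ?NS" "measure ?NS BE \<le> card S * p"
  proof -
    have "measure ?NS {w \<in> space ?NS. \<delta> \<le> \<bar>E (w i) - H (w i)\<bar>} \<le> p" if "i \<in> S" for i
    proof -
      have "{w \<in> space ?NS. \<delta> \<le> \<bar>E (w i) - H (w i)\<bar>}
          = {w \<in> space ?NS. w i \<in> {\<omega> \<in> space N. \<delta> \<le> \<bar>E \<omega> - H \<omega>\<bar>}}"
        using that by (auto simp: space_PiM PiE_def)
      moreover have "{\<omega> \<in> space N. \<delta> \<le> \<bar>E \<omega> - H \<omega>\<bar>} \<in> sets N"
        by measurable
      ultimately show ?thesis
        using EH_p by (simp only: prob_PiM_coordinate[OF N that])
    qed
    then show "BE \<in> sets ?NS" "measure ?NS BE \<le> card S * p"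
      unfolding BE_def using S(1) by (auto intro!: NS.prob_exists_le)
  qed
  have BH: "Hv -` oscillation_set S f (2 * \<delta>) e \<inter> space ?NS \<in> sets ?NS"
    "measure ?NS (Hv -` oscillation_set S f (2 * \<delta>) e \<inter> space ?NS) \<le> card S * p"
  proof -
    have "measure ?NS (Hv -` oscillation_set S f (2 * \<delta>) e \<inter> space ?NS)
        = measure (distr ?NS ?P Hv) (oscillation_set S f (2 * \<delta>) e)"
      by (rule measure_distr[symmetric]) measurable
    also have "\<dots> \<le> 1 * p"
      using osc by (simp add: Hv_law)
    also have "\<dots> \<le> card S * p"
      using card1 \<open>0 \<le> p\<close> by (intro mult_right_mono)
    finally show "measure ?NS (Hv -` oscillation_set S f (2 * \<delta>) e \<inter> space ?NS) \<le> card S * p" .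
  qed measurable
  \<comment> \<open>The cube of radius \<delta> around \<open>Ev w\<close> lies in the cube of
    radius \<open>2 * \<delta>\<close> around \<open>Hv w\<close>, on which \<open>f\<close> differs
    from \<open>f (Hv w)\<close> by at most \<open>e\<close>.\<close>
  have EH_close: "\<bar>f (Ev w) - f (Hv w)\<bar> \<le> e \<and> Ev w \<notin> oscillation_set S f \<delta> (2 * e)"
    if w: "w \<in> space ?NS" "w \<notin> BE" "w \<notin> Hv -` oscillation_set S f (2 * \<delta>) e" for w
  proof -
    have near: "\<bar>Ev w i - Hv w i\<bar> < \<delta>" if "i \<in> S" for i
      using w that by (auto simp: BE_def Ev_def Hv_def not_le)
    have Hw: "\<bar>f u - f (Hv w)\<bar> \<le> e" if "u \<in> extensional S" "\<And>i. i \<in> S \<Longrightarrow> \<bar>u i - Hv w i\<bar> < 2 * \<delta>" for u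
    proof (rule ccontr)
      assume "\<not> ?thesis"
      then have "Hv w \<in> oscillation_set S f (2 * \<delta>) e"
        unfolding oscillation_set_def using that ext(4)[of w] by (auto simp: not_le intro!: bexI[of _ u])
      then show False
        using w(3) by simp
    qed
    have EHw: "\<bar>f (Ev w) - f (Hv w)\<bar> \<le> e"
      using near \<open>0 < \<delta>\<close> by (intro Hw ext) force
    have "\<bar>f u - f (Ev w)\<bar> \<le> 2 * e" if u: "u \<in> extensional S" "\<And>i. i \<in> S \<Longrightarrow> \<bar>u i - Ev w i\<bar> < \<delta>" for u
    proof -
      have "\<bar>u i - Hv w i\<bar> < 2 * \<delta>" if "i \<in> S" for i
        using u(2)[OF that] near[OF that] by linarith
      then have "\<bar>f u - f (Hv w)\<bar> \<le> e"
        by (intro Hw u)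
      then show ?thesis
        using EHw by linarith
    qed
    note Eu = this
    have "Ev w \<notin> oscillation_set S f \<delta> (2 * e)"
    proof
      assume "Ev w \<in> oscillation_set S f \<delta> (2 * e)"
      then obtain u where "u \<in> extensional S" "\<forall>i\<in>S. \<bar>u i - Ev w i\<bar> < \<delta>" "2 * e < \<bar>f u - f (Ev w)\<bar>"
        unfolding oscillation_set_def by blast
      then show False
        using Eu[of u] by simp
    qed
    then show ?thesis
      using EHw by blast
  qed
  define BN where "BN = BE \<union> (Hv -` oscillation_set S f (2 * \<delta>) e \<inter> space ?NS)"
  have BN: "BN \<in> sets ?NS" "measure ?NS BN \<le> 2 * (card S * p)"
    unfolding BN_def using BE BH measure_Un_le[OF BE(1) BH(1)] by auto
  have fC: "\<bar>f (Xv \<omega>)\<bar> \<le> C" "\<bar>f (Zv \<omega>)\<bar> \<le> C" "\<bar>f (Ev w)\<bar> \<le> C" "\<bar>f (Hv w)\<bar> \<le> C" for \<omega> w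
    using C ext by auto
  have 1: "\<bar>(\<integral>w. f (Ev w) \<partial>?NS) - (\<integral>w. f (Hv w) \<partial>?NS)\<bar> \<le> e + 2 * C * measure ?NS BN"
    using EH_close fC BN \<open>0 < e\<close> by (intro NS.expectation_diff_le) (auto simp: BN_def)
  define BZ where "BZ = Zv -` oscillation_set S f \<delta> (2 * e) \<inter> space M"
  have BZ: "BZ \<in> sets M"
    unfolding BZ_def by measurable
  \<comment> \<open>Membership in an oscillation set depends on the point alone, so the bound for
    \<open>Ev\<close> passes to \<open>Zv\<close> through equality in law.\<close>
  have "measure M BZ = measure (distr M ?P Zv) (oscillation_set S f \<delta> (2 * e))"
    unfolding BZ_def by (rule measure_distr[symmetric]) measurable
  also have "\<dots> = measure ?NS (Ev -` oscillation_set S f \<delta> (2 * e) \<inter> space ?NS)"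
    unfolding Zv_law by (rule measure_distr) measurable
  also have "\<dots> \<le> measure ?NS BN"
    using EH_close BN by (intro NS.finite_measure_mono) (auto simp: BN_def)
  finally have BZ_le: "measure M BZ \<le> 2 * (card S * p)"
    using BN by simp
  have 2: "\<bar>(\<integral>\<omega>. f (Xv \<omega>) \<partial>M) - (\<integral>\<omega>. f (Zv \<omega>) \<partial>M)\<bar> \<le> 2 * e + 2 * C * measure M (BX \<union> BZ)"
  proof (rule M.expectation_diff_le)
    fix \<omega> assume \<omega>: "\<omega> \<in> space M" "\<omega> \<notin> BX \<union> BZ"
    then have "\<forall>i\<in>S. \<bar>Xv \<omega> i - Zv \<omega> i\<bar> < \<delta>"
      by (auto simp: BX_def Xv_def Zv_def not_le)
    then show "\<bar>f (Xv \<omega>) - f (Zv \<omega>)\<bar> \<le> 2 * e"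
      using \<omega> ext(1,2)[of \<omega>]
      by (auto simp: BZ_def oscillation_set_def not_less dest!: bspec[where x = "Xv \<omega>"])
  qed (use fC BX BZ \<open>0 < e\<close> in auto)
  have 3: "(\<integral>\<omega>. f (Zv \<omega>) \<partial>M) = (\<integral>w. f (Ev w) \<partial>?NS)"
  proof -
    have "(\<integral>\<omega>. f (Zv \<omega>) \<partial>M) = (\<integral>u. f u \<partial>distr M ?P Zv)"
      by (rule integral_distr[symmetric]) measurable
    also have "\<dots> = (\<integral>w. f (Ev w) \<partial>?NS)"
      unfolding Zv_law by (rule integral_distr) measurable
    finally show ?thesis .
  qed
  have 4: "(\<integral>w. f (Hv w) \<partial>?NS) = (\<integral>u. f u \<partial>(\<Pi>\<^sub>M i\<in>S. distr N borel H))"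
    unfolding Hv_law[symmetric] by (rule integral_distr[symmetric]) measurable
  have "measure M (BX \<union> BZ) \<le> 3 * (card S * p)"
    using measure_Un_le[OF BX(1) BZ] BX BZ_le by simp
  then have "2 * C * measure M (BX \<union> BZ) \<le> 2 * C * (3 * (card S * p))"
    using C0 by (intro mult_left_mono) auto
  moreover have "2 * C * measure ?NS BN \<le> 2 * C * (2 * (card S * p))"
    using C0 BN by (intro mult_left_mono) auto
  ultimately show ?thesis
    using 1 2 unfolding 3 4 by (simp add: Xv_def algebra_simps)
qed

section \<open>Homogeneous drifts\<close>

context
  fixes F :: "real \<Rightarrow> real" and \<gamma> :: real
  assumes \<gamma>: "1 \<le> \<gamma>"
    and hom: "\<And>v c. 0 < c \<Longrightarrow> F (c * v) = c powr \<gamma> * F v"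
    and sign: "\<And>v. 0 \<le> v * F v"
begin

lemma homogeneous_zero: "F 0 = 0"
proof -
  have "F 0 = 2 powr \<gamma> * F 0"
    using hom[of 2 0] by simp
  moreover have "(2::real) powr \<gamma> \<noteq> 1"
    using \<gamma> powr_less_mono[of 0 \<gamma> 2] by simp
  ultimately show ?thesis
    by simp
qed

lemma homogeneous_at_one: "0 \<le> F 1" "F (- 1) \<le> 0"
  using sign[of 1] sign[of "- 1"] by auto

lemma homogeneous_eq: "F v = (if 0 \<le> v then F 1 * v powr \<gamma> else F (- 1) * (- v) powr \<gamma>)"
proof (cases "v = 0")
  case True
  then show ?thesis
    using homogeneous_zero by simp
next
  case False
  then show ?thesis
    using hom[of v 1] hom[of "- v" "- 1"] by auto
qed

lemma homogeneous_growth: "\<bar>F v\<bar> \<le> (F 1 - F (- 1)) * \<bar>v\<bar> powr \<gamma>"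
proof (cases "0 \<le> v")
  case True
  have "F 1 * v powr \<gamma> \<le> (F 1 - F (- 1)) * v powr \<gamma>"
    using homogeneous_at_one by (intro mult_right_mono) auto
  then show ?thesis
    using True homogeneous_eq[of v] homogeneous_at_one by simp
next
  case False
  have "- F (- 1) * (- v) powr \<gamma> \<le> (F 1 - F (- 1)) * (- v) powr \<gamma>"
    using homogeneous_at_one by (intro mult_right_mono) auto
  moreover have "\<bar>F (- 1) * (- v) powr \<gamma>\<bar> = - F (- 1) * (- v) powr \<gamma>"
    using homogeneous_at_one by (simp add: abs_mult)
  ultimately show ?thesis
    using False homogeneous_eq[of v] by simp
qed

text \<open>Write \<open>z powr \<gamma>\<close> as \<open>z * z powr (\<gamma> - 1)\<close> and
  enlarge the second factor, which is nondecreasing in \<open>z\<close> as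
  \<open>1 \<le> \<gamma>\<close>.\<close>

lemma powr_superadditive:
  fixes x y :: real
  assumes "0 \<le> x" "0 \<le> y"
  shows "x powr \<gamma> + y powr \<gamma> \<le> (x + y) powr \<gamma>"
proof (cases "x = 0 \<or> y = 0")
  case False
  then have xy: "0 < x" "0 < y"
    using assms by auto
  have *: "z powr \<gamma> = z * z powr (\<gamma> - 1)" if "0 < z" for z :: real
    using that powr_add[of z 1 "\<gamma> - 1"] by simp
  have "x * x powr (\<gamma> - 1) + y * y powr (\<gamma> - 1) \<le> x * (x + y) powr (\<gamma> - 1) + y * (x + y) powr (\<gamma> - 1)"
    using xy \<gamma> by (intro add_mono mult_left_mono powr_mono2) auto
  also have "\<dots> = (x + y) powr \<gamma>"
    using xy by (subst *) (auto simp: distrib_right)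
  finally show ?thesis
    using xy by (simp add: *)
qed auto

text \<open>On one side of 0 this is superadditivity of the power. If \<open>v < 0 < u\<close>, the
  larger of \<open>u\<close> and \<open>- v\<close> is at least half of \<open>u - v\<close>, which
  is where the factor \<open>2 powr (- \<gamma>)\<close> comes from.\<close>

lemma homogeneous_increment:
  assumes "v \<le> u"
  shows "min (F 1) (- F (- 1)) * 2 powr (- \<gamma>) * (u - v) powr \<gamma> \<le> F u - F v"
proof -
  define m where "m = min (F 1) (- F (- 1))"
  have m: "0 \<le> m" "m \<le> F 1" "m \<le> - F (- 1)"
    using homogeneous_at_one by (auto simp: m_def)
  have half: "2 powr (- \<gamma>) \<le> (1::real)"
    using \<gamma> powr_mono[of "- \<gamma>" 0 2] by simp
  have le: "m * 2 powr (- \<gamma>) * (u - v) powr \<gamma> \<le> C * (x powr \<gamma> - y powr \<gamma>)"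
    if "0 \<le> y" "y \<le> x" "x - y = u - v" "m \<le> C" for x y C
  proof -
    have "m * 2 powr (- \<gamma>) * (u - v) powr \<gamma> \<le> m * 1 * (u - v) powr \<gamma>"
      using m half by (intro mult_right_mono mult_left_mono) auto
    also have "\<dots> \<le> C * (u - v) powr \<gamma>"
      using that by (auto intro!: mult_right_mono)
    also have "\<dots> \<le> C * (x powr \<gamma> - y powr \<gamma>)"
    proof (rule mult_left_mono)
      have "u - v + y = x"
        using that by simp
      then show "(u - v) powr \<gamma> \<le> x powr \<gamma> - y powr \<gamma>"
        using powr_superadditive[of "u - v" y] \<open>0 \<le> y\<close> assms by (metis add_le_imp_le_diff diff_ge_0_iff_ge)
    qed (use that m in simp)
    finally show ?thesis .
  qed
  consider "0 \<le> v" | "v < 0" "0 < u" | "v < 0" "u \<le> 0"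
    by linarith
  then show ?thesis
  proof cases
    case 1
    then show ?thesis
      using le[of v u "F 1"] m assms homogeneous_eq[of u] homogeneous_eq[of v]
      by (simp add: m_def[symmetric] right_diff_distrib)
  next
    case 2
    have "m * 2 powr (- \<gamma>) * (u - v) powr \<gamma> = m * ((u - v) / 2) powr \<gamma>"
    proof -
      have "((u - v) / 2) powr \<gamma> = (u - v) powr \<gamma> / 2 powr \<gamma>"
        by (rule powr_divide)
      then show ?thesis
        by (simp add: powr_minus_divide)
    qed
    also have "\<dots> \<le> m * (max u (- v)) powr \<gamma>"
      using 2 m \<gamma> by (intro mult_left_mono powr_mono2) auto
    also have "\<dots> \<le> m * u powr \<gamma> + m * (- v) powr \<gamma>"
      using m by (auto simp: max_def)
    also have "\<dots> \<le> F 1 * u powr \<gamma> + (- F (- 1)) * (- v) powr \<gamma>"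
      using m by (intro add_mono mult_right_mono) auto
    also have "\<dots> = F u - F v"
      using 2 homogeneous_eq[of u] homogeneous_eq[of v] by simp
    finally show ?thesis
      by (simp add: m_def)
  next
    case 3
    have "F u = F (- 1) * (- u) powr \<gamma>"
      using 3 homogeneous_eq[of u] homogeneous_zero by (cases "u = 0") auto
    then show ?thesis
      using le[of "- u" "- v" "- F (- 1)"] m assms 3 homogeneous_eq[of v]
      by (simp add: m_def[symmetric] algebra_simps)
  qed
qed

lemma homogeneous_mono: "mono F"
proof (rule monoI)
  fix v u :: real assume "v \<le> u"
  moreover have "0 \<le> min (F 1) (- F (- 1)) * 2 powr (- \<gamma>) * (u - v) powr \<gamma>"
    using homogeneous_at_one by (intro mult_nonneg_nonneg) auto
  ultimately show "F v \<le> F u"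
    using homogeneous_increment[of v u] by linarith
qed

text \<open>For \<open>u - v\<close> at least \<eta> the power is bounded below by the linear
  function of slope \<open>\<eta> powr (\<gamma> - 1)\<close>; below \<eta> the left side is not
  positive. This linearisation is the source of the rate \<open>k\<close> and of the slack in the
  Euler estimates.\<close>

lemma homogeneous_dissipative:
  assumes "v \<le> u" "0 < \<eta>"
  shows "min (F 1) (- F (- 1)) * 2 powr (- \<gamma>) * \<eta> powr (\<gamma> - 1) * (u - v - \<eta>) \<le> F u - F v"
proof -
  define m where "m = min (F 1) (- F (- 1)) * 2 powr (- \<gamma>)"
  have m: "0 \<le> m"
    using homogeneous_at_one by (simp add: m_def)
  show ?thesis
  proof (cases "\<eta> \<le> u - v")
    case True
    then have uv: "0 < u - v"
      using assms by simp
    have "m * (\<eta> powr (\<gamma> - 1) * (u - v - \<eta>)) \<le> m * ((u - v) powr (\<gamma> - 1) * (u - v))"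
      using True assms m \<gamma> by (intro mult_left_mono mult_mono powr_mono2) auto
    also have "(u - v) powr (\<gamma> - 1) * (u - v) = (u - v) powr \<gamma>"
      using uv powr_add[of "u - v" "\<gamma> - 1" 1] by simp
    also have "m * (u - v) powr \<gamma> \<le> F u - F v"
      using homogeneous_increment[OF assms(1)] by (simp add: m_def)
    finally show ?thesis
      by (simp add: m_def mult.assoc)
  next
    case False
    then have "m * \<eta> powr (\<gamma> - 1) * (u - v - \<eta>) \<le> 0"
      using m by (intro mult_nonneg_nonpos) auto
    moreover have "F v \<le> F u"
      using assms(1) by (rule monoD[OF homogeneous_mono])
    ultimately show ?thesis
      by (simp add: m_def)
  qed
qed

end

text \<open>Neither variable need be integrable, so their expectations cannot be subtracted.
  Truncation at level \<open>n\<close> is nondecreasing and 1-Lipschitz: the truncated differences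
  have mean zero, are dominated by \<open>\<bar>X \<omega> - Y \<omega>\<bar>\<close> and stay above
  \<open>- \<bar>\<xi> \<omega>\<bar>\<close>. Fatou's lemma gives integrability of the difference,
  and dominated convergence then its mean.\<close>

lemma (in prob_space) equidistributed_difference_mean_zero:
  fixes X Y \<xi> :: "'a \<Rightarrow> real"
  assumes [measurable]: "X \<in> borel_measurable M" "Y \<in> borel_measurable M"
    and law: "distr M borel X = distr M borel Y"
    and \<xi>: "integrable M \<xi>" and le: "AE \<omega> in M. \<xi> \<omega> \<le> X \<omega> - Y \<omega>"
  shows "integrable M (\<lambda>\<omega>. X \<omega> - Y \<omega>)" "expectation (\<lambda>\<omega>. X \<omega> - Y \<omega>) = 0"
proof -
  define T where "T = (\<lambda>n z. max (- real n) (min (real n) z))"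
  define W where "W = (\<lambda>n \<omega>. T n (X \<omega>) - T n (Y \<omega>))"
  have [measurable]: "T n \<in> borel_measurable borel" for n
    unfolding T_def by measurable
  have [measurable]: "\<xi> \<in> borel_measurable M"
    using \<xi> by (rule borel_measurable_integrable)
  have T_bd: "\<bar>T n z\<bar> \<le> real n" for n z
    by (auto simp: T_def)
  have W_mean: "expectation (W n) = 0" "integrable M (W n)" for n
  proof -
    have int: "integrable M (\<lambda>\<omega>. T n (Z \<omega>))" if [measurable]: "Z \<in> borel_measurable M" for Z
      using T_bd by (intro integrable_const_bound[of _ "real n"]) auto
    have "expectation (\<lambda>\<omega>. T n (X \<omega>)) = (\<integral>x. T n x \<partial>distr M borel X)"
      by (simp add: integral_distr)
    also have "\<dots> = expectation (\<lambda>\<omega>. T n (Y \<omega>))"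
      unfolding law by (simp add: integral_distr)
    finally show "expectation (W n) = 0" "integrable M (W n)"
      unfolding W_def using int by auto
  qed
  have W_lim: "(\<lambda>n. W n \<omega>) \<longlonglongrightarrow> X \<omega> - Y \<omega>" for \<omega>
  proof (rule tendsto_eventually)
    obtain n0 where "max \<bar>X \<omega>\<bar> \<bar>Y \<omega>\<bar> \<le> real n0"
      using real_arch_simple by blast
    then have "W n \<omega> = X \<omega> - Y \<omega>" if "n0 \<le> n" for n
      using that by (auto simp: W_def T_def)
    then show "\<forall>\<^sub>F n in sequentially. W n \<omega> = X \<omega> - Y \<omega>"
      unfolding eventually_sequentially by blast
  qed
  have W_abs: "\<bar>W n \<omega>\<bar> \<le> \<bar>X \<omega> - Y \<omega>\<bar>" for n \<omega>
    by (auto simp: W_def T_def)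
  have W_lower: "- \<bar>x - y\<bar> \<le> T n x - T n y" "y \<le> x \<Longrightarrow> 0 \<le> T n x - T n y" for n x y
    by (auto simp: T_def)
  have W_ge: "AE \<omega> in M. \<forall>n. 0 \<le> W n \<omega> + \<bar>\<xi> \<omega>\<bar>"
    using le
  proof (eventually_elim, intro allI)
    fix \<omega> n assume *: "\<xi> \<omega> \<le> X \<omega> - Y \<omega>"
    show "0 \<le> W n \<omega> + \<bar>\<xi> \<omega>\<bar>"
      using W_lower(1)[of "X \<omega>" "Y \<omega>" n] W_lower(2)[of "Y \<omega>" "X \<omega>" n] * unfolding W_def
      by (cases "Y \<omega> \<le> X \<omega>") auto
  qed
  have "(\<integral>\<^sup>+\<omega>. ennreal (X \<omega> - Y \<omega> + \<bar>\<xi> \<omega>\<bar>) \<partial>M) = (\<integral>\<^sup>+\<omega>. liminf (\<lambda>n. ennreal (W n \<omega> + \<bar>\<xi> \<omega>\<bar>)) \<partial>M)"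
  proof (rule nn_integral_cong)
    fix \<omega>
    have "(\<lambda>n. ennreal (W n \<omega> + \<bar>\<xi> \<omega>\<bar>)) \<longlonglongrightarrow> ennreal (X \<omega> - Y \<omega> + \<bar>\<xi> \<omega>\<bar>)"
      by (intro tendsto_intros W_lim)
    then show "ennreal (X \<omega> - Y \<omega> + \<bar>\<xi> \<omega>\<bar>) = liminf (\<lambda>n. ennreal (W n \<omega> + \<bar>\<xi> \<omega>\<bar>))"
      by (intro lim_imp_Liminf[symmetric]) auto
  qed
  also have "\<dots> \<le> liminf (\<lambda>n. \<integral>\<^sup>+\<omega>. ennreal (W n \<omega> + \<bar>\<xi> \<omega>\<bar>) \<partial>M)"
    by (rule nn_integral_liminf) (simp add: W_def)
  also have "(\<lambda>n. \<integral>\<^sup>+\<omega>. ennreal (W n \<omega> + \<bar>\<xi> \<omega>\<bar>) \<partial>M) = (\<lambda>n. ennreal (expectation (\<lambda>\<omega>. \<bar>\<xi> \<omega>\<bar>)))"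
  proof
    fix n
    have "(\<integral>\<^sup>+\<omega>. ennreal (W n \<omega> + \<bar>\<xi> \<omega>\<bar>) \<partial>M) = ennreal (expectation (\<lambda>\<omega>. W n \<omega> + \<bar>\<xi> \<omega>\<bar>))"
      using W_mean[of n] \<xi> W_ge by (intro nn_integral_eq_integral) (auto elim: eventually_mono)
    also have "expectation (\<lambda>\<omega>. W n \<omega> + \<bar>\<xi> \<omega>\<bar>) = expectation (\<lambda>\<omega>. \<bar>\<xi> \<omega>\<bar>)"
      using W_mean[of n] \<xi> by simp
    finally show "(\<integral>\<^sup>+\<omega>. ennreal (W n \<omega> + \<bar>\<xi> \<omega>\<bar>) \<partial>M) = ennreal (expectation (\<lambda>\<omega>. \<bar>\<xi> \<omega>\<bar>))" .
  qed
  finally have fin: "(\<integral>\<^sup>+\<omega>. ennreal (X \<omega> - Y \<omega> + \<bar>\<xi> \<omega>\<bar>) \<partial>M) < \<infinity>"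
    by (simp add: Liminf_const) (metis ennreal_less_top le_less_trans)
  have "AE \<omega> in M. 0 \<le> X \<omega> - Y \<omega> + \<bar>\<xi> \<omega>\<bar>"
    using le by eventually_elim linarith
  then have "integrable M (\<lambda>\<omega>. X \<omega> - Y \<omega> + \<bar>\<xi> \<omega>\<bar>)"
    using fin by (intro integrableI_nonneg) auto
  then have "integrable M (\<lambda>\<omega>. (X \<omega> - Y \<omega> + \<bar>\<xi> \<omega>\<bar>) - \<bar>\<xi> \<omega>\<bar>)"
    using \<xi> by (intro Bochner_Integration.integrable_diff) auto
  then show int: "integrable M (\<lambda>\<omega>. X \<omega> - Y \<omega>)"
    by simp
  have "(\<lambda>n. expectation (W n)) \<longlonglongrightarrow> expectation (\<lambda>\<omega>. X \<omega> - Y \<omega>)"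
    using W_lim W_abs int
    by (intro integral_dominated_convergence[where w = "\<lambda>\<omega>. \<bar>X \<omega> - Y \<omega>\<bar>"]) (auto simp: W_def)
  then show "expectation (\<lambda>\<omega>. X \<omega> - Y \<omega>) = 0"
    using W_mean by (simp add: LIMSEQ_const_iff)
qed

section \<open>Stationary solutions and nondegeneracy of the drift\<close>

lemma stationary_process_marginal:
  assumes H: "\<And>t. 0 \<le> t \<Longrightarrow> H t \<in> borel_measurable M" and st: "stationary_process M H" and "0 \<le> s"
  shows "distr M borel (H s) = distr M borel (H 0)"
proof -
  have path[measurable]: "path H \<in> measurable M path_space"
    unfolding path_def using H by (intro measurable_restrict) auto
  have coord[measurable]: "(\<lambda>x. x t) \<in> borel_measurable path_space" if "0 \<le> t" for t
    using that by (intro measurable_component_singleton) auto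
  have shift[measurable]: "shift s \<in> measurable path_space path_space"
    unfolding shift_def using \<open>0 \<le> s\<close> by (intro measurable_restrict coord) auto
  have marg: "distr (path_law M H) borel (\<lambda>x. x t) = distr M borel (H t)" if "0 \<le> t" for t
    unfolding path_law_def using that by (subst distr_distr) (auto simp: comp_def path_def)
  have "distr M borel (H s) = distr (path_law M H) borel (\<lambda>x. x s)"
    using \<open>0 \<le> s\<close> by (rule marg[symmetric])
  also have "\<dots> = distr (distr (path_law M H) path_space (shift s)) borel (\<lambda>x. x 0)"
    by (subst distr_distr) (auto simp: comp_def shift_def path_law_def)
  also have "\<dots> = distr (path_law M H) borel (\<lambda>x. x 0)"
    using st \<open>0 \<le> s\<close> by (simp add: stationary_process_def)
  also have "\<dots> = distr M borel (H 0)"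
    by (rule marg) simp
  finally show ?thesis .
qed

text \<open>The coefficient \<open>c\<close> covers both equations:
  \<open>t powr (- \<beta>)\<close> for the velocity and the constant 1 for the stationary process,
  hence the factors \<open>1 *\<close> in the uses of the latter.\<close>

lemma additive_sde_solution_integral_equation:
  assumes "additive_sde_solution M t0 (\<lambda>t v. - (c t * F v)) L V"
  shows "AE \<omega> in M. \<forall>t\<ge>t0. set_integrable lborel {t0..t} (\<lambda>s. c s * F (V s \<omega>))
    \<and> V t \<omega> = V t0 \<omega> + (L t \<omega> - L t0 \<omega>) - (LINT s:{t0..t}|lborel. c s * F (V s \<omega>))"
proof -
  have "set_integrable lborel {t0..t} (\<lambda>s. - (c s * F (V s \<omega>))) \<longleftrightarrow> set_integrable lborel {t0..t} (\<lambda>s. c s * F (V s \<omega>))" for t \<omega>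
    unfolding set_integrable_def by simp
  moreover have "(LINT s:{t0..t}|lborel. - (c s * F (V s \<omega>))) = - (LINT s:{t0..t}|lborel. c s * F (V s \<omega>))" for t \<omega>
    unfolding set_lebesgue_integral_def by simp
  ultimately show ?thesis
    using assms unfolding additive_sde_solution_def by simp
qed

lemma ergodic_solution_marginal:
  assumes "ergodic_solution M R F \<mu> H" "0 \<le> s"
  shows "distr M borel (H s) = \<mu>"
  using assms stationary_process_marginal[of H M s]
  by (auto simp: ergodic_solution_def ergodic_process_def additive_sde_solution_def)

text \<open>\<open>H 0 - H s + R s\<close> is the drift integral, which has a sign. As \<open>H 0\<close> and \<open>H s\<close> have the same law
  and \<open>R s\<close> has mean zero, this integral has mean zero although \<open>H 0\<close> need not be integrable.\<close>

lemma ergodic_solution_one_sided_noise: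
  assumes R: "stable_levy_process M \<alpha> a\<^sub>p a\<^sub>m R" and a: "1 < \<alpha>" "0 \<le> a\<^sub>p" "0 \<le> a\<^sub>m"
    and erg: "ergodic_solution M R F \<mu> H"
    and F: "(\<forall>v. 0 \<le> F v) \<or> (\<forall>v. F v \<le> 0)" and "0 \<le> s"
  shows "AE \<omega> in M. H s \<omega> = H 0 \<omega> + R s \<omega>"
proof -
  have L: "levy_process M R"
    using R by (simp add: stable_levy_process_def Let_def)
  interpret prob_space M
    using L by (rule levy_processD)
  have H_meas[measurable]: "H s \<in> borel_measurable M" "H 0 \<in> borel_measurable M"
    using erg \<open>0 \<le> s\<close> by (auto simp: ergodic_solution_def additive_sde_solution_def)
  note R_int = stable_levy_process_char_mean(1,2)[OF R a \<open>0 \<le> s\<close>]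
  have [measurable]: "R s \<in> borel_measurable M"
    using R_int(1) by (rule borel_measurable_integrable)
  have law: "distr M borel (H 0) = distr M borel (H s)"
    using ergodic_solution_marginal[OF erg] \<open>0 \<le> s\<close> by simp
  have "additive_sde_solution M 0 (\<lambda>t v. - (1 * F v)) R H"
    using erg by (simp add: ergodic_solution_def)
  from additive_sde_solution_integral_equation[OF this]
  have eq: "AE \<omega> in M. H 0 \<omega> + R s \<omega> - H s \<omega> = (LINT u:{0..s}|lborel. F (H u \<omega>))"
    using AE_space
  proof eventually_elim
    case (elim \<omega>)
    then have "H s \<omega> = H 0 \<omega> + (R s \<omega> - R 0 \<omega>) - (LINT u:{0..s}|lborel. 1 * F (H u \<omega>))"
      using \<open>0 \<le> s\<close> by blast
    then show ?case
      using levy_processD(3)[OF L elim(2)] by simp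
  qed
  define D where "D = (\<lambda>\<omega>. H 0 \<omega> + R s \<omega> - H s \<omega>)"
  have "AE \<omega> in M. D \<omega> = 0"
    using F
  proof
    assume F: "\<forall>v. 0 \<le> F v"
    have D: "AE \<omega> in M. 0 \<le> D \<omega>"
      using eq by eventually_elim
        (auto simp: D_def set_lebesgue_integral_def F intro!: Bochner_Integration.integral_nonneg)
    \<comment> \<open>\<open>R s\<close> is integrable, so it provides the lower bound required for
      a difference of equidistributed variables.\<close>
    have "AE \<omega> in M. - R s \<omega> \<le> H 0 \<omega> - H s \<omega>"
      using D by eventually_elim (simp add: D_def)
    from equidistributed_difference_mean_zero[OF H_meas(2,1) law _ this] R_int
    have "integrable M (\<lambda>\<omega>. H 0 \<omega> - H s \<omega>)" "expectation (\<lambda>\<omega>. H 0 \<omega> - H s \<omega>) = 0"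
      by auto
    then have "integrable M (\<lambda>\<omega>. (H 0 \<omega> - H s \<omega>) + R s \<omega>)" "expectation (\<lambda>\<omega>. (H 0 \<omega> - H s \<omega>) + R s \<omega>) = 0"
      using R_int by auto
    then have "integrable M D" "expectation D = 0"
      by (simp_all add: D_def algebra_simps)
    then show ?thesis
      using D by (subst (asm) integral_nonneg_eq_0_iff_AE) auto
  next
    assume F: "\<forall>v. F v \<le> 0"
    have D: "AE \<omega> in M. 0 \<le> - D \<omega>"
      using eq
    proof eventually_elim
      case (elim \<omega>)
      have "- D \<omega> = (LINT u:{0..s}|lborel. - F (H u \<omega>))"
        using elim by (simp add: D_def set_lebesgue_integral_def)
      also have "0 \<le> \<dots>"
        unfolding set_lebesgue_integral_def using F
        by (intro Bochner_Integration.integral_nonneg) (auto simp: indicator_def)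
      finally show ?case .
    qed
    have "AE \<omega> in M. R s \<omega> \<le> H s \<omega> - H 0 \<omega>"
      using D by eventually_elim (simp add: D_def)
    from equidistributed_difference_mean_zero[OF H_meas law[symmetric] _ this] R_int
    have "integrable M (\<lambda>\<omega>. H s \<omega> - H 0 \<omega>)" "expectation (\<lambda>\<omega>. H s \<omega> - H 0 \<omega>) = 0"
      by auto
    then have "integrable M (\<lambda>\<omega>. (H s \<omega> - H 0 \<omega>) - R s \<omega>)" "expectation (\<lambda>\<omega>. (H s \<omega> - H 0 \<omega>) - R s \<omega>) = 0"
      using R_int by auto
    then have "integrable M (\<lambda>\<omega>. - D \<omega>)" "expectation (\<lambda>\<omega>. - D \<omega>) = 0"
      by (simp_all add: D_def algebra_simps)
    then have "AE \<omega> in M. - D \<omega> = 0"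
      using D by (subst (asm) integral_nonneg_eq_0_iff_AE) auto
    then show ?thesis
      by simp
  qed
  then show ?thesis
    by eventually_elim (simp add: D_def)
qed

text \<open>\<open>R s\<close> is a difference of two variables of law \<mu>, hence tight uniformly
  in \<open>s\<close>, whereas by self-similarity \<open>R\<close> at time
  \<open>c powr \<alpha>\<close> spreads like \<open>c * R 1\<close>. Letting \<open>c\<close> grow
  forces \<open>R 1\<close> to vanish; scaling extends this to each time and right continuity to all
  times at once.\<close>

lemma ergodic_solution_one_sided_noise_zero:
  assumes R: "stable_levy_process M \<alpha> a\<^sub>p a\<^sub>m R" and a: "1 < \<alpha>" "0 \<le> a\<^sub>p" "0 \<le> a\<^sub>m"
    and erg: "ergodic_solution M R F \<mu> H"
    and F: "(\<forall>v. 0 \<le> F v) \<or> (\<forall>v. F v \<le> 0)"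
  shows "AE \<omega> in M. \<forall>t\<ge>0. R t \<omega> = 0"
proof -
  have L: "levy_process M R"
    using R by (simp add: stable_levy_process_def Let_def)
  interpret prob_space M
    using L by (rule levy_processD)
  have H_meas[measurable]: "H s \<in> borel_measurable M" if "0 \<le> s" for s
    using erg that by (auto simp: ergodic_solution_def additive_sde_solution_def)
  have R_meas[measurable]: "R s \<in> borel_measurable M" if "0 \<le> s" for s
    using that by (rule levy_processD(2)[OF L])
  have \<mu>: "prob_space \<mu>" "sets \<mu> = sets borel"
    using erg by (auto simp: ergodic_solution_def invariant_measure_def)
  interpret \<mu>: prob_space \<mu> by (rule \<mu>)
  have tail: "prob {\<omega> \<in> space M. \<eta> * c < \<bar>H s \<omega>\<bar>} = measure \<mu> {x. \<eta> * c < \<bar>x\<bar>}" if "0 \<le> s" for s \<eta> c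
    unfolding ergodic_solution_marginal[OF erg that, symmetric] using that
    by (subst measure_distr) (auto intro!: arg_cong[where f = prob])
  have one: "AE \<omega> in M. R 1 \<omega> = 0"
  proof -
    have "prob {\<omega> \<in> space M. 2 * \<eta> < \<bar>R 1 \<omega>\<bar>} = 0" if "0 < \<eta>" for \<eta>
    proof -
      have le: "prob {\<omega> \<in> space M. 2 * \<eta> < \<bar>R 1 \<omega>\<bar>} \<le> 2 * measure \<mu> {x. \<eta> * c < \<bar>x\<bar>}" if "0 < c" for c
      proof -
        let ?s = "c powr \<alpha>"
        have [measurable]: "R 1 \<in> borel_measurable M" "R ?s \<in> borel_measurable M" "H ?s \<in> borel_measurable M" "H 0 \<in> borel_measurable M"
          by auto
        have "{\<omega> \<in> space M. 2 * \<eta> < \<bar>R 1 \<omega>\<bar>} = {\<omega> \<in> space M. 2 * \<eta> * c < \<bar>c * R 1 \<omega>\<bar>}"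
          using \<open>0 < c\<close> by (simp add: abs_mult mult.commute)
        then have "prob {\<omega> \<in> space M. 2 * \<eta> < \<bar>R 1 \<omega>\<bar>} = measure (distr M borel (\<lambda>\<omega>. c * R 1 \<omega>)) {x. 2 * \<eta> * c < \<bar>x\<bar>}"
          by (subst measure_distr) (auto intro!: arg_cong[where f = prob])
        also have "\<dots> = measure (distr M borel (R ?s)) {x. 2 * \<eta> * c < \<bar>x\<bar>}"
          using stable_levy_process_scaling[OF R R a, of 1 c] \<open>0 < c\<close> by simp
        also have "\<dots> = prob {\<omega> \<in> space M. 2 * \<eta> * c < \<bar>R ?s \<omega>\<bar>}"
          by (subst measure_distr) (auto intro!: arg_cong[where f = prob])
        also have "\<dots> \<le> prob ({\<omega> \<in> space M. \<eta> * c < \<bar>H ?s \<omega>\<bar>} \<union> {\<omega> \<in> space M. \<eta> * c < \<bar>H 0 \<omega>\<bar>})"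
        proof (rule finite_measure_mono_AE)
          show "AE \<omega> in M. \<omega> \<in> {\<omega> \<in> space M. 2 * \<eta> * c < \<bar>R ?s \<omega>\<bar>} \<longrightarrow>
              \<omega> \<in> {\<omega> \<in> space M. \<eta> * c < \<bar>H ?s \<omega>\<bar>} \<union> {\<omega> \<in> space M. \<eta> * c < \<bar>H 0 \<omega>\<bar>}"
            using ergodic_solution_one_sided_noise[OF R a erg F powr_ge_zero, of c \<alpha>]
            by eventually_elim auto
        qed measurable
        also have "\<dots> \<le> prob {\<omega> \<in> space M. \<eta> * c < \<bar>H ?s \<omega>\<bar>} + prob {\<omega> \<in> space M. \<eta> * c < \<bar>H 0 \<omega>\<bar>}"
          by (rule measure_Un_le) measurable
        finally show ?thesis
          by (simp add: tail)
      qed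
      have "(\<lambda>n. measure \<mu> {x. \<eta> * real n < \<bar>x\<bar>}) \<longlonglongrightarrow> measure \<mu> (\<Inter>n. {x. \<eta> * real n < \<bar>x\<bar>})"
      proof (rule \<mu>.finite_Lim_measure_decseq)
        show "decseq (\<lambda>n. {x. \<eta> * real n < \<bar>x\<bar>})"
          unfolding decseq_def
        proof (intro allI impI subsetI)
          fix m n :: nat and x assume "m \<le> n" "x \<in> {x. \<eta> * real n < \<bar>x\<bar>}"
          moreover then have "\<eta> * real m \<le> \<eta> * real n"
            using \<open>0 < \<eta>\<close> by (intro mult_left_mono) auto
          ultimately show "x \<in> {x. \<eta> * real m < \<bar>x\<bar>}"
            by simp
        qed
      qed (auto simp: \<mu>(2))
      also have "(\<Inter>n. {x. \<eta> * real n < \<bar>x\<bar>}) = {}"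
      proof -
        have "\<exists>n. \<bar>x\<bar> \<le> \<eta> * real n" for x
          using real_arch_simple[of "\<bar>x\<bar> / \<eta>"] \<open>0 < \<eta>\<close> by (auto simp: field_simps)
        then show ?thesis
          by (simp add: set_eq_iff not_less)
      qed
      finally have "(\<lambda>n. 2 * measure \<mu> {x. \<eta> * real n < \<bar>x\<bar>}) \<longlonglongrightarrow> 2 * 0"
        by (intro tendsto_intros) simp
      moreover have "\<forall>\<^sub>F n in sequentially. prob {\<omega> \<in> space M. 2 * \<eta> < \<bar>R 1 \<omega>\<bar>} \<le> 2 * measure \<mu> {x. \<eta> * real n < \<bar>x\<bar>}"
        using eventually_gt_at_top[of 0] by eventually_elim (auto intro: le)
      ultimately have "prob {\<omega> \<in> space M. 2 * \<eta> < \<bar>R 1 \<omega>\<bar>} \<le> 2 * 0"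
        by (intro tendsto_lowerbound) auto
      then show ?thesis
        by (simp add: measure_le_0_iff)
    qed
    note prob0 = this
    have "AE \<omega> in M. \<not> 2 * (1 / real (Suc n)) < \<bar>R 1 \<omega>\<bar>" for n
    proof (rule AE_I[where N = "{\<omega> \<in> space M. 2 * (1 / real (Suc n)) < \<bar>R 1 \<omega>\<bar>}"])
      show "emeasure M {\<omega> \<in> space M. 2 * (1 / real (Suc n)) < \<bar>R 1 \<omega>\<bar>} = 0"
        unfolding emeasure_eq_measure by (subst prob0) auto
    qed auto
    then have "AE \<omega> in M. \<forall>n. \<not> 2 * (1 / real (Suc n)) < \<bar>R 1 \<omega>\<bar>"
      by (simp add: AE_all_countable)
    then show ?thesis
    proof eventually_elim
      case (elim \<omega>)
      show ?case
      proof (rule ccontr)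
        assume "R 1 \<omega> \<noteq> 0"
        then have "0 < \<bar>R 1 \<omega>\<bar> / 2"
          by simp
        then obtain n where "1 / real (Suc n) < \<bar>R 1 \<omega>\<bar> / 2"
          using nat_approx_posE by blast
        then show False
          using elim by (auto dest!: spec[where x = n])
      qed
    qed
  qed
  have all: "AE \<omega> in M. R t \<omega> = 0" if "0 < t" for t
  proof -
    define c where "c = t powr (1 / \<alpha>)"
    have c: "0 < c" "c powr \<alpha> = t"
      using that a by (auto simp: c_def powr_powr)
    have [measurable]: "R 1 \<in> borel_measurable M" "R t \<in> borel_measurable M"
      using that by auto
    have "AE x in distr M borel (\<lambda>\<omega>. c * R 1 \<omega>). x = 0"
      using one by (subst AE_distr_iff) auto
    moreover have "distr M borel (R t) = distr M borel (\<lambda>\<omega>. c * R 1 \<omega>)"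
      using stable_levy_process_scaling[OF R R a, of 1 c] c by simp
    ultimately have "AE x in distr M borel (R t). x = 0"
      by (simp only:)
    then show ?thesis
      by (subst (asm) AE_distr_iff) auto
  qed
  have "AE \<omega> in M. \<forall>t\<in>\<rat> \<inter> {0<..}. R t \<omega> = 0"
    using all by (subst AE_ball_countable) (auto intro: countable_Int1 countable_rat)
  then show ?thesis
    using AE_space
  proof (eventually_elim, intro allI impI)
    fix \<omega> and t :: real assume \<omega>: "\<forall>t\<in>\<rat> \<inter> {0<..}. R t \<omega> = 0" "\<omega> \<in> space M" and "0 \<le> t"
    have lim: "((\<lambda>t. R t \<omega>) \<longlongrightarrow> R t \<omega>) (at_right t)"
      using levy_processD(4)[OF L \<omega>(2)] \<open>0 \<le> t\<close> by (simp add: cadlag_def)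
    show "R t \<omega> = 0"
    proof (rule ccontr)
      assume "R t \<omega> \<noteq> 0"
      then have "\<forall>\<^sub>F u in at_right t. R u \<omega> \<noteq> 0"
        using lim by (intro tendsto_imp_eventually_ne)
      then obtain b where b: "t < b" "\<And>u. t < u \<Longrightarrow> u < b \<Longrightarrow> R u \<omega> \<noteq> 0"
        unfolding eventually_at_right_field by blast
      obtain r where "r \<in> \<rat>" "t < r" "r < b"
        using Rats_dense_in_real[OF b(1)] by blast
      then show False
        using b(2)[of r] \<omega>(1) \<open>0 \<le> t\<close> by auto
    qed
  qed
qed

text \<open>The map \<open>x \<mapsto> law of H x s\<close> is not known to be measurable; only its value at \<open>x\<close> matters here.\<close>

lemma zero_noise_dirac_invariant:
  assumes L: "levy_process M R" and R0: "AE \<omega> in M. \<forall>t\<ge>0. R t \<omega> = 0"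
    and F: "mono F" "continuous_on UNIV F" and inv: "invariant_measure M R F \<mu>" and x: "F x = 0"
  shows "invariant_measure M R F (return borel x)"
proof -
  interpret prob_space M
    using L by (rule levy_processD)
  obtain H where H: "\<And>x. additive_sde_solution M 0 (\<lambda>_ h. - F h) R (H x)" "\<And>x. AE \<omega> in M. H x 0 \<omega> = x"
    using inv unfolding invariant_measure_def by blast
  have const: "AE \<omega> in M. H x s \<omega> = x" if "0 \<le> s" for s
  proof (cases "s = 0")
    case False
    have "additive_sde_solution M 0 (\<lambda>t v. - (1 * F v)) R (H x)"
      using H(1) by simp
    from additive_sde_solution_integral_equation[OF this] R0 H(2)[of x] AE_space
    show ?thesis
    proof eventually_elim
      case (elim \<omega>)
      let ?y = "\<lambda>t. H x t \<omega>" and ?l = "\<lambda>t. R t \<omega>"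
      have int: "set_integrable lborel {0..t} (\<lambda>s. 1 * F (?y s))" if "0 \<le> t" for t
        using elim(1) that by blast
      have eq: "?y t = ?y 0 + (?l t - ?l 0) - (LINT s:{0..t}|lborel. 1 * F (?y s))" if "0 \<le> t" for t
        using elim(1) that by blast
      have l: "cadlag ?l"
        using elim by (intro levy_processD(4)[OF L])
      \<comment> \<open>The error bound with \<open>k = \<eta> = 0\<close> is applied to the scheme
        started at \<open>x\<close>. Without noise it stays there, since \<open>F x = 0\<close>
        makes \<open>x\<close> a fixed point of the resolvent; this stands for uniqueness of the
        deterministic equation.\<close>
      have le: "\<bar>?y s - x\<bar> \<le> \<theta>" if "0 < \<theta>" for \<theta>
      proof -
        have "\<forall>\<^sub>F n in sequentially.
          \<bar>?y s - implicit_euler F (1 * ((s - 0) / real n)) x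
            (\<lambda>j. ?l (0 + real (Suc j) * ((s - 0) / real n)) - ?l (0 + real j * ((s - 0) / real n))) n\<bar>
          \<le> 0 + exp (- (0 * 1 * (s - 0))) * \<bar>?y 0 - x\<bar>
            + (LINT u:{0<..s}|lborel. \<bar>1 - 1\<bar> * \<bar>F (?y u)\<bar>) + \<theta>"
          using \<open>0 \<le> s\<close> False \<open>0 < \<theta>\<close>
          by (intro implicit_euler_solution_limit[OF F l order_refl int eq]) (auto dest: monoD[OF F(1)])
        then obtain n where n: "\<bar>?y s - implicit_euler F (1 * ((s - 0) / real n)) x
            (\<lambda>j. ?l (0 + real (Suc j) * ((s - 0) / real n)) - ?l (0 + real j * ((s - 0) / real n))) n\<bar> \<le> \<theta>"
          using elim(3) by (auto simp: set_lebesgue_integral_def dest: eventually_happens)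
        have "implicit_euler F (1 * ((s - 0) / real n)) x
            (\<lambda>j. ?l (0 + real (Suc j) * ((s - 0) / real n)) - ?l (0 + real j * ((s - 0) / real n))) m = x" for m
        proof (induction m)
          case (Suc m)
          have "?l (0 + real (Suc m) * ((s - 0) / real n)) = 0" "?l (0 + real m * ((s - 0) / real n)) = 0"
            using elim(2) \<open>0 \<le> s\<close> by auto
          then show ?case
            using Suc x F \<open>0 \<le> s\<close> by (simp add: resolvent_unique)
        qed simp
        then show ?thesis
          using n by simp
      qed
      have "\<bar>?y s - x\<bar> \<le> 0"
        by (rule dense_ge) (rule le)
      then show ?case
        by simp
    qed
  qed (use H(2) in simp)
  have H_meas: "H x s \<in> borel_measurable M" if "0 \<le> s" for s
    using H(1)[of x] that by (simp add: additive_sde_solution_def)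
  have law: "distr M borel (H x s) = return borel x" if "0 \<le> s" for s
  proof (rule measure_eqI)
    fix A assume "A \<in> sets (distr M borel (H x s))"
    then have A: "A \<in> sets borel"
      by simp
    have "emeasure (distr M borel (H x s)) A = emeasure M (H x s -` A \<inter> space M)"
      using H_meas[OF that] A by (simp add: emeasure_distr)
    also have "\<dots> = emeasure M {\<omega> \<in> space M. x \<in> A}"
      using const[OF that] H_meas[OF that] A by (intro emeasure_eq_AE) (auto elim: eventually_mono)
    also have "\<dots> = emeasure (return borel x) A"
      using A emeasure_space_1 by (auto simp: indicator_def)
    finally show "emeasure (distr M borel (H x s)) A = emeasure (return borel x) A" .
  qed simp
  have "(\<integral>\<^sup>+x'. emeasure (distr M borel (H x' s)) A \<partial>return borel x) = emeasure (return borel x) A"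
    if "0 \<le> s" "A \<in> sets borel" for s A
  proof -
    have "AE x' in return borel x. x' = x"
      by (subst AE_return) auto
    then have "(\<integral>\<^sup>+x'. emeasure (distr M borel (H x' s)) A \<partial>return borel x)
        = (\<integral>\<^sup>+x'. emeasure (return borel x) A \<partial>return borel x)"
      using law[OF that(1)] by (intro nn_integral_cong_AE) (auto elim: eventually_mono)
    also have "\<dots> = emeasure (return borel x) A"
      by (simp add: nn_integral_return)
    finally show ?thesis .
  qed
  then show ?thesis
    unfolding invariant_measure_def using H prob_space_return[of x borel]
    by (intro conjI exI[of _ H]) auto
qed

text \<open>If \<open>F\<close> vanished on a half-line, stationarity would force the noise to vanish, and then all Dirac
  masses on this half-line would be invariant, against uniqueness.\<close>

lemma ergodic_solution_two_sided:
  assumes R: "stable_levy_process M \<alpha> a\<^sub>p a\<^sub>m R" and a: "1 < \<alpha>" "0 \<le> a\<^sub>p" "0 \<le> a\<^sub>m"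
    and erg: "ergodic_solution M R F \<mu> H"
    and F: "1 \<le> \<gamma>" "\<And>v c. 0 < c \<Longrightarrow> F (c * v) = c powr \<gamma> * F v" "\<And>v. 0 \<le> v * F v" "continuous_on UNIV F"
  shows "0 < F 1 \<and> F (- 1) < 0"
proof (rule ccontr)
  assume "\<not> ?thesis"
  then obtain x where x: "x \<noteq> 0" "F x = 0" and one: "(\<forall>v. 0 \<le> F v) \<or> (\<forall>v. F v \<le> 0)"
  proof -
    have *: "F v = (if 0 \<le> v then F 1 * v powr \<gamma> else F (- 1) * (- v) powr \<gamma>)" for v
      by (rule homogeneous_eq[OF F(1-3)])
    have s: "0 \<le> F 1" "F (- 1) \<le> 0"
      using homogeneous_at_one[OF F(1-3)] by auto
    assume "\<not> (0 < F 1 \<and> F (- 1) < 0)"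
    then consider "F 1 = 0" | "F (- 1) = 0"
      using s by linarith
    then show ?thesis
    proof cases
      case 1
      then have "F v \<le> 0" for v
        using s by (subst *) (auto intro: mult_nonpos_nonneg)
      then show ?thesis
        using 1 by (intro that[of 1]) auto
    next
      case 2
      then have "0 \<le> F v" for v
        using s by (subst *) auto
      then show ?thesis
        using 2 by (intro that[of "- 1"]) auto
    qed
  qed
  have L: "levy_process M R"
    using R by (simp add: stable_levy_process_def Let_def)
  have inv: "invariant_measure M R F \<mu>" and uniq: "\<And>\<mu>'. invariant_measure M R F \<mu>' \<Longrightarrow> \<mu>' = \<mu>"
    using erg by (auto simp: ergodic_solution_def)
  have mono: "mono F"
    by (rule homogeneous_mono[OF F(1-3)])
  have zero: "F 0 = 0"
    by (rule homogeneous_zero[OF F(1-3)])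
  note dirac = zero_noise_dirac_invariant[OF L ergodic_solution_one_sided_noise_zero[OF R a erg one]
      mono F(4) inv]
  have "return borel x = return borel (0::real)"
    using uniq[OF dirac[OF x(2)]] uniq[OF dirac[OF zero]] by simp
  then have "measure (return borel x) {x} = measure (return borel (0::real)) {x}"
    by simp
  then show False
    using x(1) by (simp add: measure_return)
qed

section \<open>Convergence of the rescaled velocity\<close>

text \<open>On \<open>[window_start, \<tau>]\<close> time is rescaled by \<open>\<tau> powr (q * \<alpha>)\<close> and space by \<open>\<tau> powr q\<close>. As
  \<open>\<beta> = q * (\<alpha> + \<gamma> - 1)\<close>, this turns the drift \<open>\<tau> powr (- \<beta>) * F\<close> into \<open>F\<close>, and the window gets length \<open>\<sigma>\<close>.\<close>

definition window_start :: "real \<Rightarrow> real \<Rightarrow> real \<Rightarrow> real \<Rightarrow> real" where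
  "window_start \<alpha> q \<sigma> \<tau> = \<tau> - \<sigma> * \<tau> powr (q * \<alpha>)"

text \<open>The scheme starts at 0 rather than at the value of the path at the start of the window:
  it is then a functional of the increments in the window alone, which gives independence over
  disjoint windows and, for stable noise, a law that does not depend on \<tau>.\<close>

definition window_euler ::
  "(real \<Rightarrow> real) \<Rightarrow> real \<Rightarrow> real \<Rightarrow> real \<Rightarrow> real \<Rightarrow> (real \<Rightarrow> real) \<Rightarrow> nat \<Rightarrow> real" where
  "window_euler F \<alpha> q \<sigma> \<tau> l n = implicit_euler F (\<sigma> / real n) 0
     (\<lambda>k. \<tau> powr (- q) *
       (l (window_start \<alpha> q \<sigma> \<tau> + real (Suc k) * (\<sigma> * \<tau> powr (q * \<alpha>) / real n))
        - l (window_start \<alpha> q \<sigma> \<tau> + real k * (\<sigma> * \<tau> powr (q * \<alpha>) / real n)))) n"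

lemma one_minus_powr_le:
  fixes r \<beta> :: real
  assumes "0 \<le> r" "r \<le> 1 / 2" "0 \<le> \<beta>" "\<beta> \<le> 2"
  shows "(1 - r) powr (- \<beta>) \<le> 1 + 8 * r"
proof -
  have "(1 - r) powr (- \<beta>) \<le> (1 - r) powr (- 2)"
    using assms by (intro powr_mono') auto
  also have "\<dots> = 1 / (1 - r)\<^sup>2"
    using assms by (simp add: powr_minus_divide)
  also have "\<dots> \<le> 1 + 8 * r"
  proof -
    \<comment> \<open>\<open>(1 + 8 * r) * (1 - r)\<^sup>2 - 1\<close> equals this product, and the
      quadratic factor is nonnegative up to \<open>r = 1 / 2\<close>.\<close>
    have "0 \<le> r * (6 - 15 * r + 8 * r\<^sup>2)"
    proof (rule mult_nonneg_nonneg)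
      have "0 \<le> (1 / 2 - r) * (11 - 8 * r) + 1 / 2"
        using assms by (intro add_nonneg_nonneg mult_nonneg_nonneg) auto
      then show "0 \<le> 6 - 15 * r + 8 * r\<^sup>2"
        by (simp add: algebra_simps power2_eq_square)
    qed (use assms in simp)
    then have "1 \<le> (1 + 8 * r) * (1 - r)\<^sup>2"
      by (simp add: algebra_simps power2_eq_square)
    then show ?thesis
      using assms by (simp add: divide_le_eq)
  qed
  finally show ?thesis .
qed

lemma kinetic_window_error:
  fixes F y l :: "real \<Rightarrow> real" and \<alpha> \<beta> \<gamma> q K \<sigma> \<tau> t\<^sub>0 \<eta> \<theta> :: real
  defines "\<kappa> \<equiv> min (F 1) (- F (- 1)) * 2 powr (- \<gamma>)"
  assumes par: "1 < \<alpha>" "1 \<le> \<gamma>" "0 \<le> \<beta>" "\<beta> \<le> 2" "\<beta> = q * (\<alpha> + \<gamma> - 1)"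
    and F: "continuous_on UNIV F" "\<And>v c. 0 < c \<Longrightarrow> F (c * v) = c powr \<gamma> * F v" "\<And>v. 0 \<le> v * F v"
    and l: "cadlag l" and t0: "0 < t\<^sub>0"
    and int: "\<And>t. t\<^sub>0 \<le> t \<Longrightarrow> set_integrable lborel {t\<^sub>0..t} (\<lambda>s. s powr (- \<beta>) * F (y s))"
    and eq: "\<And>t. t\<^sub>0 \<le> t \<Longrightarrow> y t = y t\<^sub>0 + (l t - l t\<^sub>0) - (LINT s:{t\<^sub>0..t}|lborel. s powr (- \<beta>) * F (y s))"
    and \<sigma>: "0 < \<sigma>" "0 < \<tau>" "\<sigma> * \<tau> powr (q * \<alpha> - 1) \<le> 1 / 2" "t\<^sub>0 \<le> window_start \<alpha> q \<sigma> \<tau>"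
    and K: "0 < K" "\<bar>y t\<^sub>0\<bar> \<le> K * \<tau> powr (1 / \<alpha>)" "\<And>s. 0 \<le> s \<Longrightarrow> s \<le> \<tau> \<Longrightarrow> \<bar>l s\<bar> \<le> K * \<tau> powr (1 / \<alpha>)"
    and \<eta>: "0 < \<eta>" "0 < \<theta>"
  shows "\<forall>\<^sub>F n in sequentially. \<bar>\<tau> powr (- q) * y \<tau> - window_euler F \<alpha> q \<sigma> \<tau> l n\<bar>
    \<le> \<eta> + exp (- (\<kappa> * \<eta> powr (\<gamma> - 1) * \<sigma>)) * (5 * K * \<tau> powr (1 / \<alpha> - q))
      + 8 * \<sigma>\<^sup>2 * (F 1 - F (- 1)) * (5 * K) powr \<gamma> * \<tau> powr (- ((\<alpha> - \<gamma>) * (1 / \<alpha> - q))) + \<theta>"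
proof -
  define a where "a = window_start \<alpha> q \<sigma> \<tau>"
  define r where "r = \<sigma> * \<tau> powr (q * \<alpha> - 1)"
  \<comment> \<open>In units of \<open>\<tau> powr (1 / \<alpha>)\<close>: \<open>K\<close> for the
    initial value plus 4 times \<open>K\<close> for the noise, since increments of \<open>l\<close>
    are bounded by twice its maximum and the dissipative bound doubles this again.\<close>
  define B where "B = 5 * K * \<tau> powr (1 / \<alpha>)"
  define CF where "CF = F 1 - F (- 1)"
  define J where "J = (LINT s:{a<..\<tau>}|lborel. \<bar>s powr (- \<beta>) - \<tau> powr (- \<beta>)\<bar> * \<bar>F (y s)\<bar>)"
  have mono: "mono F"
    by (rule homogeneous_mono[OF par(2) F(2,3)])
  have F1: "0 \<le> F 1" "F (- 1) \<le> 0"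
    using homogeneous_at_one[OF par(2) F(2,3)] by auto
  have Fsign: "0 \<le> F v" if "0 \<le> v" for v
    using monoD[OF mono that] homogeneous_zero[OF par(2) F(2,3)] by simp
  have Fsign': "F v \<le> 0" if "v \<le> 0" for v
    using monoD[OF mono that] homogeneous_zero[OF par(2) F(2,3)] by simp
  have len: "\<tau> - a = \<sigma> * \<tau> powr (q * \<alpha>)"
    by (simp add: a_def window_start_def)
  have a_r: "a = \<tau> * (1 - r)"
    using \<sigma> by (simp add: a_def window_start_def r_def powr_diff field_simps)
  have r: "0 < r" "r \<le> 1 / 2"
    using \<sigma> by (auto simp: r_def)
  have a: "t\<^sub>0 \<le> a" "0 < a" "a < \<tau>"
  proof -
    have "0 < \<sigma> * \<tau> powr (q * \<alpha>)"
      using \<sigma> by simp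
    then show "a < \<tau>"
      using len by linarith
    show "t\<^sub>0 \<le> a" "0 < a"
      using \<sigma>(4) t0 by (simp_all add: a_def)
  qed
  have \<tau>q: "0 < \<tau> powr q" "\<tau> powr q * \<tau> powr (- q) = 1"
    using \<sigma> by (auto simp: powr_minus)
  have c_nonneg: "0 \<le> s powr (- \<beta>)" for s :: real
    by simp
  have y_bd: "\<bar>y s\<bar> \<le> B" if "t\<^sub>0 \<le> s" "s \<le> \<tau>" for s
  proof -
    have "\<bar>l u - l t\<^sub>0\<bar> \<le> 2 * (K * \<tau> powr (1 / \<alpha>))" if "t\<^sub>0 \<le> u" "u \<le> s" for u
      using K(3)[of u] K(3)[of t\<^sub>0] that \<open>s \<le> \<tau>\<close> t0 by auto
    then have "\<bar>y s\<bar> \<le> \<bar>y t\<^sub>0\<bar> + 2 * (2 * (K * \<tau> powr (1 / \<alpha>)))"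
      by (intro dissipative_abs_bound[OF int eq c_nonneg Fsign Fsign' _ that(1)])
    then show ?thesis
      using K(2) by (simp add: B_def)
  qed
  have FB: "\<bar>F (y s)\<bar> \<le> CF * B powr \<gamma>" if "t\<^sub>0 \<le> s" "s \<le> \<tau>" for s
  proof -
    have "\<bar>F (y s)\<bar> \<le> CF * \<bar>y s\<bar> powr \<gamma>"
      unfolding CF_def by (rule homogeneous_growth[OF par(2) F(2,3)])
    also have "\<dots> \<le> CF * B powr \<gamma>"
      using y_bd[OF that] F1 par by (intro mult_left_mono powr_mono2) (auto simp: CF_def)
    finally show ?thesis .
  qed
  \<comment> \<open>\<open>r\<close> is the length of the window relative to \<tau>; on the window
    the coefficient \<open>s powr (- \<beta>)\<close> differs from its final value by a relative
    error of at most \<open>8 * r\<close>.\<close>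
  have J: "J \<le> (\<tau> - a) * (8 * r * \<tau> powr (- \<beta>) * (CF * B powr \<gamma>))"
  proof -
    let ?C = "8 * r * \<tau> powr (- \<beta>) * (CF * B powr \<gamma>)"
    have C: "0 \<le> ?C"
      using r F1 by (auto simp: CF_def)
    have "\<bar>s powr (- \<beta>) - \<tau> powr (- \<beta>)\<bar> * \<bar>F (y s)\<bar> \<le> ?C" if "a < s" "s \<le> \<tau>" for s
    proof (rule mult_mono)
      have "\<tau> powr (- \<beta>) \<le> s powr (- \<beta>)"
        using that a par by (intro powr_mono2') auto
      moreover have "s powr (- \<beta>) \<le> a powr (- \<beta>)"
        using that a par by (intro powr_mono2') auto
      moreover have "a powr (- \<beta>) = \<tau> powr (- \<beta>) * (1 - r) powr (- \<beta>)"
        using \<sigma> r unfolding a_r by (intro powr_mult)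
      moreover have "\<tau> powr (- \<beta>) * (1 - r) powr (- \<beta>) \<le> \<tau> powr (- \<beta>) * (1 + 8 * r)"
        using r par by (intro mult_left_mono one_minus_powr_le) auto
      ultimately show "\<bar>s powr (- \<beta>) - \<tau> powr (- \<beta>)\<bar> \<le> 8 * r * \<tau> powr (- \<beta>)"
        by (simp add: algebra_simps)
      show "\<bar>F (y s)\<bar> \<le> CF * B powr \<gamma>"
        using that a by (intro FB) auto
    qed (use r in auto)
    then have "indicator {a<..\<tau>} s * (\<bar>s powr (- \<beta>) - \<tau> powr (- \<beta>)\<bar> * \<bar>F (y s)\<bar>) \<le> indicator {a<..\<tau>} s * ?C" for s
      by (auto simp: indicator_def)
    moreover have "integrable lborel (\<lambda>s. indicator {a<..\<tau>} s * ?C)"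
      using a by (intro integrable_mult_left integrable_real_indicator) auto
    ultimately have "J \<le> (\<integral>s. indicator {a<..\<tau>} s * ?C \<partial>lborel)"
      unfolding J_def set_lebesgue_integral_def real_scaleR_def
      using C by (intro integral_mono') auto
    also have "\<dots> = (\<tau> - a) * ?C"
      using a by simp
    finally show ?thesis .
  qed
  \<comment> \<open>The powers of \<tau> come from the window length, its relative length, the drift
    coefficient and \<open>F\<close> at size \<open>\<tau> powr (1 / \<alpha>)\<close>; with the
    value of \<beta> they combine to the exponent
    \<open>q - (\<alpha> - \<gamma>) * (1 / \<alpha> - q)\<close>.\<close>
  have J0: "J \<le> \<tau> powr q * (8 * \<sigma>\<^sup>2 * CF * (5 * K) powr \<gamma> * \<tau> powr (- ((\<alpha> - \<gamma>) * (1 / \<alpha> - q))))"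
  proof -
    have Bg: "B powr \<gamma> = (5 * K) powr \<gamma> * \<tau> powr (\<gamma> / \<alpha>)"
      using K \<sigma> unfolding B_def by (subst powr_mult) (auto simp: powr_powr)
    have "(\<tau> - a) * (8 * r * \<tau> powr (- \<beta>) * (CF * B powr \<gamma>))
        = 8 * \<sigma>\<^sup>2 * CF * (5 * K) powr \<gamma> * (\<tau> powr (q * \<alpha>) * \<tau> powr (q * \<alpha> - 1) * \<tau> powr (- \<beta>) * \<tau> powr (\<gamma> / \<alpha>))"
      unfolding len Bg r_def by (simp add: power2_eq_square)
    also have "\<tau> powr (q * \<alpha>) * \<tau> powr (q * \<alpha> - 1) * \<tau> powr (- \<beta>) * \<tau> powr (\<gamma> / \<alpha>)
        = \<tau> powr (q * \<alpha> + (q * \<alpha> - 1) + (- \<beta>) + \<gamma> / \<alpha>)"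
      by (simp only: powr_add)
    also have "q * \<alpha> + (q * \<alpha> - 1) + (- \<beta>) + \<gamma> / \<alpha> = q + (- ((\<alpha> - \<gamma>) * (1 / \<alpha> - q)))"
      using par(1) unfolding par(5) by (simp add: field_simps)
    also have "\<tau> powr \<dots> = \<tau> powr q * \<tau> powr (- ((\<alpha> - \<gamma>) * (1 / \<alpha> - q)))"
      by (rule powr_add)
    finally have e: "(\<tau> - a) * (8 * r * \<tau> powr (- \<beta>) * (CF * B powr \<gamma>))
        = 8 * \<sigma>\<^sup>2 * CF * (5 * K) powr \<gamma> * (\<tau> powr q * \<tau> powr (- ((\<alpha> - \<gamma>) * (1 / \<alpha> - q))))" .
    show ?thesis
      using J unfolding e by (simp only: mult_ac)
  qed
  define \<eta>' where "\<eta>' = \<tau> powr q * \<eta>"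
  define k where "k = \<kappa> * \<eta>' powr (\<gamma> - 1)"
  have \<eta>': "0 < \<eta>'"
    using \<eta> \<sigma> by (simp add: \<eta>'_def)
  have k: "0 \<le> k"
    using F1 by (simp add: k_def \<kappa>_def)
  have expo: "\<tau> powr (q * (\<gamma> - 1)) * \<tau> powr (- \<beta>) * \<tau> powr (q * \<alpha>) = 1"
  proof -
    have "\<tau> powr (q * (\<gamma> - 1)) * \<tau> powr (- \<beta>) * \<tau> powr (q * \<alpha>) = \<tau> powr (q * (\<gamma> - 1) + (- \<beta>) + q * \<alpha>)"
      by (simp only: powr_add)
    also have "q * (\<gamma> - 1) + (- \<beta>) + q * \<alpha> = 0"
      unfolding par(5) by (simp add: algebra_simps)
    finally show ?thesis
      using \<sigma> by simp
  qed
  have k_len: "k * \<tau> powr (- \<beta>) * (\<tau> - a) = \<kappa> * \<eta> powr (\<gamma> - 1) * \<sigma>"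
  proof -
    have "\<eta>' powr (\<gamma> - 1) = \<tau> powr (q * (\<gamma> - 1)) * \<eta> powr (\<gamma> - 1)"
      using \<eta> \<sigma> unfolding \<eta>'_def by (subst powr_mult) (auto simp: powr_powr)
    then have "k * \<tau> powr (- \<beta>) * (\<tau> - a)
        = \<kappa> * \<eta> powr (\<gamma> - 1) * \<sigma> * (\<tau> powr (q * (\<gamma> - 1)) * \<tau> powr (- \<beta>) * \<tau> powr (q * \<alpha>))"
      unfolding k_def len by simp
    then show ?thesis
      unfolding expo by simp
  qed
  have "\<forall>\<^sub>F n in sequentially.
    \<bar>y \<tau> - implicit_euler F (\<tau> powr (- \<beta>) * ((\<tau> - a) / real n)) 0
        (\<lambda>j. l (a + real (Suc j) * ((\<tau> - a) / real n)) - l (a + real j * ((\<tau> - a) / real n))) n\<bar>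
      \<le> \<eta>' + exp (- (k * \<tau> powr (- \<beta>) * (\<tau> - a))) * \<bar>y a - 0\<bar> + J + \<tau> powr q * \<theta>"
    unfolding J_def
  proof (rule implicit_euler_solution_limit[OF mono F(1) l _ int eq a(1,3) _ k])
    show "k * (u - v - \<eta>') \<le> F u - F v" if "v \<le> u" for u v
      unfolding k_def \<kappa>_def by (rule homogeneous_dissipative[OF par(2) F(2,3) that \<eta>'])
  qed (use t0 \<eta>' \<eta> \<tau>q in auto)
  then show ?thesis
    using eventually_gt_at_top[of 0]
  proof eventually_elim
    case (elim n)
    let ?\<xi> = "\<lambda>j. l (a + real (Suc j) * ((\<tau> - a) / real n)) - l (a + real j * ((\<tau> - a) / real n))"
    have "implicit_euler F (\<tau> powr (- \<beta>) * ((\<tau> - a) / real n)) 0 ?\<xi> n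
        = implicit_euler F (\<tau> powr (- \<beta>) * ((\<tau> - a) / real n)) (\<tau> powr q * 0) (\<lambda>j. \<tau> powr q * (\<tau> powr (- q) * ?\<xi> j)) n"
      unfolding mult.assoc[symmetric] \<tau>q(2) by simp
    also have "\<dots> = \<tau> powr q * implicit_euler F (\<tau> powr (- \<beta>) * ((\<tau> - a) / real n) * (\<tau> powr q) powr (\<gamma> - 1)) 0
        (\<lambda>j. \<tau> powr (- q) * ?\<xi> j) n"
      using a \<tau>q F(2) by (intro implicit_euler_scale mono F(1)) auto
    also have "\<tau> powr (- \<beta>) * ((\<tau> - a) / real n) * (\<tau> powr q) powr (\<gamma> - 1) = \<sigma> / real n"
    proof -
      have "\<tau> powr (- \<beta>) * ((\<tau> - a) / real n) * (\<tau> powr q) powr (\<gamma> - 1)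
          = \<sigma> / real n * (\<tau> powr (q * (\<gamma> - 1)) * \<tau> powr (- \<beta>) * \<tau> powr (q * \<alpha>))"
        unfolding len by (simp add: powr_powr)
      then show ?thesis
        unfolding expo by simp
    qed
    also have "implicit_euler F (\<sigma> / real n) 0 (\<lambda>j. \<tau> powr (- q) * ?\<xi> j) n = window_euler F \<alpha> q \<sigma> \<tau> l n"
      unfolding window_euler_def a_def[symmetric] len ..
    finally have E: "implicit_euler F (\<tau> powr (- \<beta>) * ((\<tau> - a) / real n)) 0 ?\<xi> n = \<tau> powr q * window_euler F \<alpha> q \<sigma> \<tau> l n" .
    let ?rhs = "\<eta> + exp (- (\<kappa> * \<eta> powr (\<gamma> - 1) * \<sigma>)) * (5 * K * \<tau> powr (1 / \<alpha> - q))
      + 8 * \<sigma>\<^sup>2 * CF * (5 * K) powr \<gamma> * \<tau> powr (- ((\<alpha> - \<gamma>) * (1 / \<alpha> - q))) + \<theta>"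
    have "y \<tau> = \<tau> powr q * (\<tau> powr (- q) * y \<tau>)"
      unfolding mult.assoc[symmetric] \<tau>q(2) by simp
    then have "\<tau> powr q * \<bar>\<tau> powr (- q) * y \<tau> - window_euler F \<alpha> q \<sigma> \<tau> l n\<bar>
        = \<bar>y \<tau> - \<tau> powr q * window_euler F \<alpha> q \<sigma> \<tau> l n\<bar>"
      using \<tau>q(1) by (metis abs_mult abs_of_pos right_diff_distrib)
    also have "\<dots> \<le> \<eta>' + exp (- (\<kappa> * \<eta> powr (\<gamma> - 1) * \<sigma>)) * \<bar>y a\<bar> + J + \<tau> powr q * \<theta>"
      using elim(1) unfolding E k_len by simp
    also have "\<dots> \<le> \<eta>' + exp (- (\<kappa> * \<eta> powr (\<gamma> - 1) * \<sigma>)) * B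
        + \<tau> powr q * (8 * \<sigma>\<^sup>2 * CF * (5 * K) powr \<gamma> * \<tau> powr (- ((\<alpha> - \<gamma>) * (1 / \<alpha> - q)))) + \<tau> powr q * \<theta>"
      using J0 y_bd[of a] a by (intro add_mono mult_left_mono) auto
    also have "B = \<tau> powr q * (5 * K * \<tau> powr (1 / \<alpha> - q))"
    proof -
      have "\<tau> powr (1 / \<alpha>) = \<tau> powr (q + (1 / \<alpha> - q))"
        by simp
      also have "\<dots> = \<tau> powr q * \<tau> powr (1 / \<alpha> - q)"
        by (rule powr_add)
      finally show ?thesis
        by (simp add: B_def)
    qed
    also have "\<eta>' + exp (- (\<kappa> * \<eta> powr (\<gamma> - 1) * \<sigma>)) * (\<tau> powr q * (5 * K * \<tau> powr (1 / \<alpha> - q)))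
        + \<tau> powr q * (8 * \<sigma>\<^sup>2 * CF * (5 * K) powr \<gamma> * \<tau> powr (- ((\<alpha> - \<gamma>) * (1 / \<alpha> - q)))) + \<tau> powr q * \<theta>
      = \<tau> powr q * ?rhs"
      unfolding \<eta>'_def by (simp add: distrib_left mult.left_commute)
    finally have "\<bar>\<tau> powr (- q) * y \<tau> - window_euler F \<alpha> q \<sigma> \<tau> l n\<bar> \<le> ?rhs"
      using \<tau>q(1) by (rule mult_left_le_imp_le)
    then show ?case
      by (simp only: CF_def)
  qed
qed

text \<open>The index from which \<open>Y n \<omega> < \<delta>\<close> holds depends on \<omega>;
  dominated convergence on \<open>G\<close> turns this into a bound on probabilities. The strict
  inequality for the complement of \<open>G\<close> leaves the room for it.\<close>

lemma (in prob_space) eventually_prob_le: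
  fixes Y :: "nat \<Rightarrow> 'a \<Rightarrow> real"
  assumes [measurable]: "\<And>n. Y n \<in> borel_measurable M" "G \<in> events"
    and G: "prob (space M - G) < p"
    and Y: "AE \<omega> in M. \<omega> \<in> G \<longrightarrow> (\<forall>\<^sub>F n in sequentially. Y n \<omega> < \<delta>)"
  shows "\<forall>\<^sub>F n in sequentially. prob {\<omega> \<in> space M. \<delta> \<le> Y n \<omega>} < p"
proof -
  let ?B = "\<lambda>n. {\<omega> \<in> space M. \<delta> \<le> Y n \<omega>}"
  have "(\<lambda>n. expectation (\<lambda>\<omega>. indicator (?B n \<inter> G) \<omega> :: real)) \<longlonglongrightarrow> expectation (\<lambda>\<omega>. 0)"
  proof (rule integral_dominated_convergence)
    show "AE \<omega> in M. (\<lambda>n. indicator (?B n \<inter> G) \<omega> :: real) \<longlonglongrightarrow> 0"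
      using Y
    proof eventually_elim
      case (elim \<omega>)
      have "\<forall>\<^sub>F n in sequentially. indicator (?B n \<inter> G) \<omega> = (0::real)"
      proof (cases "\<omega> \<in> G")
        case True
        then have "\<forall>\<^sub>F n in sequentially. Y n \<omega> < \<delta>"
          using elim by simp
        then show ?thesis
          by eventually_elim simp
      qed simp
      then show ?case
        by (rule tendsto_eventually)
    qed
    show "integrable M (\<lambda>_. 1 :: real)"
      by simp
  qed (auto simp: indicator_def)
  moreover have "expectation (\<lambda>\<omega>. indicator (?B n \<inter> G) \<omega> :: real) = prob (?B n \<inter> G)" for n
    by (subst Bochner_Integration.integral_indicator) (auto intro!: arg_cong[where f = prob])
  ultimately have "(\<lambda>n. prob (?B n \<inter> G)) \<longlonglongrightarrow> 0"
    by simp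
  then have "\<forall>\<^sub>F n in sequentially. prob (?B n \<inter> G) < p - prob (space M - G)"
    using G by (intro order_tendstoD) auto
  then show ?thesis
  proof eventually_elim
    case (elim n)
    have "prob (?B n) \<le> prob ((?B n \<inter> G) \<union> (space M - G))"
      by (intro finite_measure_mono) auto
    also have "\<dots> \<le> prob (?B n \<inter> G) + prob (space M - G)"
      by (intro measure_Un_le) auto
    finally show ?case
      using elim by simp
  qed
qed

section \<open>Closeness in probability to Euler functionals, their laws and their
  independence\<close>

lemma borel_measurable_window_euler:
  assumes L: "levy_process M L" and F: "mono F" "continuous_on UNIV F"
    and \<sigma>: "0 \<le> \<sigma>" "0 \<le> \<tau>" "0 \<le> window_start \<alpha> q \<sigma> \<tau>"
  shows "(\<lambda>\<omega>. window_euler F \<alpha> q \<sigma> \<tau> (\<lambda>s. L s \<omega>) n) \<in> borel_measurable M"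
  unfolding window_euler_def using \<sigma> by (intro borel_measurable_levy_process_euler L F) auto

text \<open>\<open>K\<close> comes from tightness of the running maximum on [0, 1] and stays fixed;
  self-similarity carries the bound to [0, \<tau>] with the factor
  \<open>\<tau> powr (1 / \<alpha>)\<close>. The slack and the discretisation error are set to
  \<open>\<delta> / 4\<close> each, and the other two terms fall below \<open>\<delta> / 4\<close>
  for large \<open>T\<close>.\<close>

lemma kinetic_window_prob:
  fixes F :: "real \<Rightarrow> real" and \<alpha> \<beta> \<gamma> q a\<^sub>p a\<^sub>m t\<^sub>0 v\<^sub>0 t \<delta> p :: real
  assumes par: "1 < \<alpha>" "1 \<le> \<gamma>" "\<gamma> < \<alpha>" "0 \<le> \<beta>" "\<beta> \<le> 2" "\<beta> = q * (\<alpha> + \<gamma> - 1)" "q < 1 / \<alpha>"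
    and a: "0 \<le> a\<^sub>p" "0 \<le> a\<^sub>m"
    and F: "continuous_on UNIV F" "\<And>v c. 0 < c \<Longrightarrow> F (c * v) = c powr \<gamma> * F v" "\<And>v. 0 \<le> v * F v"
    and two_sided: "0 < F 1" "F (- 1) < 0"
    and L: "stable_levy_process M \<alpha> a\<^sub>p a\<^sub>m L" and t0: "0 < t\<^sub>0"
    and V: "additive_sde_solution M t\<^sub>0 (\<lambda>t v. - (t powr (- \<beta>) * F v)) L V" "AE \<omega> in M. V t\<^sub>0 \<omega> = v\<^sub>0"
    and t: "0 < t" "0 < \<delta>" "0 < p"
  shows "\<forall>\<^sub>F T in at_top. t\<^sub>0 \<le> window_start \<alpha> q ((ln T)\<^sup>2) (t * T) \<and>
    (\<forall>\<^sub>F n in sequentially. measure M {\<omega> \<in> space M.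
      \<delta> \<le> \<bar>(t * T) powr (- q) * V (t * T) \<omega> - window_euler F \<alpha> q ((ln T)\<^sup>2) (t * T) (\<lambda>s. L s \<omega>) n\<bar>} < p)"
proof -
  have levy: "levy_process M L"
    using L by (simp add: stable_levy_process_def Let_def)
  interpret prob_space M
    using levy by (rule levy_processD)
  have mono: "mono F"
    by (rule homogeneous_mono[OF par(2) F(2,3)])
  define k where "k = min (F 1) (- F (- 1)) * 2 powr (- \<gamma>) * (\<delta> / 4) powr (\<gamma> - 1)"
  have k: "0 < k"
    using two_sided t by (simp add: k_def)
  obtain K where K: "0 < K" "prob {\<omega> \<in> space M. \<exists>s\<in>{0..1}. K < \<bar>L s \<omega>\<bar>} < p"
    using levy_process_sup_tight[OF levy t(3)] by blast
  have expo: "0 < 1 - q * \<alpha>" "0 < 1 / \<alpha>" "0 < 1 / \<alpha> - q" "0 < (\<alpha> - \<gamma>) * (1 / \<alpha> - q)"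
  proof -
    show "0 < 1 - q * \<alpha>"
      using par(1,7) by (simp add: field_simps)
    show "0 < 1 / \<alpha>" "0 < 1 / \<alpha> - q"
      using par by auto
    then show "0 < (\<alpha> - \<gamma>) * (1 / \<alpha> - q)"
      using par by (intro mult_pos_pos) auto
  qed
  have "filterlim (\<lambda>T. t * T) at_top at_top"
    using t by (intro filterlim_tendsto_pos_mult_at_top[OF tendsto_const]) (auto simp: filterlim_ident)
  then have "\<forall>\<^sub>F T in at_top. 2 * t\<^sub>0 \<le> t * T"
    by (simp add: filterlim_at_top)
  moreover have "\<forall>\<^sub>F T in at_top. (ln T)\<^sup>2 * (t * T) powr (- (1 - q * \<alpha>)) < 1 / 2"
  proof (rule order_tendstoD)
    show "((\<lambda>T. (ln T)\<^sup>2 * (t * T) powr (- (1 - q * \<alpha>))) \<longlongrightarrow> 0) at_top"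
      using t(1) expo(1) by real_asymp
  qed simp
  moreover have "\<forall>\<^sub>F T in at_top. \<bar>v\<^sub>0\<bar> \<le> K * (t * T) powr (1 / \<alpha>)"
  proof -
    have "filterlim (\<lambda>T. K * (t * T) powr (1 / \<alpha>)) at_top at_top"
      using t(1) K(1) expo(2) by real_asymp
    then show ?thesis
      by (simp add: filterlim_at_top)
  qed
  moreover have "\<forall>\<^sub>F T in at_top. exp (- (k * (ln T)\<^sup>2)) * (5 * K * (t * T) powr (1 / \<alpha> - q)) < \<delta> / 4"
  proof (rule order_tendstoD)
    show "((\<lambda>T. exp (- (k * (ln T)\<^sup>2)) * (5 * K * (t * T) powr (1 / \<alpha> - q))) \<longlongrightarrow> 0) at_top"
      using t(1) K(1) k expo(3) by real_asymp
  qed (use t in simp)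
  moreover have "\<forall>\<^sub>F T in at_top. 8 * ((ln T)\<^sup>2)\<^sup>2 * (F 1 - F (- 1)) * (5 * K) powr \<gamma>
      * (t * T) powr (- ((\<alpha> - \<gamma>) * (1 / \<alpha> - q))) < \<delta> / 4"
  proof (rule order_tendstoD)
    have "((\<lambda>T. ((ln T)\<^sup>2)\<^sup>2 * (t * T) powr (- ((\<alpha> - \<gamma>) * (1 / \<alpha> - q)))) \<longlongrightarrow> 0) at_top"
      using t(1) expo(4) by real_asymp
    from tendsto_mult_left[OF this, of "8 * (F 1 - F (- 1)) * (5 * K) powr \<gamma>"]
    show "((\<lambda>T. 8 * ((ln T)\<^sup>2)\<^sup>2 * (F 1 - F (- 1)) * (5 * K) powr \<gamma>
        * (t * T) powr (- ((\<alpha> - \<gamma>) * (1 / \<alpha> - q)))) \<longlongrightarrow> 0) at_top"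
      by (simp only: mult.left_commute mult.assoc mult_zero_right)
  qed (use t in simp)
  ultimately show ?thesis
    using eventually_gt_at_top[of 1]
  proof eventually_elim
    case (elim T)
    define \<tau> where "\<tau> = t * T"
    define \<sigma> where "\<sigma> = (ln T)\<^sup>2"
    have \<tau>: "0 < \<tau>" "2 * t\<^sub>0 \<le> \<tau>"
      using elim t by (auto simp: \<tau>_def)
    have \<sigma>: "0 < \<sigma>"
      using elim by (simp add: \<sigma>_def)
    have r: "\<sigma> * \<tau> powr (q * \<alpha> - 1) \<le> 1 / 2"
      using elim by (simp add: \<tau>_def \<sigma>_def)
    have "window_start \<alpha> q \<sigma> \<tau> = \<tau> * (1 - \<sigma> * \<tau> powr (q * \<alpha> - 1))"
      using \<tau> by (simp add: window_start_def powr_diff field_simps)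
    \<comment> \<open>The window keeps to the second half of \<open>[0, \<tau>]\<close>, hence after
      \<open>t\<^sub>0\<close>.\<close>
    moreover have "\<tau> * (1 / 2) \<le> \<tau> * (1 - \<sigma> * \<tau> powr (q * \<alpha> - 1))"
      using \<tau> r by (intro mult_left_mono) auto
    ultimately have start: "t\<^sub>0 \<le> window_start \<alpha> q \<sigma> \<tau>"
      using \<tau> by linarith
    have V_meas[measurable]: "V \<tau> \<in> borel_measurable M"
      using V(1) \<tau> t0 by (simp add: additive_sde_solution_def)
    have [measurable]: "(\<lambda>\<omega>. window_euler F \<alpha> q \<sigma> \<tau> (\<lambda>s. L s \<omega>) n) \<in> borel_measurable M" for n
      using \<sigma> \<tau> start t0 by (intro borel_measurable_window_euler levy mono F(1)) auto
    define c where "c = \<tau> powr (1 / \<alpha>)"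
    have c: "0 < c" "c powr \<alpha> = \<tau>"
      using \<tau> par by (auto simp: c_def powr_powr)
    have scale: "distr M borel (L (\<tau> * s)) = distr M borel (\<lambda>\<omega>. c * L s \<omega>)" if "0 \<le> s" for s
      using stable_levy_process_scaling[OF L L par(1) a that c(1)] c(2) by simp
    define G where "G = space M - {\<omega> \<in> space M. \<exists>s\<in>{0..\<tau>}. c * K < \<bar>L s \<omega>\<bar>}"
    have bad: "{\<omega> \<in> space M. \<exists>s\<in>{0..\<tau>}. c * K < \<bar>L s \<omega>\<bar>} \<in> events"
      "prob {\<omega> \<in> space M. \<exists>s\<in>{0..\<tau>}. c * K < \<bar>L s \<omega>\<bar>} < p"
      using levy_process_sup_distr[OF levy scale \<tau>(1) c(1), of K] K(2) by auto
    have "space M - G = {\<omega> \<in> space M. \<exists>s\<in>{0..\<tau>}. c * K < \<bar>L s \<omega>\<bar>}"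
      by (auto simp: G_def)
    then have G: "G \<in> events" "prob (space M - G) < p"
      using bad by (auto simp: G_def)
    have "\<forall>\<^sub>F n in sequentially. prob {\<omega> \<in> space M.
      \<delta> \<le> \<bar>\<tau> powr (- q) * V \<tau> \<omega> - window_euler F \<alpha> q \<sigma> \<tau> (\<lambda>s. L s \<omega>) n\<bar>} < p"
    proof (rule eventually_prob_le[OF _ G])
      show "AE \<omega> in M. \<omega> \<in> G \<longrightarrow> (\<forall>\<^sub>F n in sequentially.
        \<bar>\<tau> powr (- q) * V \<tau> \<omega> - window_euler F \<alpha> q \<sigma> \<tau> (\<lambda>s. L s \<omega>) n\<bar> < \<delta>)"
        using additive_sde_solution_integral_equation[OF V(1)] V(2) AE_space
      proof (eventually_elim, intro impI)
        fix \<omega>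
        assume sol: "\<forall>t\<ge>t\<^sub>0. set_integrable lborel {t\<^sub>0..t} (\<lambda>s. s powr - \<beta> * F (V s \<omega>)) \<and>
            V t \<omega> = V t\<^sub>0 \<omega> + (L t \<omega> - L t\<^sub>0 \<omega>) - (LINT s:{t\<^sub>0..t}|lborel. s powr - \<beta> * F (V s \<omega>))"
          and v0: "V t\<^sub>0 \<omega> = v\<^sub>0" and \<omega>: "\<omega> \<in> space M" "\<omega> \<in> G"
        have int: "set_integrable lborel {t\<^sub>0..t} (\<lambda>s. s powr - \<beta> * F (V s \<omega>))" if "t\<^sub>0 \<le> t" for t
          using sol that by blast
        have eq: "V t \<omega> = V t\<^sub>0 \<omega> + (L t \<omega> - L t\<^sub>0 \<omega>) - (LINT s:{t\<^sub>0..t}|lborel. s powr - \<beta> * F (V s \<omega>))" if "t\<^sub>0 \<le> t" for t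
          using sol that by blast
        have Lb: "\<bar>L s \<omega>\<bar> \<le> K * \<tau> powr (1 / \<alpha>)" if "0 \<le> s" "s \<le> \<tau>" for s
          using \<omega> that by (auto simp: G_def c_def not_less mult.commute)
        have "\<bar>V t\<^sub>0 \<omega>\<bar> \<le> K * \<tau> powr (1 / \<alpha>)"
          using elim v0 by (simp add: \<tau>_def)
        from kinetic_window_error[OF par(1,2,4-6) F levy_processD(4)[OF levy \<omega>(1)] t0 int eq \<sigma> \<tau>(1) r start K(1) this Lb,
            of "\<delta> / 4" "\<delta> / 4"]
        have "\<forall>\<^sub>F n in sequentially. \<bar>\<tau> powr (- q) * V \<tau> \<omega> - window_euler F \<alpha> q \<sigma> \<tau> (\<lambda>s. L s \<omega>) n\<bar>
          \<le> \<delta> / 4 + exp (- (k * \<sigma>)) * (5 * K * \<tau> powr (1 / \<alpha> - q))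
            + 8 * \<sigma>\<^sup>2 * (F 1 - F (- 1)) * (5 * K) powr \<gamma> * \<tau> powr (- ((\<alpha> - \<gamma>) * (1 / \<alpha> - q))) + \<delta> / 4"
          using t unfolding k_def by simp
        then show "\<forall>\<^sub>F n in sequentially.
          \<bar>\<tau> powr (- q) * V \<tau> \<omega> - window_euler F \<alpha> q \<sigma> \<tau> (\<lambda>s. L s \<omega>) n\<bar> < \<delta>"
        proof eventually_elim
          case (elim n)
          then show ?case
            using \<open>exp (- (k * (ln T)\<^sup>2)) * (5 * K * (t * T) powr (1 / \<alpha> - q)) < \<delta> / 4\<close>
              \<open>8 * ((ln T)\<^sup>2)\<^sup>2 * (F 1 - F (- 1)) * (5 * K) powr \<gamma> * (t * T) powr (- ((\<alpha> - \<gamma>) * (1 / \<alpha> - q))) < \<delta> / 4\<close>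
            unfolding \<tau>_def \<sigma>_def by linarith
        qed
      qed
    qed measurable
    then show ?case
      using start unfolding \<tau>_def \<sigma>_def by blast
  qed
qed

text \<open>Here the coefficient is constantly 1, so no freezing error occurs, and the start is
  \<open>H 0\<close>, whose size does not depend on \<sigma>: its bound \<open>m\<close> is chosen
  before \<sigma>. The trivial \<open>1 *\<close> and \<open>0 +\<close> fit the form of the grid
  functionals.\<close>

lemma stationary_euler_prob:
  fixes F :: "real \<Rightarrow> real" and \<gamma> \<delta> p :: real
  assumes \<gamma>: "1 \<le> \<gamma>"
    and F: "continuous_on UNIV F" "\<And>v c. 0 < c \<Longrightarrow> F (c * v) = c powr \<gamma> * F v" "\<And>v. 0 \<le> v * F v"
    and two_sided: "0 < F 1" "F (- 1) < 0"
    and R: "levy_process M R" and H: "additive_sde_solution M 0 (\<lambda>_ h. - F h) R H"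
    and "0 < \<delta>" "0 < p"
  shows "\<forall>\<^sub>F \<sigma> in at_top. \<forall>\<^sub>F n in sequentially. measure M {\<omega> \<in> space M. \<delta> \<le>
    \<bar>implicit_euler F (\<sigma> / real n) 0 (\<lambda>k. 1 * (R (0 + real (Suc k) * (\<sigma> / real n)) \<omega>
      - R (0 + real k * (\<sigma> / real n)) \<omega>)) n - H \<sigma> \<omega>\<bar>} < p"
proof -
  interpret prob_space M
    using R by (rule levy_processD)
  have mono: "mono F"
    by (rule homogeneous_mono[OF \<gamma> F(2,3)])
  define k where "k = min (F 1) (- F (- 1)) * 2 powr (- \<gamma>) * (\<delta> / 4) powr (\<gamma> - 1)"
  have k: "0 < k"
    using two_sided \<open>0 < \<delta>\<close> by (simp add: k_def)
  have H_meas: "H t \<in> borel_measurable M" if "0 \<le> t" for t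
    using H that by (simp add: additive_sde_solution_def)
  note [measurable] = H_meas[OF order_refl]
  have "(\<lambda>n. prob {\<omega> \<in> space M. real n < \<bar>H 0 \<omega>\<bar>}) \<longlonglongrightarrow> prob (\<Inter>n. {\<omega> \<in> space M. real n < \<bar>H 0 \<omega>\<bar>})"
    by (rule finite_Lim_measure_decseq) (auto simp: decseq_def)
  moreover have "(\<Inter>n. {\<omega> \<in> space M. real n < \<bar>H 0 \<omega>\<bar>}) = {}"
    using real_arch_simple by (auto simp: set_eq_iff not_less)
  ultimately have "(\<lambda>n. prob {\<omega> \<in> space M. real n < \<bar>H 0 \<omega>\<bar>}) \<longlonglongrightarrow> 0"
    by simp
  then have "\<forall>\<^sub>F n in sequentially. prob {\<omega> \<in> space M. real n < \<bar>H 0 \<omega>\<bar>} < p"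
    using \<open>0 < p\<close> by (rule order_tendstoD)
  then obtain m where m: "prob {\<omega> \<in> space M. real m < \<bar>H 0 \<omega>\<bar>} < p"
    by (auto dest: eventually_happens)
  have "filterlim (\<lambda>\<sigma>. exp (k * \<sigma>) * (\<delta> / 4)) at_top at_top"
    using k \<open>0 < \<delta>\<close> by real_asymp
  then have "\<forall>\<^sub>F \<sigma> in at_top. real m \<le> exp (k * \<sigma>) * (\<delta> / 4)"
    by (simp add: filterlim_at_top)
  then show ?thesis
    using eventually_gt_at_top[of 0]
  proof eventually_elim
    case (elim \<sigma>)
    then have \<sigma>: "0 < \<sigma>"
      by simp
    let ?E = "\<lambda>n \<omega>. implicit_euler F (\<sigma> / real n) 0 (\<lambda>k. 1 * (R (0 + real (Suc k) * (\<sigma> / real n)) \<omega>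
      - R (0 + real k * (\<sigma> / real n)) \<omega>)) n"
    have [measurable]: "?E n \<in> borel_measurable M" for n
      using \<sigma> by (intro borel_measurable_levy_process_euler R mono F(1)) auto
    have [measurable]: "H \<sigma> \<in> borel_measurable M"
      using \<sigma> by (intro H_meas) simp
    define G where "G = {\<omega> \<in> space M. \<bar>H 0 \<omega>\<bar> \<le> real m}"
    have "space M - G = {\<omega> \<in> space M. real m < \<bar>H 0 \<omega>\<bar>}"
      by (auto simp: G_def)
    then have G: "G \<in> events" "prob (space M - G) < p"
      using m by (auto simp: G_def)
    show ?case
    proof (rule eventually_prob_le[OF _ G])
      have H': "additive_sde_solution M 0 (\<lambda>t v. - (1 * F v)) R H"
        using H by simp
      show "AE \<omega> in M. \<omega> \<in> G \<longrightarrow> (\<forall>\<^sub>F n in sequentially. \<bar>?E n \<omega> - H \<sigma> \<omega>\<bar> < \<delta>)"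
        using additive_sde_solution_integral_equation[OF H'] AE_space
      proof (eventually_elim, intro impI)
        fix \<omega>
        let ?y = "\<lambda>t. H t \<omega>" and ?l = "\<lambda>t. R t \<omega>"
        assume sol: "\<forall>t\<ge>0. set_integrable lborel {0..t} (\<lambda>s. 1 * F (?y s)) \<and>
            ?y t = ?y 0 + (?l t - ?l 0) - (LINT s:{0..t}|lborel. 1 * F (?y s))"
          and \<omega>: "\<omega> \<in> space M" "\<omega> \<in> G"
        have int: "set_integrable lborel {0..t} (\<lambda>s. 1 * F (?y s))" if "0 \<le> t" for t
          using sol that by blast
        have eq: "?y t = ?y 0 + (?l t - ?l 0) - (LINT s:{0..t}|lborel. 1 * F (?y s))" if "0 \<le> t" for t
          using sol that by blast
        have l: "cadlag ?l"
          by (rule levy_processD(4)[OF R \<omega>(1)])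
        have "\<forall>\<^sub>F n in sequentially.
          \<bar>?y \<sigma> - implicit_euler F (1 * ((\<sigma> - 0) / real n)) 0
            (\<lambda>j. ?l (0 + real (Suc j) * ((\<sigma> - 0) / real n)) - ?l (0 + real j * ((\<sigma> - 0) / real n))) n\<bar>
          \<le> \<delta> / 4 + exp (- (k * 1 * (\<sigma> - 0))) * \<bar>?y 0 - 0\<bar>
            + (LINT u:{0<..\<sigma>}|lborel. \<bar>1 - 1\<bar> * \<bar>F (?y u)\<bar>) + \<delta> / 4"
        proof (rule implicit_euler_solution_limit[OF mono F(1) l order_refl int eq order_refl \<sigma>])
          show "k * (u - v - \<delta> / 4) \<le> F u - F v" if "v \<le> u" for u v
            unfolding k_def by (rule homogeneous_dissipative[OF \<gamma> F(2,3) that]) (use \<open>0 < \<delta>\<close> in auto)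
        qed (use k \<open>0 < \<delta>\<close> in auto)
        moreover have "exp (- (k * 1 * (\<sigma> - 0))) * \<bar>?y 0 - 0\<bar> \<le> \<delta> / 4"
        proof -
          have "\<bar>?y 0\<bar> \<le> exp (k * \<sigma>) * (\<delta> / 4)"
            using \<omega> elim by (simp add: G_def)
          then have "exp (- (k * \<sigma>)) * \<bar>?y 0\<bar> \<le> exp (- (k * \<sigma>)) * (exp (k * \<sigma>) * (\<delta> / 4))"
            by (intro mult_left_mono) auto
          also have "\<dots> = \<delta> / 4"
            by (simp add: exp_minus)
          finally show ?thesis
            by simp
        qed
        ultimately show "\<forall>\<^sub>F n in sequentially. \<bar>?E n \<omega> - ?y \<sigma>\<bar> < \<delta>"
        proof (elim eventually_mono)
          fix n
          assume "\<bar>?y \<sigma> - implicit_euler F (1 * ((\<sigma> - 0) / real n)) 0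
            (\<lambda>j. ?l (0 + real (Suc j) * ((\<sigma> - 0) / real n)) - ?l (0 + real j * ((\<sigma> - 0) / real n))) n\<bar>
          \<le> \<delta> / 4 + exp (- (k * 1 * (\<sigma> - 0))) * \<bar>?y 0 - 0\<bar>
            + (LINT u:{0<..\<sigma>}|lborel. \<bar>1 - 1\<bar> * \<bar>F (?y u)\<bar>) + \<delta> / 4"
          moreover have "(LINT u:{0<..\<sigma>}|lborel. \<bar>1 - 1\<bar> * \<bar>F (?y u)\<bar>) = 0"
            by (simp add: set_lebesgue_integral_def)
          ultimately have "\<bar>?E n \<omega> - ?y \<sigma>\<bar> \<le> \<delta> / 4 + \<delta> / 4 + \<delta> / 4"
            using \<open>exp (- (k * 1 * (\<sigma> - 0))) * \<bar>?y 0 - 0\<bar> \<le> \<delta> / 4\<close>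
            unfolding mult_1 diff_0_right abs_minus_commute[of "?y \<sigma>"] by linarith
          then show "\<bar>?E n \<omega> - ?y \<sigma>\<bar> < \<delta>"
            using \<open>0 < \<delta>\<close> by linarith
        qed
      qed
    qed measurable
  qed
qed

text \<open>Self-similarity with \<open>c = \<tau> powr q\<close>: the increment of \<open>L\<close>
  over one step of length \<open>\<sigma> * \<tau> powr (q * \<alpha>) / n\<close>, divided by
  \<open>c\<close>, has the law of \<open>R\<close> at time \<open>\<sigma> / n\<close>. Hence the
  law is the same for all windows.\<close>

lemma window_euler_law:
  assumes L: "stable_levy_process M \<alpha> a\<^sub>p a\<^sub>m L" and R: "stable_levy_process M' \<alpha> a\<^sub>p a\<^sub>m R"
    and a: "1 < \<alpha>" "0 \<le> a\<^sub>p" "0 \<le> a\<^sub>m" and F: "mono F" "continuous_on UNIV F"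
    and \<sigma>: "0 \<le> \<sigma>" "0 < \<tau>" "0 \<le> window_start \<alpha> q \<sigma> \<tau>" "0 < n"
  shows "distr M borel (\<lambda>\<omega>. window_euler F \<alpha> q \<sigma> \<tau> (\<lambda>s. L s \<omega>) n)
    = distr M' borel (\<lambda>\<omega>. implicit_euler F (\<sigma> / real n) 0
        (\<lambda>k. 1 * (R (0 + real (Suc k) * (\<sigma> / real n)) \<omega> - R (0 + real k * (\<sigma> / real n)) \<omega>)) n)"
  unfolding window_euler_def
proof (rule levy_process_grid_functional_distr)
  show levy: "levy_process M L" "levy_process M' R"
    using L R by (auto simp: stable_levy_process_def Let_def)
  let ?h = "\<sigma> * \<tau> powr (q * \<alpha>) / real n"
  have h: "(\<tau> powr q) powr \<alpha> * (\<sigma> / real n) = ?h"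
    by (simp add: powr_powr)
  have meas: "L ?h \<in> borel_measurable M" "R (\<sigma> / real n) \<in> borel_measurable M'"
    using \<sigma> by (auto intro!: levy_processD(2)[OF levy(1)] levy_processD(2)[OF levy(2)])
  have "distr M borel (L ?h) = distr M' borel (\<lambda>\<omega>. \<tau> powr q * R (\<sigma> / real n) \<omega>)"
    using stable_levy_process_scaling[OF L R a, of "\<sigma> / real n" "\<tau> powr q"] \<sigma> unfolding h by simp
  then have "distr (distr M borel (L ?h)) borel (\<lambda>x. \<tau> powr (- q) * x)
      = distr (distr M' borel (\<lambda>\<omega>. \<tau> powr q * R (\<sigma> / real n) \<omega>)) borel (\<lambda>x. \<tau> powr (- q) * x)"
    by simp
  then have "distr M borel (\<lambda>\<omega>. \<tau> powr (- q) * L ?h \<omega>) = distr M' borel (\<lambda>\<omega>. \<tau> powr (- q) * (\<tau> powr q * R (\<sigma> / real n) \<omega>))"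
    using meas by (simp add: distr_distr comp_def)
  moreover have "\<tau> powr (- q) * (\<tau> powr q * x) = 1 * x" for x
    using \<sigma> by (simp add: powr_minus)
  ultimately show "distr M borel (\<lambda>\<omega>. \<tau> powr (- q) * L ?h \<omega>) = distr M' borel (\<lambda>\<omega>. 1 * R (\<sigma> / real n) \<omega>)"
    by simp
  show "(\<lambda>\<xi>. implicit_euler F (\<sigma> / real n) 0 \<xi> n) \<in> borel_measurable (\<Pi>\<^sub>M k\<in>{..<n}. borel)"
    using \<sigma> by (intro borel_measurable_implicit_euler F measurable_component_singleton) auto
  show "implicit_euler F (\<sigma> / real n) 0 (restrict \<xi> {..<n}) n = implicit_euler F (\<sigma> / real n) 0 \<xi> n" for \<xi>
    by (rule implicit_euler_cong) simp
qed (use \<sigma> in auto)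

text \<open>The space factor \<open>(t * T) powr (- q)\<close> differs from window to window, so it
  is made part of the functional, which may depend on the window.\<close>

lemma window_euler_indep:
  assumes L: "levy_process M L" and F: "mono F" "continuous_on UNIV F" and S: "finite S" "S \<subseteq> {0<..}"
    and \<sigma>: "0 \<le> \<sigma>" "0 < T" "0 < n"
    and start: "\<And>t. t \<in> S \<Longrightarrow> 0 \<le> window_start \<alpha> q \<sigma> (t * T)"
    and disj: "\<And>s t. s \<in> S \<Longrightarrow> t \<in> S \<Longrightarrow> s < t \<Longrightarrow> s * T \<le> window_start \<alpha> q \<sigma> (t * T)"
  shows "prob_space.indep_vars M (\<lambda>_. borel) (\<lambda>t \<omega>. window_euler F \<alpha> q \<sigma> (t * T) (\<lambda>s. L s \<omega>) n) S"
proof -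
  have "prob_space.indep_vars M (\<lambda>_. borel) (\<lambda>t \<omega>.
    (\<lambda>\<xi>. implicit_euler F (\<sigma> / real n) 0 (\<lambda>k. (t * T) powr (- q) * \<xi> k) n)
    (\<lambda>k. L (window_start \<alpha> q \<sigma> (t * T) + real (Suc k) * (\<sigma> * (t * T) powr (q * \<alpha>) / real n)) \<omega>
      - L (window_start \<alpha> q \<sigma> (t * T) + real k * (\<sigma> * (t * T) powr (q * \<alpha>) / real n)) \<omega>)) S"
  proof (rule levy_process_windows_indep[OF L S(1)])
    show "window_start \<alpha> q \<sigma> (s * T) + real n * (\<sigma> * (s * T) powr (q * \<alpha>) / real n) \<le> window_start \<alpha> q \<sigma> (t * T)"
      if "s \<in> S" "t \<in> S" "s < t" for s t
      using disj[OF that] \<sigma> by (simp add: window_start_def)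
    show "(\<lambda>\<xi>. implicit_euler F (\<sigma> / real n) 0 (\<lambda>k. (t * T) powr (- q) * \<xi> k) n) \<in> borel_measurable (\<Pi>\<^sub>M k\<in>{..<n}. borel)" for t
    proof (rule borel_measurable_implicit_euler[OF F])
      fix k assume "k < n"
      then have [measurable]: "(\<lambda>\<xi>. \<xi> k) \<in> borel_measurable (\<Pi>\<^sub>M k\<in>{..<n}. borel :: real measure)"
        by (intro measurable_component_singleton) auto
      show "(\<lambda>\<xi>. (t * T) powr (- q) * \<xi> k) \<in> borel_measurable (\<Pi>\<^sub>M k\<in>{..<n}. borel)"
        by measurable
    qed (use \<sigma> in simp)
    show "implicit_euler F (\<sigma> / real n) 0 (\<lambda>k. (t * T) powr (- q) * restrict \<xi> {..<n} k) n
      = implicit_euler F (\<sigma> / real n) 0 (\<lambda>k. (t * T) powr (- q) * \<xi> k) n" for t \<xi>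
      by (rule implicit_euler_cong) simp
  qed (use \<sigma> start in auto)
  then show ?thesis
    by (simp only: window_euler_def)
qed

section \<open>Convergence of the finite-dimensional laws\<close>

lemma continuous_map_scaled:
  assumes "continuous_map (product_topology (\<lambda>_. euclideanreal) S) euclideanreal f"
  shows "continuous_map (product_topology (\<lambda>_. euclideanreal) S) euclideanreal (\<lambda>u. f (\<lambda>t\<in>S. c t * u t))"
proof -
  have "continuous_map (product_topology (\<lambda>_. euclideanreal) S) (product_topology (\<lambda>_. euclideanreal) S)
      (\<lambda>u. \<lambda>t\<in>S. c t * u t)"
    unfolding continuous_map_componentwise
    by (auto intro!: continuous_map_real_mult continuous_map_product_projection)
  from continuous_map_compose[OF this assms] show ?thesis
    by (simp add: comp_def)
qed

theorem theorem2p5: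
  fixes \<alpha> \<beta> \<gamma> q a\<^sub>p a\<^sub>m t\<^sub>0 v\<^sub>0 x\<^sub>0 :: real
    and F :: "real \<Rightarrow> real"
    and M :: "'a measure" and L V X :: "real \<Rightarrow> 'a \<Rightarrow> real"
    and M' :: "'b measure" and R H :: "real \<Rightarrow> 'b \<Rightarrow> real"
    and Pi_F :: "real measure"
    and M'' :: "'c measure" and VV :: "real \<Rightarrow> 'c \<Rightarrow> real"
  assumes "1 < \<alpha>" "\<alpha> < 2" "1 \<le> \<gamma>" "\<gamma> < \<alpha>" "0 \<le> \<beta>" "\<beta> < 1 + (\<gamma> - 1) / \<alpha>"
    and "0 \<le> a\<^sub>p" "0 \<le> a\<^sub>m"
    and "continuous_on UNIV F"
    and "\<And>v c. 0 < c \<Longrightarrow> F (c * v) = c powr \<gamma> * F v"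
    and "\<And>v. 0 \<le> v * F v"
    and "stable_levy_process M \<alpha> a\<^sub>p a\<^sub>m L"
    and "0 < t\<^sub>0" "0 < v\<^sub>0"
    and "kinetic_solution M t\<^sub>0 v\<^sub>0 x\<^sub>0 \<beta> F L V X"
    and "q = \<beta> / (\<alpha> + \<gamma> - 1)"
    and "stable_levy_process M' \<alpha> a\<^sub>p a\<^sub>m R"
    and "ergodic_solution M' R F Pi_F H"
    and "prob_space M''"
    and "\<And>t. 0 \<le> t \<Longrightarrow> VV t \<in> borel_measurable M''"
    and "\<And>S. finite S \<Longrightarrow> S \<subseteq> {0<..} \<Longrightarrow> fdd M'' VV S = scaled_product Pi_F q S"
  shows "q < 1 / \<alpha> \<and> fdd_converges M (\<lambda>\<epsilon> t \<omega>. \<epsilon> powr q * V (t / \<epsilon>) \<omega>) M'' VV"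
proof
  note par = assms(1-6) and a = assms(7,8) and F = assms(9-11) and L = assms(12) and t0 = assms(13)
    and R = assms(17) and erg = assms(18)
  have levy: "levy_process M L" "levy_process M' R"
    using L R by (auto simp: stable_levy_process_def Let_def)
  interpret M: prob_space M
    using levy(1) by (rule levy_processD)
  interpret M': prob_space M'
    using levy(2) by (rule levy_processD)
  have \<beta>: "\<beta> = q * (\<alpha> + \<gamma> - 1)"
    using par assms(16) by simp
  have "\<beta> * \<alpha> < \<alpha> + \<gamma> - 1"
    using par by (simp add: field_simps)
  then show q: "q < 1 / \<alpha>"
    using par unfolding assms(16) by (simp add: field_simps)
  have "(\<gamma> - 1) / \<alpha> \<le> 1"
    using par by (simp add: field_simps)
  then have \<beta>2: "\<beta> \<le> 2"
    using par by linarith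
  have mono: "mono F"
    by (rule homogeneous_mono[OF par(3) F(2,3)])
  have two_sided: "0 < F 1" "F (- 1) < 0"
    using ergodic_solution_two_sided[OF R par(1) a erg par(3) F(2,3,1)] by auto
  have V: "additive_sde_solution M t\<^sub>0 (\<lambda>t v. - (t powr (- \<beta>) * F v)) L V" "AE \<omega> in M. V t\<^sub>0 \<omega> = v\<^sub>0"
    using assms(15) by (auto simp: kinetic_solution_def)
  have V_meas: "V t \<in> borel_measurable M" if "t\<^sub>0 \<le> t" for t
    using V(1) that by (simp add: additive_sde_solution_def)
  have H: "additive_sde_solution M' 0 (\<lambda>_ h. - F h) R H"
    using erg by (simp add: ergodic_solution_def)
  have \<mu>: "prob_space Pi_F" "sets Pi_F = sets borel"
    using erg by (auto simp: ergodic_solution_def invariant_measure_def)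
  show "fdd_converges M (\<lambda>\<epsilon> t \<omega>. \<epsilon> powr q * V (t / \<epsilon>) \<omega>) M'' VV"
    unfolding fdd_converges_def converges_weakly_def
  proof (intro allI impI)
    fix S :: "real set" and f :: "(real \<Rightarrow> real) \<Rightarrow> real"
    let ?T = "product_topology (\<lambda>_. euclideanreal) S"
    assume S: "finite S" "S \<subseteq> {0<..}" and f: "continuous_map ?T euclideanreal f" and "bounded (f ` topspace ?T)"
    then obtain C0 where C0: "\<forall>x\<in>f ` topspace ?T. norm x \<le> C0"
      by (auto simp: bounded_iff)
    define C where "C = max C0 0"
    have C: "\<bar>f u\<bar> \<le> C" if "u \<in> extensional S" for u
      using C0 that by (auto simp: C_def PiE_def)
    note [measurable] = continuous_map_borel_measurable_PiM[OF S(1) f]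
    \<comment> \<open>The linear map of the limit is moved into the test function, so that the
      vector to be compared has the plain product of copies of \<open>Pi_F\<close> as limit
      law.\<close>
    define g where "g = (\<lambda>u. f (\<lambda>t\<in>S. t powr q * u t))"
    have g: "continuous_map ?T euclideanreal g"
      unfolding g_def by (rule continuous_map_scaled[OF f])
    have gC: "\<bar>g u\<bar> \<le> C" if "u \<in> extensional S" for u
      unfolding g_def by (rule C) simp
    define \<mu>S where "\<mu>S = (\<Pi>\<^sub>M t\<in>S. Pi_F)"
    have \<mu>S: "prob_space \<mu>S" "sets \<mu>S = sets (\<Pi>\<^sub>M t\<in>S. borel)"
      using \<mu> by (auto simp: \<mu>S_def intro!: prob_space_PiM sets_PiM_cong)
    have scaled: "(\<integral>u. f u \<partial>fdd M'' VV S) = (\<integral>u. g u \<partial>\<mu>S)"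
    proof -
      have "(\<lambda>u. \<lambda>t\<in>S. t powr q * u t) \<in> measurable (\<Pi>\<^sub>M t\<in>S. Pi_F) (\<Pi>\<^sub>M t\<in>S. borel)"
        using \<mu>(2) by measurable
      then show ?thesis
        unfolding assms(21)[OF S] scaled_product_def \<mu>S_def g_def by (rule integral_distr) measurable
    qed
    \<comment> \<open>As \<open>\<epsilon> powr q = t powr q * (t / \<epsilon>) powr (- q)\<close>,
      the given normalisation is that of the window ending at \<open>t / \<epsilon>\<close> followed
      by the map inside \<open>g\<close>.\<close>
    have fdd_eq: "(\<integral>u. f u \<partial>fdd M (\<lambda>t \<omega>. \<epsilon> powr q * V (t / \<epsilon>) \<omega>) S)
        = (\<integral>\<omega>. g (\<lambda>t\<in>S. (t * inverse \<epsilon>) powr (- q) * V (t * inverse \<epsilon>) \<omega>) \<partial>M)"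
      if \<epsilon>: "0 < \<epsilon>" "\<And>t. t \<in> S \<Longrightarrow> t\<^sub>0 \<le> t * inverse \<epsilon>" for \<epsilon>
    proof -
      have meas: "(\<lambda>\<omega>. \<lambda>t\<in>S. \<epsilon> powr q * V (t / \<epsilon>) \<omega>) \<in> measurable M (\<Pi>\<^sub>M t\<in>S. borel)"
      proof (rule measurable_restrict)
        fix t assume "t \<in> S"
        then have [measurable]: "V (t / \<epsilon>) \<in> borel_measurable M"
          using \<epsilon>(2) by (intro V_meas) (simp add: divide_inverse)
        show "(\<lambda>\<omega>. \<epsilon> powr q * V (t / \<epsilon>) \<omega>) \<in> borel_measurable M"
          by measurable
      qed
      have pow: "t powr q * ((t * inverse \<epsilon>) powr (- q) * x) = \<epsilon> powr q * x" if "t \<in> S" for t x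
      proof -
        have "0 < t"
          using that S by auto
        have "(t * inverse \<epsilon>) powr (- q) = t powr (- q) * inverse \<epsilon> powr (- q)"
          using \<open>0 < t\<close> \<epsilon>(1) by (intro powr_mult)
        also have "inverse \<epsilon> powr (- q) = \<epsilon> powr q"
          using \<epsilon>(1) by (simp add: powr_minus inverse_powr)
        also have "t powr (- q) = inverse (t powr q)"
          by (rule powr_minus)
        finally show ?thesis
          using \<open>0 < t\<close> by simp
      qed
      have "(\<integral>u. f u \<partial>fdd M (\<lambda>t \<omega>. \<epsilon> powr q * V (t / \<epsilon>) \<omega>) S) = (\<integral>\<omega>. f (\<lambda>t\<in>S. \<epsilon> powr q * V (t / \<epsilon>) \<omega>) \<partial>M)"
        unfolding fdd_def using meas by (rule integral_distr) measurable
      also have "(\<lambda>\<omega>. f (\<lambda>t\<in>S. \<epsilon> powr q * V (t / \<epsilon>) \<omega>))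
          = (\<lambda>\<omega>. g (\<lambda>t\<in>S. (t * inverse \<epsilon>) powr (- q) * V (t * inverse \<epsilon>) \<omega>))"
        unfolding g_def
        by (intro ext arg_cong[where f = f] restrict_ext) (simp add: pow divide_inverse)
      finally show ?thesis .
    qed
    have main: "\<forall>\<^sub>F T in at_top. (\<forall>t\<in>S. t\<^sub>0 \<le> t * T) \<and>
        \<bar>(\<integral>\<omega>. g (\<lambda>t\<in>S. (t * T) powr (- q) * V (t * T) \<omega>) \<partial>M) - (\<integral>u. g u \<partial>\<mu>S)\<bar> < e" if "0 < e" for e
    \<comment> \<open>The coupling estimate asks for a nonempty index set; for the empty one both
      integrals are the value of \<open>g\<close> at the only point.\<close>
    proof (cases "S = {}")
      case True
      have "restrict h {} = (\<lambda>_. undefined)" for h :: "real \<Rightarrow> real"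
        by (simp add: restrict_def)
      then show ?thesis
        using True \<open>0 < e\<close> M.prob_space by (simp add: \<mu>S_def PiM_empty lebesgue_integral_count_space_finite)
    next
      case False
      \<comment> \<open>\<open>3 * e'\<close> is half of \<open>e\<close>, and \<open>p\<close>
        makes the probability term of the coupling estimate less than the other half;
        \<open>C + 1\<close> keeps the denominator positive when \<open>C = 0\<close>.\<close>
      define e' where "e' = e / 6"
      define p where "p = e / (20 * (C + 1) * real (card S))"
      have card: "0 < real (card S)"
        using S(1) False by (simp add: card_gt_0_iff)
      have C0: "0 \<le> C"
        by (simp add: C_def)
      have p: "0 < p" "10 * C * (real (card S) * p) < e / 2"
      proof -
        show "0 < p"
          using card C0 \<open>0 < e\<close> by (simp add: p_def)
        have "10 * C * (real (card S) * p) = (10 * C * e) / (20 * (C + 1))"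
          using card by (simp add: p_def)
        also have "\<dots> < e / 2"
        proof -
          have "10 * C * e < e / 2 * (20 * (C + 1))"
            using \<open>0 < e\<close> by (simp add: algebra_simps)
          then show ?thesis
            using C0 by (subst pos_divide_less_eq) auto
        qed
        finally show "10 * C * (real (card S) * p) < e / 2" .
      qed
      have e': "0 < e'"
        using \<open>0 < e\<close> by (simp add: e'_def)
      obtain \<delta>' where \<delta>': "0 < \<delta>'" "measure \<mu>S (oscillation_set S g \<delta>' e') < p"
        using oscillation_set_small[OF S(1) g \<mu>S e' p(1)] by blast
      \<comment> \<open>The coupling estimate uses oscillation sets of radius
        \<open>2 * \<delta>\<close>.\<close>
      define \<delta> where "\<delta> = \<delta>' / 2"
      have \<delta>: "0 < \<delta>" "measure \<mu>S (oscillation_set S g (2 * \<delta>) e') \<le> p"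
        using \<delta>' by (auto simp: \<delta>_def)
      have "\<forall>t\<in>S. \<forall>\<^sub>F T in at_top. t\<^sub>0 \<le> window_start \<alpha> q ((ln T)\<^sup>2) (t * T) \<and>
        (\<forall>\<^sub>F n in sequentially. measure M {\<omega> \<in> space M.
          \<delta> \<le> \<bar>(t * T) powr (- q) * V (t * T) \<omega> - window_euler F \<alpha> q ((ln T)\<^sup>2) (t * T) (\<lambda>s. L s \<omega>) n\<bar>} < p)"
        using S(2) \<delta>(1) p(1)
        by (intro ballI kinetic_window_prob[OF par(1,3,4,5) \<beta>2 \<beta> q a F two_sided L t0 V]) auto
      then have ev1: "\<forall>\<^sub>F T in at_top. \<forall>t\<in>S. t\<^sub>0 \<le> window_start \<alpha> q ((ln T)\<^sup>2) (t * T) \<and>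
        (\<forall>\<^sub>F n in sequentially. measure M {\<omega> \<in> space M.
          \<delta> \<le> \<bar>(t * T) powr (- q) * V (t * T) \<omega> - window_euler F \<alpha> q ((ln T)\<^sup>2) (t * T) (\<lambda>s. L s \<omega>) n\<bar>} < p)"
        using S(1) by (simp add: eventually_ball_finite)
      let ?E = "\<lambda>\<sigma> n \<omega>. implicit_euler F (\<sigma> / real n) 0 (\<lambda>k. 1 * (R (0 + real (Suc k) * (\<sigma> / real n)) \<omega>
          - R (0 + real k * (\<sigma> / real n)) \<omega>)) n"
      have "filterlim (\<lambda>T::real. (ln T)\<^sup>2) at_top at_top"
        by real_asymp
      note rate = this
      have ev2: "\<forall>\<^sub>F T in at_top. \<forall>\<^sub>F n in sequentially.
          measure M' {\<omega> \<in> space M'. \<delta> \<le> \<bar>?E ((ln T)\<^sup>2) n \<omega> - H ((ln T)\<^sup>2) \<omega>\<bar>} < p"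
        by (rule eventually_compose_filterlim[OF
              stationary_euler_prob[OF par(3) F two_sided levy(2) H \<delta>(1) p(1)] rate]) simp_all
      \<comment> \<open>The length of a window is of lower order than \<open>T\<close> because
        \<open>q * \<alpha> < 1\<close>, while the times \<open>s * T\<close> and
        \<open>t * T\<close> separate linearly; so the windows become disjoint.\<close>
      have "\<forall>s\<in>S. \<forall>t\<in>S. \<forall>\<^sub>F T in at_top. s < t \<longrightarrow> s * T \<le> window_start \<alpha> q ((ln T)\<^sup>2) (t * T)"
      proof (intro ballI)
        fix s t assume st: "s \<in> S" "t \<in> S"
        then have pos: "0 < s" "0 < t"
          using S by auto
        show "\<forall>\<^sub>F T in at_top. s < t \<longrightarrow> s * T \<le> window_start \<alpha> q ((ln T)\<^sup>2) (t * T)"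
        proof (cases "s < t")
          case True
          have "0 < 1 - q * \<alpha>"
            using q par(1) by (simp add: field_simps)
          then have "((\<lambda>T. (ln T)\<^sup>2 * (t * T) powr (- (1 - q * \<alpha>))) \<longlongrightarrow> 0) at_top"
            using pos by real_asymp
          then have "\<forall>\<^sub>F T in at_top. (ln T)\<^sup>2 * (t * T) powr (- (1 - q * \<alpha>)) < 1 - s / t"
            using True pos by (intro order_tendstoD) auto
          then show ?thesis
            using eventually_gt_at_top[of 0]
          proof eventually_elim
            case (elim T)
            have "0 < t * T"
              using pos elim by simp
            then have "window_start \<alpha> q ((ln T)\<^sup>2) (t * T) = (t * T) * (1 - (ln T)\<^sup>2 * (t * T) powr (- (1 - q * \<alpha>)))"
              by (simp add: window_start_def powr_diff field_simps)
            also have "\<dots> \<ge> (t * T) * (s / t)"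
              using elim \<open>0 < t * T\<close> by (intro mult_left_mono) auto
            finally show ?case
              using pos by (simp add: mult.commute)
          qed
        qed simp
      qed
      then have ev3: "\<forall>\<^sub>F T in at_top. \<forall>s\<in>S. \<forall>t\<in>S. s < t \<longrightarrow> s * T \<le> window_start \<alpha> q ((ln T)\<^sup>2) (t * T)"
        using S(1) by (simp add: eventually_ball_finite)
      show ?thesis
        using ev1 ev2 ev3 eventually_gt_at_top[of 1]
      proof eventually_elim
        case (elim T)
        define \<sigma> where "\<sigma> = (ln T)\<^sup>2"
        have \<sigma>: "0 < \<sigma>"
          using elim by (simp add: \<sigma>_def)
        have T: "0 < T" "\<And>t. t \<in> S \<Longrightarrow> 0 < t * T"
          using elim S by auto
        have start: "t\<^sub>0 \<le> window_start \<alpha> q \<sigma> (t * T)" if "t \<in> S" for t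
          using elim that by (simp add: \<sigma>_def)
        have late: "t\<^sub>0 \<le> t * T" if "t \<in> S" for t
        proof -
          have "window_start \<alpha> q \<sigma> (t * T) \<le> t * T"
            using \<sigma> by (simp add: window_start_def)
          then show ?thesis
            using start[OF that] by linarith
        qed
        have "\<forall>\<^sub>F n in sequentially. 0 < n \<and>
          (\<forall>t\<in>S. measure M {\<omega> \<in> space M.
            \<delta> \<le> \<bar>(t * T) powr (- q) * V (t * T) \<omega> - window_euler F \<alpha> q \<sigma> (t * T) (\<lambda>s. L s \<omega>) n\<bar>} < p) \<and>
          measure M' {\<omega> \<in> space M'. \<delta> \<le> \<bar>?E \<sigma> n \<omega> - H \<sigma> \<omega>\<bar>} < p"
          using elim S(1) unfolding \<sigma>_def
          by (intro eventually_conj eventually_gt_at_top eventually_ball_finite) auto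
        \<comment> \<open>\<open>T\<close> is fixed here, so finitely many conditions hold for all
          large \<open>n\<close>, and one step number serves all times of \<open>S\<close> and the
          stationary process.\<close>
        then obtain n where n: "0 < n"
          "\<And>t. t \<in> S \<Longrightarrow> measure M {\<omega> \<in> space M.
            \<delta> \<le> \<bar>(t * T) powr (- q) * V (t * T) \<omega> - window_euler F \<alpha> q \<sigma> (t * T) (\<lambda>s. L s \<omega>) n\<bar>} < p"
          "measure M' {\<omega> \<in> space M'. \<delta> \<le> \<bar>?E \<sigma> n \<omega> - H \<sigma> \<omega>\<bar>} < p"
          by (auto dest: eventually_happens)
        have H_law: "distr M' borel (H \<sigma>) = Pi_F"
          using \<sigma> by (intro ergodic_solution_marginal[OF erg]) simp
        have H_meas: "H \<sigma> \<in> borel_measurable M'"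
          using H \<sigma> by (simp add: additive_sde_solution_def)
        have E_meas: "?E \<sigma> n \<in> borel_measurable M'"
          using \<sigma> by (intro borel_measurable_levy_process_euler levy(2) mono F(1)) auto
        have "\<bar>(\<integral>\<omega>. g (\<lambda>t\<in>S. (t * T) powr (- q) * V (t * T) \<omega>) \<partial>M) - (\<integral>u. g u \<partial>(\<Pi>\<^sub>M t\<in>S. distr M' borel (H \<sigma>)))\<bar>
          \<le> 3 * e' + 10 * C * (real (card S) * p)"
        proof (rule indep_coupling_expectation[where Z = "\<lambda>t \<omega>. window_euler F \<alpha> q \<sigma> (t * T) (\<lambda>s. L s \<omega>) n"
              and X = "\<lambda>t \<omega>. (t * T) powr (- q) * V (t * T) \<omega>" and E = "?E \<sigma> n" and \<delta> = \<delta>,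
              OF S(1) False g gC M.prob_space_axioms M'.prob_space_axioms])
          show "(\<lambda>\<omega>. (t * T) powr (- q) * V (t * T) \<omega>) \<in> borel_measurable M" if "t \<in> S" for t
            using V_meas[OF late[OF that]] by simp
          show "M.indep_vars (\<lambda>_. borel) (\<lambda>t \<omega>. window_euler F \<alpha> q \<sigma> (t * T) (\<lambda>s. L s \<omega>) n) S"
            using \<sigma> T(1) n(1) elim start t0
            by (intro window_euler_indep[OF levy(1) mono F(1) S]) (auto simp: \<sigma>_def intro: order.trans)
          show "distr M borel (\<lambda>\<omega>. window_euler F \<alpha> q \<sigma> (t * T) (\<lambda>s. L s \<omega>) n) = distr M' borel (?E \<sigma> n)" if "t \<in> S" for t
            using \<sigma> T(2)[OF that] n(1) start[OF that] t0
            by (intro window_euler_law[OF L R par(1) a mono F(1)]) auto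
          show "measure (\<Pi>\<^sub>M t\<in>S. distr M' borel (H \<sigma>)) (oscillation_set S g (2 * \<delta>) e') \<le> p"
            using \<delta>(2) unfolding H_law \<mu>S_def .
        qed (use n e' \<delta> p E_meas H_meas in \<open>auto intro: less_imp_le\<close>)
        then have "\<bar>(\<integral>\<omega>. g (\<lambda>t\<in>S. (t * T) powr (- q) * V (t * T) \<omega>) \<partial>M) - (\<integral>u. g u \<partial>\<mu>S)\<bar> < e"
          using p(2) unfolding H_law \<mu>S_def e'_def by linarith
        then show ?case
          using late by blast
      qed
    qed
    show "((\<lambda>\<epsilon>. \<integral>u. f u \<partial>fdd M (\<lambda>t \<omega>. \<epsilon> powr q * V (t / \<epsilon>) \<omega>) S) \<longlongrightarrow> (\<integral>u. f u \<partial>fdd M'' VV S)) (at_right 0)"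
    proof (rule tendstoI)
      fix e :: real assume "0 < e"
      from eventually_compose_filterlim[OF main[OF this] filterlim_inverse_at_top_right]
      show "\<forall>\<^sub>F \<epsilon> in at_right 0. dist (\<integral>u. f u \<partial>fdd M (\<lambda>t \<omega>. \<epsilon> powr q * V (t / \<epsilon>) \<omega>) S) (\<integral>u. f u \<partial>fdd M'' VV S) < e"
        using eventually_at_right_less[of 0]
      proof eventually_elim
        case (elim \<epsilon>)
        then show ?case
          by (subst fdd_eq) (auto simp: scaled dist_real_def)
      qed
    qed
  qed
qed

end
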